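(* Let $n\geq 2$, let $\mu$ be a nonnegative Borel measure on the unit ball $\mathbb{B}^n$ such that $$\int_{\mathbb{B}^n}(1-|y|^2)^{n-1}\,d\mu(y)<\infty,$$ let $\phi\in L^1(\mathbb{S}^{n-1})$, and let $u=P_h[\phi]-G_h[\mu]$. Then $\Delta_h u=\mu$ in the weak sense on $\mathbb{B}^n$, that is, $$\int_{\mathbb{B}^n}u\,\Delta_h\psi\,d\tau=\int_{\mathbb{B}^n}\psi\,d\mu\qquad\text{for all }\psi\in C_c^2(\mathbb{B}^n),$$ and $$\lim_{r\to 1^-}u(rt)=\phi(t)\qquad\text{for almost every } t\in\mathbb{S}^{n-1}.$$
   Context: $\mathbb{B}^n$ is the open unit ball and $\mathbb{S}^{n-1}$ the unit sphere of $\mathbb{R}^n$. The hyperbolic Laplacian is $$\Delta_h u(x)=(1-|x|^2)^2\Delta u(x)+2(n-2)(1-|x|^2)\sum_{i=1}^n x_i\frac{\partial u}{\partial x_i}(x).$$ $\sigma$ is surface measure on $\mathbb{S}^{n-1}$ normalized so that $\sigma(\mathbb{S}^{n-1})=1$ ("almost every" on the sphere refers to $\sigma$); $\nu$ is Lebesgue measure on $\mathbb{B}^n$ normalized so that $\nu(\mathbb{B}^n)=1$; $d\tau(x)=(1-|x|^2)^{-n}\,d\nu(x)$. The hyperbolic Poisson integral is $$P_h[\phi](x)=\int_{\mathbb{S}^{n-1}}\left(\frac{1-|x|^2}{|t-x|^2}\right)^{n-1}\phi(t)\,d\sigma(t).$$ The hyperbolic Green function is $G_h(x,y)=g\left(\frac{|x-y|}{[x,y]}\right)$,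 where $[x,y]=\sqrt{1+|x|^2|y|^2-2\langle x,y\rangle}$ and $$g(r)=\frac1n\int_r^1\frac{(1-t^2)^{n-2}}{t^{n-1}}\,dt,\qquad 0<r<1.$$ The Green potential of $\mu$ is $G_h[\mu](x)=\int_{\mathbb{B}^n}G_h(x,y)\,d\mu(y)$. $C_c^2(\mathbb{B}^n)$ is the set of $C^2$ functions with compact support in $\mathbb{B}^n$. *)

theory Defs
  imports "HOL-Probability.Probability"
begin

text \<open>
  Throughout, $\mathbb{R}^n$ is an arbitrary Euclidean space \<open>'a\<close>, with $n$ = \<open>DIM('a)\<close> and the
  coordinates taken with respect to \<open>Basis\<close>.
\<close>

abbreviation unit_ball :: "'a::euclidean_space set" where
  "unit_ball \<equiv> ball 0 1"

abbreviation unit_sphere :: "'a::euclidean_space set" where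
  "unit_sphere \<equiv> sphere 0 1"


subsection \<open>Measures\<close>

definition ball_measure :: "'a::euclidean_space measure" where
  "ball_measure = uniform_measure (restrict_space lborel unit_ball) unit_ball"

text \<open>
  Normalized surface measure on the sphere, in the usual form from polar coordinates: up to
  the normalization, the surface measure of $A$ is $n$ times the volume of the cone
  $\{rt : t \in A,\ 0 < r < 1\}$. So it is the image of the normalized volume of the punctured
  ball under $x \mapsto x/|x|$. The origin is removed because \<open>sgn 0 = 0\<close> is not on the sphere.
\<close>

definition sphere_measure :: "'a::euclidean_space measure" where
  "sphere_measure =
     distr (restrict_space ball_measure (- {0})) (restrict_space borel unit_sphere) sgn"

definition hyperbolic_measure :: "'a::euclidean_space measure" where
  "hyperbolic_measure =
     density ball_measure (\<lambda>x. ennreal (1 / (1 - (norm x)\<^sup>2) ^ DIM('a)))"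


subsection \<open>Differential operators and test functions\<close>

definition partial_deriv :: "'a::euclidean_space \<Rightarrow> ('a \<Rightarrow> real) \<Rightarrow> 'a \<Rightarrow> real" where
  "partial_deriv b f x = deriv (\<lambda>s. f (x + s *\<^sub>R b)) 0"

definition laplacian :: "('a::euclidean_space \<Rightarrow> real) \<Rightarrow> 'a \<Rightarrow> real" where
  "laplacian f x = (\<Sum>b\<in>Basis. partial_deriv b (partial_deriv b f) x)"

definition hyperbolic_laplacian :: "('a::euclidean_space \<Rightarrow> real) \<Rightarrow> 'a \<Rightarrow> real" where
  "hyperbolic_laplacian f x =
     (1 - (norm x)\<^sup>2)\<^sup>2 * laplacian f x
     + 2 * (real DIM('a) - 2) * (1 - (norm x)\<^sup>2) * (\<Sum>b\<in>Basis. (x \<bullet> b) * partial_deriv b f x)"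

text \<open>The following two are meant for open \<open>S\<close>.\<close>

definition C1_on :: "'a::euclidean_space set \<Rightarrow> ('a \<Rightarrow> real) \<Rightarrow> bool" where
  "C1_on S f \<longleftrightarrow> f differentiable_on S \<and> (\<forall>b\<in>Basis. continuous_on S (partial_deriv b f))"

definition C2_on :: "'a::euclidean_space set \<Rightarrow> ('a \<Rightarrow> real) \<Rightarrow> bool" where
  "C2_on S f \<longleftrightarrow> C1_on S f \<and> (\<forall>b\<in>Basis. C1_on S (partial_deriv b f))"

text \<open>
  A test function is a function on the ball, so its values elsewhere are unconstrained; its
  support is the closure relative to the ball of the set where it does not vanish.
\<close>

definition C2c_ball :: "('a::euclidean_space \<Rightarrow> real) set" where
  "C2c_ball =
     {\<psi>. C2_on unit_ball \<psi> \<and> compact (unit_ball \<inter> closure {x \<in> unit_ball. \<psi> x \<noteq> 0})}"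


subsection \<open>Poisson integral and Green potential\<close>

definition poisson_integral :: "('a::euclidean_space \<Rightarrow> real) \<Rightarrow> 'a \<Rightarrow> real" where
  "poisson_integral \<phi> x =
     (\<integral>t. ((1 - (norm x)\<^sup>2) / (norm (t - x))\<^sup>2) ^ (DIM('a) - 1) * \<phi> t \<partial>sphere_measure)"

definition bracket :: "'a::euclidean_space \<Rightarrow> 'a \<Rightarrow> real" where
  "bracket x y = sqrt (1 + (norm x)\<^sup>2 * (norm y)\<^sup>2 - 2 * (x \<bullet> y))"

text \<open>
  The function $g$, for $n \ge 2$. The nonnegative integral extends it to $r = 0$ by
  $g(0) = \lim_{r \to 0+} g(r) = \infty$, so that the Green function is infinite on the
  diagonal and the Green potential is defined everywhere, with values in $[0, \infty]$.
\<close>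

definition green_profile :: "nat \<Rightarrow> real \<Rightarrow> ennreal" where
  "green_profile n r =
     ennreal (1 / real n) * (\<integral>\<^sup>+t\<in>{r..1}. ennreal ((1 - t\<^sup>2) ^ (n - 2) / t ^ (n - 1)) \<partial>lborel)"

definition green_function :: "'a::euclidean_space \<Rightarrow> 'a \<Rightarrow> ennreal" where
  "green_function x y = green_profile DIM('a) (norm (x - y) / bracket x y)"

definition green_potential :: "'a::euclidean_space measure \<Rightarrow> 'a \<Rightarrow> ennreal" where
  "green_potential \<mu> x = (\<integral>\<^sup>+y. green_function x y \<partial>\<mu>)"


subsection \<open>Consistency of the normalizations\<close>

lemma emeasure_restrict_unit_ball:
  "emeasure (restrict_space lborel unit_ball) (unit_ball :: 'a::euclidean_space set)
     = emeasure lborel (unit_ball :: 'a set)"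
  by (simp add: emeasure_restrict_space)

lemma space_ball_measure [simp]: "space ball_measure = unit_ball"
  by (simp add: ball_measure_def space_restrict_space)

lemma sets_ball_measure:
  "sets (ball_measure :: 'a::euclidean_space measure) = sets (restrict_space borel unit_ball)"
  by (simp add: ball_measure_def cong: sets_restrict_space_cong)

lemma prob_space_ball_measure: "prob_space (ball_measure :: 'a::euclidean_space measure)"
  unfolding ball_measure_def
proof (rule prob_space_uniform_measure)
  have "measure lborel (unit_ball :: 'a set) > 0"
    by (metis content_ball_pos zero_less_one measure_completion open_ball borel_open sets_lborel)
  then show "emeasure (restrict_space lborel unit_ball) (unit_ball :: 'a set) \<noteq> 0"
    unfolding emeasure_restrict_unit_ball by (auto simp: measure_def)
  show "emeasure (restrict_space lborel unit_ball) (unit_ball :: 'a set) \<noteq> \<infinity>"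
    unfolding emeasure_restrict_unit_ball
    using emeasure_lborel_ball_finite[of "0 :: 'a" 1] by simp
qed

lemma emeasure_ball_measure:
  assumes "A \<in> sets borel" "A \<subseteq> (unit_ball :: 'a::euclidean_space set)"
  shows "emeasure ball_measure A = emeasure lborel A / emeasure lborel (unit_ball :: 'a set)"
  using assms
  by (simp add: ball_measure_def emeasure_restrict_space sets_restrict_space_iff inf_absorb2)

lemma sgn_measurable_sphere:
  "sgn \<in> restrict_space ball_measure (- {0})
     \<rightarrow>\<^sub>M restrict_space borel (unit_sphere :: 'a::euclidean_space set)"
proof (rule measurable_restrict_space2)
  show "sgn \<in> space (restrict_space ball_measure (- {0})) \<rightarrow> (unit_sphere :: 'a set)"
    by (auto simp: space_restrict_space norm_sgn)
  have "(\<lambda>x::'a. x /\<^sub>R norm x) \<in> borel_measurable ball_measure"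
    unfolding measurable_cong_sets[OF sets_ball_measure refl]
    by (intro measurable_restrict_space1) measurable
  then show "(sgn :: 'a \<Rightarrow> 'a) \<in> borel_measurable (restrict_space ball_measure (- {0}))"
    unfolding sgn_div_norm by (rule measurable_restrict_space1)
qed

lemma prob_space_sphere_measure: "prob_space (sphere_measure :: 'a::euclidean_space measure)"
proof -
  have pb: "- {0} \<inter> space (ball_measure :: 'a measure) \<in> sets ball_measure"
    by (auto simp: sets_ball_measure sets_restrict_space_iff)
  have null: "emeasure ball_measure {0 :: 'a} = 0"
    by (subst emeasure_ball_measure) auto
  have "emeasure ball_measure (unit_ball - {0 :: 'a}) = emeasure ball_measure (unit_ball :: 'a set)"
    using null by (intro emeasure_Diff_null_set)
      (auto simp: null_sets_def sets_ball_measure sets_restrict_space_iff)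
  also have "\<dots> = 1"
    using prob_space.emeasure_space_1[OF prob_space_ball_measure] by simp
  finally have "emeasure ball_measure (unit_ball - {0 :: 'a}) = 1" .
  then have "prob_space (restrict_space ball_measure (- {0 :: 'a}))"
    using pb by (intro prob_spaceI)
      (simp add: space_restrict_space emeasure_restrict_space Diff_eq Int_commute)
  then show ?thesis
    unfolding sphere_measure_def by (rule prob_space.prob_space_distr[OF _ sgn_measurable_sphere])
qed

lemma green_profile_pos:
  assumes "0 < r"
  shows "green_profile n r
           = ennreal (1 / real n * integral {r..1} (\<lambda>t. (1 - t\<^sup>2) ^ (n - 2) / t ^ (n - 1)))"
proof -
  let ?f = "\<lambda>t::real. (1 - t\<^sup>2) ^ (n - 2) / t ^ (n - 1)"
  have nonneg: "0 \<le> ?f t" if "t \<in> {r..1}" for t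
    using that assms by (auto intro!: divide_nonneg_nonneg zero_le_power simp: power_le_one)
  have cont: "continuous_on {r..1} ?f"
    using assms by (intro continuous_intros) auto
  have "(?f has_integral integral {r..1} ?f) {r..1}"
    using integrable_continuous_interval[OF cont] by (rule integrable_integral)
  then have "(\<integral>\<^sup>+t\<in>{r..1}. ennreal (?f t) \<partial>lborel) = ennreal (integral {r..1} ?f)"
    by (intro nn_integral_has_integral_lebesgue') (use nonneg in auto)
  moreover have "0 \<le> integral {r..1} ?f"
    using nonneg by (intro integral_nonneg integrable_continuous_interval cont)
  ultimately show ?thesis
    by (simp only: green_profile_def) (simp add: ennreal_mult[symmetric])
qed

lemma green_profile_0:
  assumes "n \<ge> 2"
  shows "green_profile n 0 = \<infinity>"
proof -
  define c :: real where "c = (3/4) ^ (n - 2)"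
  let ?f = "\<lambda>t::real. (1 - t\<^sup>2) ^ (n - 2) / t ^ (n - 1)"
  define I where "I = (\<integral>\<^sup>+t\<in>{0..1}. ennreal (?f t) \<partial>lborel)"
  have c: "c > 0" by (simp add: c_def)
  have ge: "c / t \<le> ?f t" if "0 < t" "t \<le> 1/2" for t
  proof -
    have "t\<^sup>2 \<le> (1/2)\<^sup>2" using that by (intro power_mono) auto
    then have "c \<le> (1 - t\<^sup>2) ^ (n - 2)"
      unfolding c_def by (intro power_mono) (auto simp: power2_eq_square)
    moreover have "t ^ (n - 1) \<le> t ^ 1"
      using that assms by (intro power_decreasing) auto
    ultimately show ?thesis
      using that c by (intro frac_le) auto
  qed
  have le: "ennreal K \<le> I" if "K \<ge> 0" for K
  proof -
    define \<epsilon> where "\<epsilon> = exp (- K / c) / 2"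
    have \<epsilon>: "0 < \<epsilon>" "\<epsilon> \<le> 1/2" using that c by (auto simp: \<epsilon>_def divide_nonneg_pos)
    have "(\<integral>\<^sup>+t. ennreal (c / t) * indicator {\<epsilon>..1/2} t \<partial>lborel)
            = ennreal (c * ln (1/2) - c * ln \<epsilon>)"
      using \<epsilon> c by (intro nn_integral_FTC_Icc)
        (auto intro!: derivative_eq_intros simp: has_real_derivative_iff_has_vector_derivative[symmetric])
    also have "c * ln (1/2) - c * ln \<epsilon> = K"
      using c by (simp add: \<epsilon>_def ln_div field_simps)
    finally have "ennreal K = (\<integral>\<^sup>+t. ennreal (c / t) * indicator {\<epsilon>..1/2} t \<partial>lborel)" ..
    also have "\<dots> \<le> I"
      unfolding I_def using \<epsilon> ge
      by (intro nn_integral_mono) (auto simp: indicator_def intro!: ennreal_leI)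
    finally show ?thesis .
  qed
  have "I = \<infinity>"
  proof (cases I)
    case (real x)
    with le[of "x + 1"] show ?thesis by simp
  qed simp
  then show ?thesis
    using assms by (simp add: green_profile_def I_def ennreal_mult_top)
qed

end

theory Submission
  imports Defs
begin

text \<open>
  With the weight \<open>w = (1 - |x|^2)^(2 - n)\<close>, the measure \<open>\<Delta>\<^sub>h \<psi> d\<tau>\<close> is \<open>div (w \<nabla>\<psi>) dx\<close> up to a constant, so
  integration by parts moves it to the kernels. For the Poisson kernel \<open>P\<close> one has
  \<open>div (w \<nabla>P) = 0\<close>. The Green function is a function \<open>f\<close> of
  \<open>p = |x - y|^2 / ((1 - |x|^2) (1 - |y|^2))\<close>; replacing \<open>f p\<close> by the smooth \<open>f (p + \<epsilon>)\<close> turns its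
  weak Laplacian into an explicit approximate identity at \<open>y\<close>, and \<open>\<epsilon> \<rightarrow> 0\<close> gives the point mass.

  Both boundary limits rest on the maximal function of a measure over balls centred on the sphere,
  which satisfies a weak type estimate by Vitali's covering lemma. It controls the Poisson integral
  and the part of the Green potential at distance at least a multiple of \<open>1 - r\<close> from \<open>rt\<close>. The
  remaining part of the potential is dominated, uniformly in \<open>r\<close>, by the tail of an integral over
  \<open>\<mu>\<close> that is finite for almost every \<open>t\<close>, because the projection of its singularity to the sphere
  is integrable (Littlewood's theorem).
\<close>

subsection \<open>Polar coordinates\<close>

text \<open>The variable p is natural because \<open>w |grad p|^2\<close> and
  \<open>div (w grad p)\<close> are \<open>4 p (1 + p)\<close> and \<open>2 n (1 + 2 p)\<close>
  times \<open>(1 - |x|^2)^(- n)\<close>. For functions of p the equation is thus an ordinary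
  differential equation, solved by \<open>f' = c (p (1 + p))^(- n/2)\<close>, and the shift by
  \<epsilon> removes the pole without cutting out a ball around y. So the only integration by parts
  is that a derivative of a compactly supported function has integral 0; no surface term occurs. The
  same device replaces the divergence theorem on spheres when the Poisson kernel is shown to have
  mean 1.

  The obstacle at the boundary is that \<mu> may have infinite mass and that its potential may be
  infinite on a dense set: a point mass on the radius of t makes the potential infinite there, while
  the maximal function at t stays finite. Only \<open>(1 - |y|^2)^(n - 1) d\<mu>\<close> has finite
  mass, and the poles have to be handled by an estimate that holds for almost every direction
  instead of every one.\<close>

lemma borel_measurable_sgn_euclidean [measurable]:
  "(sgn :: 'a::euclidean_space \<Rightarrow> 'a) \<in> borel_measurable borel"
proof -
  have "(\<lambda>x::'a. x /\<^sub>R norm x) \<in> borel_measurable borel" by measurable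
  then show ?thesis by (simp add: sgn_div_norm[abs_def])
qed

lemma unit_ball_vol_DIM_neq_0 [simp]: "unit_ball_vol (real DIM('a::euclidean_space)) \<noteq> 0"
  using unit_ball_vol_pos[of "real DIM('a)"] by linarith

lemma zero_power_DIM [simp]: "(0::real) ^ DIM('a::euclidean_space) = 0"
  by (simp add: zero_power)

lemma nn_integral_lborel_affine:
  fixes f :: "'a::euclidean_space \<Rightarrow> ennreal"
  assumes [measurable]: "f \<in> borel_measurable borel" and c: "c > 0"
  shows "(\<integral>\<^sup>+x. f x \<partial>lborel) = ennreal (c ^ DIM('a)) * (\<integral>\<^sup>+x. f (t + c *\<^sub>R x) \<partial>lborel)"
proof -
  have "(\<integral>\<^sup>+x. f x \<partial>lborel) =
      (\<integral>\<^sup>+x. f x \<partial>density (distr lborel borel (\<lambda>x. t + c *\<^sub>R x)) (\<lambda>_. ennreal (\<bar>c\<bar>^DIM('a))))"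
    using lborel_affine[of c t] c by simp
  also have "\<dots> = ennreal (c ^ DIM('a)) * (\<integral>\<^sup>+x. f (t + c *\<^sub>R x) \<partial>lborel)"
    using c by (subst nn_integral_density) (auto simp: nn_integral_distr nn_integral_cmult)
  finally show ?thesis .
qed

lemma lborel_integral_affine:
  fixes f :: "'a::euclidean_space \<Rightarrow> real"
  assumes [measurable]: "f \<in> borel_measurable borel" and c: "c > 0"
  shows "(\<integral>x. f x \<partial>lborel) = c ^ DIM('a) * (\<integral>x. f (t + c *\<^sub>R x) \<partial>lborel)"
proof -
  have "(\<integral>x. f x \<partial>lborel) =
      (\<integral>x. f x \<partial>density (distr lborel borel (\<lambda>x. t + c *\<^sub>R x)) (\<lambda>_. ennreal (\<bar>c\<bar>^DIM('a))))"
    using lborel_affine[of c t] c by simp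
  also have "\<dots> = c ^ DIM('a) * (\<integral>x. f (t + c *\<^sub>R x) \<partial>lborel)"
    using c by (subst integral_density) (auto simp: integral_distr)
  finally show ?thesis .
qed

lemma lborel_integral_translate:
  fixes f :: "'a::euclidean_space \<Rightarrow> real"
  assumes [measurable]: "f \<in> borel_measurable borel"
  shows "(\<integral>x. f (x + t) \<partial>lborel) = (\<integral>x. f x \<partial>lborel)"
  using lborel_integral_affine[of f 1 t] by (simp add: add.commute)

lemma emeasure_lborel_unit_ball:
  "emeasure lborel (ball 0 1 :: 'a::euclidean_space set) = ennreal (unit_ball_vol (DIM('a)))"
  by (simp add: emeasure_ball)

lemma ball_measure_eq_density:
  "(ball_measure :: 'a::euclidean_space measure) =
     density (restrict_space lborel unit_ball) (\<lambda>_. ennreal (1 / unit_ball_vol (DIM('a))))"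
  unfolding ball_measure_def uniform_measure_def emeasure_restrict_unit_ball emeasure_lborel_unit_ball
proof (rule density_cong)
  show "AE x in restrict_space lborel (unit_ball :: 'a set).
      indicator unit_ball x / ennreal (unit_ball_vol (real DIM('a))) = ennreal (1 / unit_ball_vol (DIM('a)))"
    by (subst AE_restrict_space_iff) (auto simp: divide_ennreal[symmetric])
  have "unit_ball \<in> sets (restrict_space lborel (unit_ball :: 'a set))"
    by (simp add: sets_restrict_space_iff)
  then show "(\<lambda>x. indicator unit_ball x / ennreal (unit_ball_vol (real DIM('a))))
       \<in> borel_measurable (restrict_space lborel (unit_ball :: 'a set))"
    by measurable
qed auto

lemma hyperbolic_measure_eq_density:
  "(hyperbolic_measure :: 'a::euclidean_space measure) =
     density (restrict_space lborel unit_ball)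
       (\<lambda>x. ennreal (1 / (unit_ball_vol (DIM('a)) * (1 - (norm x)\<^sup>2) ^ DIM('a))))"
proof -
  have "(hyperbolic_measure :: 'a measure) =
     density (restrict_space lborel unit_ball)
       (\<lambda>x. ennreal (1 / unit_ball_vol (DIM('a))) * ennreal (1 / (1 - (norm x)\<^sup>2) ^ DIM('a)))"
    unfolding hyperbolic_measure_def ball_measure_eq_density
    by (rule density_density_eq) (auto intro!: measurable_restrict_space1)
  also have "\<dots> = density (restrict_space lborel unit_ball)
       (\<lambda>x. ennreal (1 / (unit_ball_vol (DIM('a)) * (1 - (norm x)\<^sup>2) ^ DIM('a))))"
    by (intro density_cong)
       (auto intro!: measurable_restrict_space1 simp: ennreal_mult'[symmetric])
  finally show ?thesis .
qed

text \<open>Surface measure carried over to the Borel sets of the whole space: balls and kernels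
  then need no restriction to the sphere, and lying on the sphere becomes an almost-everywhere
  statement.\<close>

definition sphere_borel :: "'a::euclidean_space measure" where
  "sphere_borel = distr sphere_measure borel (\<lambda>x. x)"

lemma sets_sphere_borel [simp, measurable_cong]: "sets sphere_borel = sets borel"
  and space_sphere_borel [simp]: "space sphere_borel = UNIV"
  by (simp_all add: sphere_borel_def)

lemma sets_sphere_measure:
  "sets (sphere_measure :: 'a::euclidean_space measure) = sets (restrict_space borel unit_sphere)"
  by (simp add: sphere_measure_def)

lemma space_sphere_measure:
  "space (sphere_measure :: 'a::euclidean_space measure) = unit_sphere"
  by (simp add: sphere_measure_def space_restrict_space)

lemma measurable_ident_sphere_measure:
  "(\<lambda>x::'a::euclidean_space. x) \<in> measurable sphere_measure borel"
  unfolding measurable_cong_sets[OF sets_sphere_measure refl]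
  by (rule measurable_restrict_space1) measurable

lemma emeasure_sphere_borel:
  assumes A [measurable]: "A \<in> sets (borel :: 'a::euclidean_space measure)"
  shows "emeasure sphere_borel A =
    emeasure lborel {x. x \<noteq> 0 \<and> norm x < 1 \<and> sgn x \<in> A} / ennreal (unit_ball_vol (DIM('a)))"
proof -
  have "emeasure sphere_borel A = emeasure sphere_measure (A \<inter> unit_sphere)"
    unfolding sphere_borel_def using measurable_ident_sphere_measure
    by (subst emeasure_distr) (auto simp: space_sphere_measure)
  also have "\<dots> = emeasure (restrict_space ball_measure (- {0}))
      (sgn -` (A \<inter> unit_sphere) \<inter> space (restrict_space ball_measure (- {0 :: 'a})))"
    unfolding sphere_measure_def
    by (rule emeasure_distr[OF sgn_measurable_sphere])
       (auto simp: sets_restrict_space_iff)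
  also have "sgn -` (A \<inter> unit_sphere) \<inter> space (restrict_space ball_measure (- {0 :: 'a}))
      = {x. x \<noteq> 0 \<and> norm x < 1 \<and> sgn x \<in> A}"
    by (auto simp: space_restrict_space norm_sgn)
  also have "emeasure (restrict_space ball_measure (- {0 :: 'a})) \<dots> =
      emeasure ball_measure {x::'a. x \<noteq> 0 \<and> norm x < 1 \<and> sgn x \<in> A}"
    by (rule emeasure_restrict_space) (auto simp: sets_ball_measure sets_restrict_space_iff)
  also have "\<dots> = emeasure lborel {x. x \<noteq> 0 \<and> norm x < 1 \<and> sgn x \<in> A} / ennreal (unit_ball_vol (DIM('a)))"
    by (subst emeasure_ball_measure) (auto simp: emeasure_lborel_unit_ball)
  finally show ?thesis .
qed

lemma prob_space_sphere_borel: "prob_space (sphere_borel :: 'a::euclidean_space measure)"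
  unfolding sphere_borel_def
  by (rule prob_space.prob_space_distr[OF prob_space_sphere_measure measurable_ident_sphere_measure])

lemma AE_sphere_borel_norm: "AE t in (sphere_borel :: 'a::euclidean_space measure). norm t = 1"
  unfolding sphere_borel_def
  by (subst AE_distr_iff[OF measurable_ident_sphere_measure]) (auto simp: space_sphere_measure)

text \<open>A dilation by R multiplies volumes by \<open>R ^ DIM('a)\<close> and keeps directions,
  so the truncated cone over A differs only by this factor from the one that defines surface
  measure.\<close>

lemma emeasure_cone:
  assumes A [measurable]: "A \<in> sets (borel :: 'a::euclidean_space measure)" and R: "0 \<le> R"
  shows "emeasure lborel {x. x \<noteq> 0 \<and> norm x < R \<and> sgn x \<in> A} =
    ennreal (unit_ball_vol (DIM('a)) * R ^ DIM('a)) * emeasure sphere_borel A"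
proof (cases "R = 0")
  case True
  then show ?thesis by (simp add: not_less)
next
  case False
  with R have R: "R > 0" by simp
  let ?V = "unit_ball_vol (DIM('a))"
  have V: "?V > 0" by simp
  let ?C = "\<lambda>R. {x::'a. x \<noteq> 0 \<and> norm x < R \<and> sgn x \<in> A}"
  have "emeasure lborel (?C R) = (\<integral>\<^sup>+x. indicator (?C R) x \<partial>lborel)" by simp
  also have "\<dots> = ennreal (R ^ DIM('a)) * (\<integral>\<^sup>+x. indicator (?C R) (0 + R *\<^sub>R x) \<partial>lborel)"
    by (rule nn_integral_lborel_affine[OF _ R]) measurable
  also have "(\<lambda>x::'a. indicator (?C R) (0 + R *\<^sub>R x)) = (indicator (?C 1) :: _ \<Rightarrow> ennreal)"
    using R by (auto simp: fun_eq_iff indicator_def sgn_scaleR)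
  also have "(\<integral>\<^sup>+x. indicator (?C 1) x \<partial>lborel) = emeasure lborel (?C 1)" by simp
  also have "\<dots> = ennreal ?V * emeasure sphere_borel A"
    unfolding emeasure_sphere_borel[OF A] ennreal_times_divide using V
    by (subst mult.commute, subst mult_divide_eq_ennreal) auto
  finally show ?thesis using V R by (simp add: ennreal_mult ac_simps)
qed

text \<open>The distribution of \<open>norm\<close> under Lebesgue measure. The factor n times the
  volume of the unit ball is the unnormalized area of the sphere, which the probability measure
  \<open>sphere_borel\<close> lacks. The \<open>itself\<close> argument carries the
  dimension.\<close>

definition radial_measure :: "'a::euclidean_space itself \<Rightarrow> real measure" where
  "radial_measure _ = density lborel
     (\<lambda>r. ennreal (real DIM('a) * unit_ball_vol (DIM('a)) * r ^ (DIM('a) - 1)) * indicator {0..} r)"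

lemma sets_radial_measure [simp, measurable_cong]: "sets (radial_measure T) = sets borel"
  and space_radial_measure [simp]: "space (radial_measure T) = UNIV"
  by (simp_all add: radial_measure_def)

lemma emeasure_radial_measure_lessThan:
  assumes "R \<ge> 0"
  shows "emeasure (radial_measure TYPE('a::euclidean_space)) {..<R} =
    ennreal (unit_ball_vol (DIM('a)) * R ^ DIM('a))"
proof -
  let ?V = "unit_ball_vol (DIM('a))" and ?n = "DIM('a)"
  have "emeasure (radial_measure TYPE('a)) {..<R} =
     (\<integral>\<^sup>+r. ennreal (?n * ?V * r ^ (?n - 1)) * indicator {0..} r * indicator {..<R} r \<partial>lborel)"
    unfolding radial_measure_def by (subst emeasure_density) auto
  also have "\<dots> = (\<integral>\<^sup>+r. ennreal (?n * ?V * r ^ (?n - 1)) * indicator {0..R} r \<partial>lborel)"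
  proof (rule nn_integral_cong_AE)
    show "AE r in lborel. ennreal (?n * ?V * r ^ (?n - 1)) * indicator {0..} r * indicator {..<R} r
        = ennreal (?n * ?V * r ^ (?n - 1)) * indicator {0..R} r"
      using AE_lborel_singleton[of R] by eventually_elim (auto simp: indicator_def)
  qed
  also have "\<dots> = ennreal (?V * R ^ ?n - ?V * 0 ^ ?n)"
    using assms
    by (intro nn_integral_FTC_Icc)
       (auto intro!: derivative_eq_intros simp: has_real_derivative_iff_has_vector_derivative[symmetric])
  finally show ?thesis by simp
qed

lemma sigma_finite_radial_measure: "sigma_finite_measure (radial_measure TYPE('a::euclidean_space))"
proof
  show "\<exists>A. countable A \<and> A \<subseteq> sets (radial_measure TYPE('a)) \<and>
        \<Union>A = space (radial_measure TYPE('a)) \<and> (\<forall>a\<in>A. emeasure (radial_measure TYPE('a)) a \<noteq> \<infinity>)"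
    by (intro exI[of _ "range (\<lambda>n::nat. {..<real n})"])
       (auto simp: emeasure_radial_measure_lessThan reals_Archimedean2)
qed

text \<open>Length and direction are independent: the image of Lebesgue measure under
  \<open>(norm, sgn)\<close> is a product measure. On a rectangle \<open>A \<times> B\<close> this
  follows from the volumes of cones over B. Multiplying length and direction recovers every point
  except the origin, which is null.\<close>

lemma polar_coordinates:
  "(lborel :: 'a::euclidean_space measure) =
     distr (radial_measure TYPE('a) \<Otimes>\<^sub>M sphere_borel) borel (\<lambda>(r, s). r *\<^sub>R s)"
proof -
  interpret R: sigma_finite_measure "radial_measure TYPE('a)" by (rule sigma_finite_radial_measure)
  interpret S: prob_space "sphere_borel :: 'a measure" by (rule prob_space_sphere_borel)
  let ?L = "restrict_space lborel (- {0 :: 'a})"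
  let ?D = "distr ?L (borel \<Otimes>\<^sub>M borel) (\<lambda>x. (norm x, sgn x))"
  have m [measurable]: "(\<lambda>x. (norm x, sgn x)) \<in> ?L \<rightarrow>\<^sub>M (borel \<Otimes>\<^sub>M borel)"
    by (rule measurable_restrict_space1) simp
  have D: "emeasure ?D X = emeasure lborel {x. x \<noteq> 0 \<and> (norm x, sgn x) \<in> X}"
    if [measurable]: "X \<in> sets (borel \<Otimes>\<^sub>M borel)" for X
    by (subst emeasure_distr)
       (auto simp: space_restrict_space emeasure_restrict_space intro!: arg_cong2[where f=emeasure])
  have gen: "sets (borel :: real measure) = sigma_sets UNIV (range lessThan)"
    by (subst borel_Iio, rule sets_measure_of) auto
  have eq: "radial_measure TYPE('a) \<Otimes>\<^sub>M sphere_borel = ?D"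
  proof (rule pair_measure_eqI)
    fix A :: "real set" and B :: "'a set"
    assume "A \<in> sets (radial_measure TYPE('a))" "B \<in> sets sphere_borel"
    then have A [measurable]: "A \<in> sets borel" and B [measurable]: "B \<in> sets borel" by auto
    have B1: "emeasure sphere_borel B < top"
      using S.emeasure_le_1[of B] by (simp add: order_le_less_trans)
    let ?N = "distr (restrict_space lborel {x::'a. x \<noteq> 0 \<and> sgn x \<in> B}) borel norm"
    have mN: "norm \<in> restrict_space lborel {x::'a. x \<noteq> 0 \<and> sgn x \<in> B} \<rightarrow>\<^sub>M borel"
      by (rule measurable_restrict_space1) simp
    have N: "emeasure ?N X = emeasure lborel {x. x \<noteq> 0 \<and> norm x \<in> X \<and> sgn x \<in> B}"
      if [measurable]: "X \<in> sets borel" for X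
      using mN by (subst emeasure_distr)
       (auto simp: space_restrict_space emeasure_restrict_space intro!: arg_cong2[where f=emeasure])
    \<comment> \<open>For fixed B both sides of the rectangle identity are measures in A, so it is
      enough to compare them on the rays \<open>{..<a}\<close>, where the values are volumes of
      cones.\<close>
    have "scale_measure (emeasure sphere_borel B) (radial_measure TYPE('a)) = ?N"
    proof (rule measure_eqI_generator_eq[where E="range lessThan" and \<Omega>=UNIV and A="\<lambda>n. {..<real n}"])
      show "Int_stable (range lessThan :: real set set)"
      proof (rule Int_stableI)
        fix A B :: "real set" assume "A \<in> range lessThan" "B \<in> range lessThan"
        then obtain a b where "A = {..<a}" "B = {..<b}" by auto
        then have "A \<inter> B = {..<min a b}" by auto
        then show "A \<inter> B \<in> range lessThan" by blast
      qed
      show "emeasure (scale_measure (emeasure sphere_borel B) (radial_measure TYPE('a))) X = emeasure ?N X"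
        if "X \<in> range lessThan" for X
      proof -
        from that obtain a where X: "X = {..<a}" by auto
        show ?thesis
        proof (cases "a \<ge> 0")
          case True
          then show ?thesis
            using emeasure_cone[OF B True]
            by (simp add: X N emeasure_radial_measure_lessThan mult.commute)
        next
          case False
          have "emeasure (radial_measure TYPE('a)) {..<a} \<le> emeasure (radial_measure TYPE('a)) {..<0}"
            using False by (intro emeasure_mono) auto
          then have "emeasure (radial_measure TYPE('a)) {..<a} = 0"
            using emeasure_radial_measure_lessThan[of 0, where 'a='a] by (simp add: zero_power)
          moreover have e: "{x. x \<noteq> 0 \<and> norm x < a \<and> sgn x \<in> B} = {}"
            using False by (auto dest: order_le_less_trans[OF norm_ge_zero])
          have "emeasure ?N {..<a} = 0"
            by (subst N) (simp_all add: e del: Collect_empty_eq)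
          ultimately show ?thesis by (simp add: X)
        qed
      qed
      show "sets (scale_measure (emeasure sphere_borel B) (radial_measure TYPE('a))) = sigma_sets UNIV (range lessThan)"
        by (simp add: gen[symmetric])
      show "sets ?N = sigma_sets UNIV (range lessThan)"
        by (simp add: gen[symmetric])
      show "(\<Union>i. {..<real i}) = UNIV" by (auto simp: reals_Archimedean2)
      show "emeasure (scale_measure (emeasure sphere_borel B) (radial_measure TYPE('a))) {..<real i} \<noteq> \<infinity>" for i
        using B1 by (simp add: emeasure_radial_measure_lessThan ennreal_mult_eq_top_iff)
    qed auto
    from arg_cong[where f="\<lambda>M. emeasure M A", OF this]
    have "emeasure (radial_measure TYPE('a)) A * emeasure sphere_borel B = emeasure ?N A"
      by (simp add: mult.commute)
    also have "\<dots> = emeasure ?D (A \<times> B)"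
      by (subst N, simp, subst D) auto
    finally show "emeasure (radial_measure TYPE('a)) A * emeasure sphere_borel B = emeasure ?D (A \<times> B)" .
  next
    show "sets (radial_measure TYPE('a) \<Otimes>\<^sub>M sphere_borel) = sets ?D"
      by (simp cong: sets_pair_measure_cong)
  qed (rule R.sigma_finite_measure_axioms S.sigma_finite_measure_axioms)+
  show ?thesis
  proof (rule measure_eqI)
    fix X :: "'a set" assume "X \<in> sets lborel"
    then have X [measurable]: "X \<in> sets borel" by simp
    have mm: "(\<lambda>(r, s). r *\<^sub>R s) \<in> ?D \<rightarrow>\<^sub>M (borel :: 'a measure)" by simp
    have sp: "space (borel \<Otimes>\<^sub>M borel) = (UNIV :: (real \<times> 'a) set)"
      by (simp add: space_pair_measure)
    have "(\<lambda>(r, s). r *\<^sub>R s) -` X \<inter> space (borel \<Otimes>\<^sub>M borel) \<in> sets (borel \<Otimes>\<^sub>M borel)"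
      by (rule measurable_sets[OF _ X]) simp
    then have mX: "(\<lambda>(r, s). r *\<^sub>R s) -` X \<in> sets (borel \<Otimes>\<^sub>M borel)"
      by (simp add: sp)
    have "emeasure (distr (radial_measure TYPE('a) \<Otimes>\<^sub>M sphere_borel) borel (\<lambda>(r, s). r *\<^sub>R s)) X =
        emeasure ?D ((\<lambda>(r, s). r *\<^sub>R s) -` X)"
      unfolding eq using emeasure_distr[OF mm X] by (simp only: sp space_distr Int_UNIV_right)
    also have "\<dots> = emeasure lborel {x. x \<noteq> 0 \<and> norm x *\<^sub>R sgn x \<in> X}"
      unfolding D[OF mX] by (simp only: vimage_eq case_prod_conv)
    also have "{x. x \<noteq> 0 \<and> norm x *\<^sub>R sgn x \<in> X} = X - {0}"
      by (auto simp: sgn_div_norm)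
    also have "emeasure lborel (X - {0}) = emeasure lborel X"
      by (rule emeasure_Diff_null_set) (auto simp: null_sets_def)
    finally show "emeasure lborel X =
      emeasure (distr (radial_measure TYPE('a) \<Otimes>\<^sub>M sphere_borel) borel (\<lambda>(r, s). r *\<^sub>R s)) X" ..
  qed simp
qed

lemma nn_integral_polar:
  fixes f :: "'a::euclidean_space \<Rightarrow> ennreal"
  assumes [measurable]: "f \<in> borel_measurable borel"
  shows "(\<integral>\<^sup>+x. f x \<partial>lborel) =
    (\<integral>\<^sup>+r. (\<integral>\<^sup>+s. f (r *\<^sub>R s) \<partial>sphere_borel) \<partial>radial_measure TYPE('a))"
proof -
  interpret S: prob_space "sphere_borel :: 'a measure" by (rule prob_space_sphere_borel)
  have m: "(\<lambda>(r, s). r *\<^sub>R s) \<in> radial_measure TYPE('a) \<Otimes>\<^sub>M sphere_borel \<rightarrow>\<^sub>M (borel :: 'a measure)"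
    by measurable
  have "(\<integral>\<^sup>+x. f x \<partial>lborel) = (\<integral>\<^sup>+p. f (case p of (r, s) \<Rightarrow> r *\<^sub>R s) \<partial>(radial_measure TYPE('a) \<Otimes>\<^sub>M sphere_borel))"
    by (subst polar_coordinates, subst nn_integral_distr[OF m]) auto
  also have "\<dots> = (\<integral>\<^sup>+r. (\<integral>\<^sup>+s. f (case (r, s) of (r, s) \<Rightarrow> r *\<^sub>R s) \<partial>sphere_borel) \<partial>radial_measure TYPE('a))"
    by (rule S.nn_integral_fst[symmetric]) measurable
  finally show ?thesis by simp
qed

lemma nn_integral_radial:
  fixes f :: "real \<Rightarrow> ennreal"
  assumes [measurable]: "f \<in> borel_measurable borel"
  shows "(\<integral>\<^sup>+x. f (norm (x::'a::euclidean_space)) \<partial>lborel) =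
    (\<integral>\<^sup>+r. ennreal (real DIM('a) * unit_ball_vol (DIM('a)) * r ^ (DIM('a) - 1)) * f r * indicator {0..} r \<partial>lborel)"
proof -
  interpret S: prob_space "sphere_borel :: 'a measure" by (rule prob_space_sphere_borel)
  have "(\<integral>\<^sup>+x. f (norm (x::'a)) \<partial>lborel) =
      (\<integral>\<^sup>+r. (\<integral>\<^sup>+s. f (norm (r *\<^sub>R s)) \<partial>(sphere_borel :: 'a measure)) \<partial>radial_measure TYPE('a))"
    by (rule nn_integral_polar) measurable
  also have "\<dots> = (\<integral>\<^sup>+r. (\<integral>\<^sup>+s. f \<bar>r\<bar> \<partial>(sphere_borel :: 'a measure)) \<partial>radial_measure TYPE('a))"
    using AE_sphere_borel_norm by (intro nn_integral_cong nn_integral_cong_AE) (auto elim!: eventually_mono)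
  also have "\<dots> = (\<integral>\<^sup>+r. f \<bar>r\<bar> \<partial>radial_measure TYPE('a))"
    using S.emeasure_space_1 by simp
  also have "\<dots> = (\<integral>\<^sup>+r. ennreal (real DIM('a) * unit_ball_vol (DIM('a)) * r ^ (DIM('a) - 1)) * indicator {0..} r * f \<bar>r\<bar> \<partial>lborel)"
    unfolding radial_measure_def by (subst nn_integral_density) auto
  also have "\<dots> = (\<integral>\<^sup>+r. ennreal (real DIM('a) * unit_ball_vol (DIM('a)) * r ^ (DIM('a) - 1)) * f r * indicator {0..} r \<partial>lborel)"
    by (intro nn_integral_cong) (auto simp: indicator_def)
  finally show ?thesis .
qed

section \<open>Explicit integrals: the bubble, spherical caps, Riesz potentials\<close>

text \<open>In polar coordinates the integrand is an exact derivative, that of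
  \<open>V (r^2 / (1 + r^2))^(n/2)\<close> with V the volume of the unit ball, and this function
  climbs from 0 to V. The value is what makes the normalization of the Green function come out
  right.\<close>

lemma nn_integral_bubble:
  "(\<integral>\<^sup>+z. ennreal ((1 + (norm (z::'a::euclidean_space))\<^sup>2) powr (- (DIM('a) / 2) - 1)) \<partial>lborel) =
     ennreal (unit_ball_vol (DIM('a)))"
proof -
  let ?V = "unit_ball_vol (DIM('a))" and ?n = "DIM('a)"
  let ?F = "\<lambda>r::real. ?V * (r ^ ?n * (1 + r\<^sup>2) powr (- (?n / 2)))"
  have pos: "1 + r\<^sup>2 > 0" for r :: real by (simp add: add_pos_nonneg)
  have "(\<integral>\<^sup>+z. ennreal ((1 + (norm (z::'a))\<^sup>2) powr (- (?n / 2) - 1)) \<partial>lborel) =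
    (\<integral>\<^sup>+r. ennreal (?n * ?V * r ^ (?n - 1)) * ennreal ((1 + r\<^sup>2) powr (- (?n / 2) - 1)) * indicator {0..} r \<partial>lborel)"
    by (rule nn_integral_radial) measurable
  also have "\<dots> = (\<integral>\<^sup>+r. ennreal (?n * ?V * r ^ (?n - 1) * (1 + r\<^sup>2) powr (- (?n / 2) - 1)) * indicator {0..} r \<partial>lborel)"
    by (intro nn_integral_cong) (auto simp: indicator_def ennreal_mult'')
  also have "\<dots> = ennreal (?V - ?F 0)"
  proof (rule nn_integral_FTC_atLeast)
    show "(?F has_real_derivative ?n * ?V * r ^ (?n - 1) * (1 + r\<^sup>2) powr (- (?n / 2) - 1)) (at r)" for r
    proof -
      have eq: "(1 + r\<^sup>2) powr (- (?n / 2)) = (1 + r\<^sup>2) * (1 + r\<^sup>2) powr (- (?n / 2) - 1)"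
        using pos[of r] by (simp add: powr_diff)
      have r: "r ^ ?n = r * r ^ (?n - 1)" by (metis DIM_positive power_minus_mult mult.commute)
      have *: "((\<lambda>r. (1 + r\<^sup>2) powr (- (?n / 2))) has_real_derivative
          (- (?n / 2)) * (1 + r\<^sup>2) powr (- (?n / 2) - 1) * (2 * r)) (at r)"
        using pos[of r] by (auto intro!: derivative_eq_intros)
      have "(?F has_real_derivative ?V * (?n * r ^ (?n - 1) * (1 + r\<^sup>2) powr (- (?n / 2)) +
          (- (?n / 2)) * (1 + r\<^sup>2) powr (- (?n / 2) - 1) * (2 * r) * r ^ ?n)) (at r)"
        by (intro DERIV_cmult DERIV_mult * DERIV_pow[folded One_nat_def])
      also have "?V * (?n * r ^ (?n - 1) * (1 + r\<^sup>2) powr (- (?n / 2)) +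
          (- (?n / 2)) * (1 + r\<^sup>2) powr (- (?n / 2) - 1) * (2 * r) * r ^ ?n) =
          ?n * ?V * r ^ (?n - 1) * (1 + r\<^sup>2) powr (- (?n / 2) - 1)"
        unfolding eq r by (simp add: field_simps power2_eq_square)
      finally show ?thesis .
    qed
    show "0 \<le> ?n * ?V * r ^ (?n - 1) * (1 + r\<^sup>2) powr (- (?n / 2) - 1)" if "0 \<le> r" for r
      using that by simp
    have "((\<lambda>r::real. ?V * (r\<^sup>2 / (1 + r\<^sup>2)) powr (?n / 2)) \<longlongrightarrow> ?V * 1 powr (?n / 2)) at_top"
    proof (intro tendsto_intros)
      show "((\<lambda>r::real. r\<^sup>2 / (1 + r\<^sup>2)) \<longlongrightarrow> 1) at_top"
      proof -
        have "((\<lambda>r::real. 1 - 1 / (1 + r\<^sup>2)) \<longlongrightarrow> 1 - 0) at_top"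
          by (intro tendsto_intros tendsto_divide_0[OF tendsto_const] filterlim_at_top_imp_at_infinity
              filterlim_tendsto_add_at_top[OF tendsto_const] filterlim_pow_at_top filterlim_ident) auto
        moreover have "1 - 1 / (1 + r\<^sup>2) = r\<^sup>2 / (1 + r\<^sup>2)" for r :: real
          using pos[of r] by (simp add: field_simps)
        ultimately show ?thesis by simp
      qed
    qed auto
    moreover have "\<forall>\<^sub>F r in at_top. ?V * (r\<^sup>2 / (1 + r\<^sup>2)) powr (?n / 2) = ?F r"
    proof (rule eventually_mono[OF eventually_gt_at_top[of 0]])
      fix r :: real assume r: "r > 0"
      have "(r\<^sup>2) powr (?n / 2) = r ^ ?n"
        using r by (simp add: powr_powr powr_realpow flip: powr_numeral)
      then show "?V * (r\<^sup>2 / (1 + r\<^sup>2)) powr (?n / 2) = ?F r"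
        using r pos[of r] by (simp add: powr_divide powr_minus_divide)
    qed
    ultimately show "(?F \<longlongrightarrow> ?V) at_top"
      by (auto intro: Lim_transform_eventually)
  qed measurable
  finally show ?thesis by simp
qed

text \<open>The cone of height 1 over the cap splits into the cone of height \<open>1 - r\<close>
  and a shell whose points lie within r of the cap, hence in \<open>ball t (2 * r)\<close>.
  Comparing volumes gives \<open>s \<le> (1 - r)^n s + (2 r)^n\<close>, and
  \<open>(1 - r)^n \<le> 1 - r\<close> allows division by r. The centre t is arbitrary, which later
  admits \<open>sgn 0\<close>.\<close>

lemma emeasure_sphere_borel_ball_le:
  fixes t :: "'a::euclidean_space"
  assumes r: "r > 0"
  shows "emeasure sphere_borel (ball t r) \<le> ennreal (2 ^ DIM('a) * r ^ (DIM('a) - 1))"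
proof -
  interpret S: prob_space "sphere_borel :: 'a measure" by (rule prob_space_sphere_borel)
  let ?V = "unit_ball_vol (DIM('a))" and ?n = "DIM('a)"
  define s where "s = measure sphere_borel (ball t r)"
  have s: "emeasure sphere_borel (ball t r) = ennreal s" "0 \<le> s" "s \<le> 1"
    by (auto simp: s_def S.emeasure_eq_measure)
  have "s \<le> 2 ^ ?n * r ^ (?n - 1)"
  proof (cases "r \<ge> 1")
    case True
    have "1 * 1 \<le> (2::real) ^ ?n * r ^ (?n - 1)"
      using True by (intro mult_mono one_le_power) auto
    with s show ?thesis by simp
  next
    case False
    define C where "C R = {x. x \<noteq> 0 \<and> norm x < R \<and> sgn x \<in> ball t r}" for R
    have Ceq: "C R = - {0} \<inter> {x. norm x < R} \<inter> (sgn -` ball t r \<inter> space borel)" for R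
      by (auto simp: C_def)
    have [measurable]: "C R \<in> sets borel" for R
      unfolding Ceq by (intro sets.Int measurable_sets[OF borel_measurable_sgn_euclidean]) auto
    have C: "emeasure lborel (C R) = ennreal (?V * R ^ ?n * s)" if "R \<ge> 0" for R
      unfolding C_def using that s by (subst emeasure_cone) (auto simp: ennreal_mult)
    have "C 1 \<subseteq> C (1 - r) \<union> ball t (2 * r)"
    proof
      fix x assume x: "x \<in> C 1"
      show "x \<in> C (1 - r) \<union> ball t (2 * r)"
      proof (cases "norm x < 1 - r")
        case True with x show ?thesis by (auto simp: C_def)
      next
        case False
        have "x - sgn x = (norm x - 1) *\<^sub>R sgn x"
          using x by (simp add: C_def sgn_div_norm algebra_simps)
        then have "norm (x - sgn x) = \<bar>norm x - 1\<bar>"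
          using x by (simp add: norm_sgn C_def)
        with x False have "norm (x - sgn x) \<le> r" by (auto simp: C_def)
        moreover have "norm (sgn x - t) < r" using x by (auto simp: C_def dist_norm norm_minus_commute)
        ultimately have "norm (x - t) < 2 * r"
          using norm_triangle_ineq[of "x - sgn x" "sgn x - t"] by simp
        then show ?thesis by (simp add: dist_norm norm_minus_commute)
      qed
    qed
    then have "emeasure lborel (C 1) \<le> emeasure lborel (C (1 - r)) + emeasure lborel (ball t (2 * r))"
      by (intro order_trans[OF emeasure_mono emeasure_subadditive]) auto
    then have "ennreal (?V * s) \<le> ennreal (?V * (1 - r) ^ ?n * s + ?V * (2 * r) ^ ?n)"
      using r False s by (simp add: C emeasure_ball)
    then have "?V * s \<le> ?V * (1 - r) ^ ?n * s + ?V * (2 * r) ^ ?n"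
      using r False s by (subst (asm) ennreal_le_iff) auto
    then have "?V * s \<le> ?V * ((1 - r) ^ ?n * s + (2 * r) ^ ?n)"
      by (simp add: algebra_simps)
    then have "s \<le> (1 - r) ^ ?n * s + (2 * r) ^ ?n"
      by (subst (asm) mult_le_cancel_left_pos) auto
    moreover have "(1 - r) ^ ?n * s \<le> (1 - r) * s"
      using r False s by (intro mult_right_mono) (auto simp: power_le_one_iff power_Suc_le_self intro: power_le_imp_le_exp power_decreasing[of 1 _ "1 - r", simplified])
    ultimately have "r * s \<le> (2 * r) ^ ?n" by (simp add: algebra_simps)
    also have "(2 * r) ^ ?n = r * (2 ^ ?n * r ^ (?n - 1))"
      using power_minus_mult[OF DIM_positive[where 'a='a], of r]
      by (simp add: power_mult_distrib mult.commute)
    finally show ?thesis using r by simp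
  qed
  with s show ?thesis by (auto intro!: ennreal_leI)
qed

text \<open>Dyadic shells around y: the growth exponent d beats the exponent b of the singularity,
  so the contributions form a geometric series of ratio \<open>2 powr (b - d)\<close>. At y itself
  the integrand is 0, since \<open>0 powr - b = 0\<close>; the growth bound makes that point null
  anyway. The lemma serves Lebesgue measure (d = n) and surface measure (d = n - 1).\<close>

lemma nn_integral_riesz_le:
  fixes M :: "'a::euclidean_space measure"
  assumes sM: "sets M = sets borel"
    and bd: "b < d" "0 \<le> b" and A: "0 \<le> A" and R: "0 < R"
    and ball: "\<And>r. 0 < r \<Longrightarrow> r \<le> R \<Longrightarrow> emeasure M (ball y r) \<le> ennreal (A * r powr d)"
  shows "(\<integral>\<^sup>+x\<in>ball y R. ennreal (norm (x - y) powr - b) \<partial>M) \<le>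
    ennreal (A * 2 powr b / (1 - 2 powr (b - d)) * R powr (d - b))"
proof -
  define q where "q = (2::real) powr (b - d)"
  have q: "0 < q" "q < 1" using bd by (auto simp: q_def powr_less_one)
  let ?c = "\<lambda>k::nat. (R / 2 ^ Suc k) powr - b"
  have mm: "(\<lambda>x. ennreal (?c k) * indicator (ball y (R / 2 ^ k)) x) \<in> borel_measurable M" for k
    unfolding measurable_cong_sets[OF assms(1) refl]
    by (rule borel_measurable_times_ennreal[OF borel_measurable_const borel_measurable_indicator]) simp
  have "(\<integral>\<^sup>+x\<in>ball y R. ennreal (norm (x - y) powr - b) \<partial>M) \<le>
     (\<integral>\<^sup>+x. (\<Sum>k. ennreal (?c k) * indicator (ball y (R / 2 ^ k)) x) \<partial>M)"
  proof (intro nn_integral_mono)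
    fix x
    show "ennreal (norm (x - y) powr - b) * indicator (ball y R) x \<le>
       (\<Sum>k. ennreal (?c k) * indicator (ball y (R / 2 ^ k)) x)"
    proof (cases "x \<in> ball y R \<and> x \<noteq> y")
      case True
      define u where "u = norm (x - y)"
      have u: "0 < u" "u < R" using True by (auto simp: u_def dist_norm norm_minus_commute)
      obtain m where m: "(1/2) ^ m < u / R"
        using real_arch_pow_inv[of "u / R" "1/2"] u by auto
      \<comment> \<open>The index of the shell that contains x; its minimality yields the upper
        bound on the distance u.\<close>
      define k where "k = (LEAST m. R / 2 ^ Suc m \<le> u)"
      have ex: "R / 2 ^ Suc m \<le> u"
      proof -
        have "R / 2 ^ m < u" using m u by (simp add: field_simps power_one_over)
        moreover have "R / 2 ^ Suc m \<le> R / 2 ^ m" using R by (simp add: field_simps)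
        ultimately show ?thesis by simp
      qed
      have k: "R / 2 ^ Suc k \<le> u" unfolding k_def by (rule LeastI[of _ m]) (rule ex)
      have k2: "u < R / 2 ^ k"
      proof (cases k)
        case 0 with u show ?thesis by simp
      next
        case (Suc j)
        then have "\<not> R / 2 ^ Suc j \<le> u" using not_less_Least[of j "\<lambda>m. R / 2 ^ Suc m \<le> u"] k_def by auto
        with Suc show ?thesis by simp
      qed
      have "u powr - b \<le> ?c k"
        using k u R bd by (intro powr_mono2') auto
      then have "ennreal (norm (x - y) powr - b) * indicator (ball y R) x \<le> ennreal (?c k) * indicator (ball y (R / 2 ^ k)) x"
        using True k2 by (auto simp: u_def dist_norm norm_minus_commute intro!: ennreal_leI)
      also have "\<dots> = (\<Sum>k\<in>{k}. ennreal (?c k) * indicator (ball y (R / 2 ^ k)) x)"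
        by (simp only: sum.insert[OF finite.emptyI] sum.empty empty_iff simp_thms add_0_right)
      also have "\<dots> \<le> (\<Sum>k. ennreal (?c k) * indicator (ball y (R / 2 ^ k)) x)"
        by (intro sum_le_suminf) auto
      finally show ?thesis .
    qed (auto simp: indicator_def)
  qed
  also have "\<dots> = (\<Sum>k. \<integral>\<^sup>+x. ennreal (?c k) * indicator (ball y (R / 2 ^ k)) x \<partial>M)"
    by (rule nn_integral_suminf) (rule mm)
  also have "\<dots> = (\<Sum>k. ennreal (?c k) * emeasure M (ball y (R / 2 ^ k)))"
    by (subst nn_integral_cmult_indicator) (simp_all add: sM)
  also have "\<dots> \<le> (\<Sum>k. ennreal (A * 2 powr b * R powr (d - b) * q ^ k))"
  proof (intro suminf_le allI)
    fix k
    have le: "R / 2 ^ k \<le> R" using R by (simp add: field_simps)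
    have "ennreal (?c k) * emeasure M (ball y (R / 2 ^ k)) \<le> ennreal (?c k) * ennreal (A * (R / 2 ^ k) powr d)"
      using R le by (intro mult_left_mono ball) auto
    also have "\<dots> = ennreal (?c k * (A * (R / 2 ^ k) powr d))"
      using A by (simp add: ennreal_mult)
    also have "?c k * (A * (R / 2 ^ k) powr d) = A * 2 powr b * R powr (d - b) * q ^ k"
    proof -
      have "?c k = R powr - b * 2 powr b * (2 ^ k) powr b"
        using R by (simp add: powr_divide powr_mult powr_minus divide_simps)
      moreover have "(R / 2 ^ k) powr d = R powr d * (2 ^ k) powr - d"
        using R by (simp add: powr_divide powr_minus divide_simps)
      moreover have "(2 ^ k) powr b * (2 ^ k) powr - d = q ^ k"
        by (simp add: q_def powr_realpow[symmetric] powr_powr mult.commute flip: powr_add) 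
           (simp add: algebra_simps)
      moreover have "R powr - b * R powr d = R powr (d - b)"
        by (simp flip: powr_add)
      ultimately show ?thesis by (simp add: ac_simps)
    qed
    finally show "ennreal (?c k) * emeasure M (ball y (R / 2 ^ k)) \<le> ennreal (A * 2 powr b * R powr (d - b) * q ^ k)" .
  qed auto
  also have "\<dots> = ennreal (\<Sum>k. A * 2 powr b * R powr (d - b) * q ^ k)"
    using A q by (intro suminf_ennreal2 summable_mult summable_geometric) auto
  also have "(\<Sum>k. A * 2 powr b * R powr (d - b) * q ^ k) = A * 2 powr b * R powr (d - b) * (1 / (1 - q))"
    using q by (subst suminf_mult) (auto simp: suminf_geometric intro!: summable_geometric)
  finally show ?thesis by (simp add: q_def ac_simps)
qed

subsection \<open>The maximal function on the sphere\<close>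

text \<open>A maximal function adapted to the sphere: the balls are those of the whole space, so M
  may sit inside the unit ball, but they are weighed by the growth \<open>r^(n - 1)\<close> of
  surface measure.\<close>

definition sphere_maximal :: "'a::euclidean_space measure \<Rightarrow> 'a \<Rightarrow> ennreal" where
  "sphere_maximal M t = (SUP r\<in>{0<..}. emeasure M (ball t r) / ennreal (r ^ (DIM('a) - 1)))"

lemma emeasure_ball_le_sphere_maximal:
  fixes M :: "'a::euclidean_space measure"
  assumes "r > 0"
  shows "emeasure M (ball t r) \<le> ennreal (r ^ (DIM('a) - 1)) * sphere_maximal M t"
proof -
  have "emeasure M (ball t r) = ennreal (r ^ (DIM('a) - 1)) * (emeasure M (ball t r) / ennreal (r ^ (DIM('a) - 1)))"
    using assms by (simp add: ennreal_times_divide mult.commute[of "ennreal _"] mult_divide_eq_ennreal)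
  also have "\<dots> \<le> ennreal (r ^ (DIM('a) - 1)) * sphere_maximal M t"
    unfolding sphere_maximal_def using assms by (intro mult_left_mono SUP_upper) auto
  finally show ?thesis .
qed

text \<open>The balls on which M exceeds \<open>l r^(n - 1)\<close> are thinned to a disjoint family
  whose fivefold enlargements still cover. Each enlargement has surface measure at most
  \<open>2^n (5 r)^(n - 1)\<close>, hence the constant. The Borel set U stands in for the superlevel
  set, whose measurability stays open.\<close>

lemma sphere_maximal_weak_type:
  fixes M :: "'a::euclidean_space measure"
  assumes dim: "DIM('a) \<ge> 2" and "finite_measure M" and sM: "sets M = sets borel" and l: "l > 0"
  obtains U where "U \<in> sets borel" "{t. ennreal l < sphere_maximal M t} \<subseteq> U"
    "emeasure sphere_borel U \<le> ennreal (2 ^ DIM('a) * 5 ^ (DIM('a) - 1) / l) * emeasure M UNIV"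
proof -
  interpret M: finite_measure M by fact
  let ?d = "DIM('a) - 1"
  have spM: "space M = UNIV" using sM by (metis sets_eq_imp_space_eq space_borel)
  define E where "E = {t. ennreal l < sphere_maximal M t}"
  have "\<exists>r>0. l * r ^ ?d < measure M (ball t r)" if "t \<in> E" for t
  proof -
    from that obtain r where r: "r > 0" "ennreal l < emeasure M (ball t r) / ennreal (r ^ ?d)"
      by (auto simp: E_def sphere_maximal_def less_SUP_iff)
    from r have "ennreal l < ennreal (measure M (ball t r) / r ^ ?d)"
      by (simp add: M.emeasure_eq_measure divide_ennreal)
    then have "l < measure M (ball t r) / r ^ ?d"
      using l by (subst (asm) ennreal_less_iff) auto
    with r show ?thesis by (auto simp: field_simps)
  qed
  then obtain r where r: "\<And>t. t \<in> E \<Longrightarrow> r t > 0" "\<And>t. t \<in> E \<Longrightarrow> l * r t ^ ?d < measure M (ball t (r t))"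
    by metis
  \<comment> \<open>Vitali's lemma wants bounded radii. Finiteness of M bounds them: if
    \<open>r t > 1\<close>, then \<open>r t\<close> is at most its power of exponent
    \<open>n - 1 \<ge> 1\<close>, which is less than the total mass divided by l.\<close>
  have bd: "0 < r t \<and> r t \<le> max 1 (measure M UNIV / l)" if "t \<in> E" for t
  proof (cases "r t \<le> 1")
    case False
    then have "r t ^ 1 \<le> r t ^ ?d" using dim by (intro power_increasing) auto
    also have "r t ^ ?d < measure M UNIV / l"
      using r(2)[OF that] M.bounded_measure[of "ball t (r t)"] l by (simp add: field_simps spM)
    finally show ?thesis using r(1)[OF that] by simp
  qed (use r(1)[OF that] in auto)
  obtain C where C: "countable C" "C \<subseteq> E"
     "pairwise (\<lambda>i j. disjnt (ball i (r i)) (ball j (r j))) C"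
     "(\<Union>i\<in>E. ball i (r i)) \<subseteq> (\<Union>i\<in>C. ball i (5 * r i))"
    by (rule Vitali_covering_lemma_balls[where S="\<Union>i\<in>E. ball i (r i)" and a="\<lambda>i. i" and r=r and K=E, OF order_refl bd])
  have rC: "r i > 0" "l * r i ^ ?d < measure M (ball i (r i))" if "i \<in> C" for i
    using r C(2) that by auto
  let ?c = "2 ^ DIM('a) * 5 ^ ?d / l"
  show ?thesis
  proof (rule that[of "\<Union>i\<in>C. ball i (5 * r i)"])
    show "(\<Union>i\<in>C. ball i (5 * r i)) \<in> sets borel" by (simp add: open_UN)
    show "{t. ennreal l < sphere_maximal M t} \<subseteq> (\<Union>i\<in>C. ball i (5 * r i))"
    proof
      fix t assume "t \<in> {t. ennreal l < sphere_maximal M t}"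
      then have "t \<in> (\<Union>i\<in>E. ball i (r i))" using r(1)[of t] by (auto simp: E_def)
      with C(4) show "t \<in> (\<Union>i\<in>C. ball i (5 * r i))" by blast
    qed
    \<comment> \<open>The family may be finite, so it is numbered by a set D of naturals and padded
      with empty sets; countable subadditivity and additivity then apply to sequences.\<close>
    have inj: "inj_on (to_nat_on C) C" using C(1) by (rule inj_on_to_nat_on)
    define D where "D = to_nat_on C ` C"
    define g where "g = inv_into C (to_nat_on C)"
    have gC: "g k \<in> C" if "k \<in> D" for k using that by (simp add: g_def D_def inv_into_into)
    have gD: "\<exists>k\<in>D. i = g k" if "i \<in> C" for i
      using that inj by (intro bexI[of _ "to_nat_on C i"]) (auto simp: g_def D_def)
    have ginj: "g k \<noteq> g l" if "k \<in> D" "l \<in> D" "k \<noteq> l" for k l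
      using that by (metis D_def f_inv_into_f g_def)
    define A where "A k = (if k \<in> D then ball (g k) (5 * r (g k)) else {})" for k
    define W where "W k = (if k \<in> D then ball (g k) (r (g k)) else {})" for k
    have "(\<Union>i\<in>C. ball i (5 * r i)) \<subseteq> (\<Union>k. A k)"
    proof
      fix x assume "x \<in> (\<Union>i\<in>C. ball i (5 * r i))"
      then obtain i where i: "i \<in> C" "x \<in> ball i (5 * r i)" by blast
      from gD[OF i(1)] obtain k where "k \<in> D" "i = g k" by blast
      with i show "x \<in> (\<Union>k. A k)" by (auto simp: A_def)
    qed
    then have "emeasure sphere_borel (\<Union>i\<in>C. ball i (5 * r i)) \<le> emeasure sphere_borel (\<Union>k. A k)"
      by (intro emeasure_mono) (auto simp: A_def)
    also have "\<dots> \<le> (\<Sum>k. emeasure sphere_borel (A k))"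
      by (intro emeasure_subadditive_countably) (auto simp: A_def)
    also have "\<dots> \<le> (\<Sum>k. ennreal ?c * emeasure M (W k))"
    proof (intro suminf_le allI)
      fix k
      show "emeasure sphere_borel (A k) \<le> ennreal ?c * emeasure M (W k)"
      proof (cases "k \<in> D")
        case True
        define i where "i = g k"
        have i: "i \<in> C" using gC[OF True] by (simp add: i_def)
        have "emeasure sphere_borel (ball i (5 * r i)) \<le> ennreal (2 ^ DIM('a) * (5 * r i) ^ ?d)"
          using rC[OF i] by (intro emeasure_sphere_borel_ball_le) simp
        also have "\<dots> \<le> ennreal (?c * measure M (ball i (r i)))"
        proof (rule ennreal_leI)
          have "2 ^ DIM('a) * (5 * r i) ^ ?d = ?c * (l * r i ^ ?d)"
            using l by (simp add: power_mult_distrib)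
          also have "\<dots> \<le> ?c * measure M (ball i (r i))"
            using rC(2)[OF i] l by (intro mult_left_mono) auto
          finally show "2 ^ DIM('a) * (5 * r i) ^ ?d \<le> ?c * measure M (ball i (r i))" .
        qed
        also have "\<dots> = ennreal ?c * emeasure M (ball i (r i))"
          unfolding M.emeasure_eq_measure using l by (intro ennreal_mult) auto
        finally show ?thesis using True by (simp add: A_def W_def i_def)
      qed (simp add: A_def)
    qed auto
    also have "\<dots> = ennreal ?c * (\<Sum>k. emeasure M (W k))"
      by simp
    also have "(\<Sum>k. emeasure M (W k)) = emeasure M (\<Union>k. W k)"
    proof (rule suminf_emeasure)
      show "range W \<subseteq> sets M" by (auto simp: W_def sM)
      show "disjoint_family W"
        using C(3) gC ginj unfolding disjoint_family_on_def W_def pairwise_def disjnt_def by auto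
    qed
    also have "\<dots> \<le> emeasure M UNIV"
      using emeasure_space[of M] by (simp add: spM)
    finally show "emeasure sphere_borel (\<Union>i\<in>C. ball i (5 * r i)) \<le> ennreal ?c * emeasure M UNIV"
      by (simp add: mult_left_mono)
  qed
qed

text \<open>At a fixed level the exceptional set \<open>U j\<close> has measure at most a constant
  times the mass of \<open>M j\<close>. A bad point lies in all of these sets, so the bad points
  form a null set. Claiming one good j for each e, rather than a limit, makes convergence of the
  masses to 0 sufficient.\<close>

lemma AE_sphere_maximal_small:
  fixes M :: "nat \<Rightarrow> 'a::euclidean_space measure"
  assumes dim: "DIM('a) \<ge> 2" and fin: "\<And>j. finite_measure (M j)" and sM: "\<And>j. sets (M j) = sets borel"
    and lim: "(\<lambda>j. emeasure (M j) UNIV) \<longlonglongrightarrow> 0"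
  shows "AE t in (sphere_borel :: 'a measure). \<forall>e>0. \<exists>j. sphere_maximal (M j) t \<le> ennreal e"
proof -
  have *: "AE t in sphere_borel. \<exists>j. sphere_maximal (M j) t \<le> ennreal (1 / Suc i)" for i
  proof -
    let ?l = "1 / real (Suc i)"
    have "\<forall>j. \<exists>U. U \<in> sets borel \<and> {t. ennreal ?l < sphere_maximal (M j) t} \<subseteq> U \<and>
      emeasure sphere_borel U \<le> ennreal (2 ^ DIM('a) * 5 ^ (DIM('a) - 1) / ?l) * emeasure (M j) UNIV"
    proof
      fix j
      show "\<exists>U. U \<in> sets borel \<and> {t. ennreal ?l < sphere_maximal (M j) t} \<subseteq> U \<and>
        emeasure sphere_borel U \<le> ennreal (2 ^ DIM('a) * 5 ^ (DIM('a) - 1) / ?l) * emeasure (M j) UNIV"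
        by (rule sphere_maximal_weak_type[OF dim fin sM, of ?l j]) auto
    qed
    then obtain U where U: "\<And>j. U j \<in> sets borel" "\<And>j. {t. ennreal ?l < sphere_maximal (M j) t} \<subseteq> U j"
      "\<And>j. emeasure sphere_borel (U j) \<le> ennreal (2 ^ DIM('a) * 5 ^ (DIM('a) - 1) / ?l) * emeasure (M j) UNIV"
      by metis
    have "(\<lambda>j. ennreal (2 ^ DIM('a) * 5 ^ (DIM('a) - 1) / ?l) * emeasure (M j) UNIV)
        \<longlonglongrightarrow> ennreal (2 ^ DIM('a) * 5 ^ (DIM('a) - 1) / ?l) * 0"
      by (intro ennreal_tendsto_cmult lim) simp
    moreover have "emeasure sphere_borel (\<Inter>j. U j) \<le>
        ennreal (2 ^ DIM('a) * 5 ^ (DIM('a) - 1) / ?l) * emeasure (M j) UNIV" for j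
      using U by (intro order_trans[OF emeasure_mono U(3)[of j]]) auto
    ultimately have "emeasure sphere_borel (\<Inter>j. U j) \<le> ennreal (2 ^ DIM('a) * 5 ^ (DIM('a) - 1) / ?l) * 0"
      by (intro LIMSEQ_le_const[rotated]) auto
    then have "(\<Inter>j. U j) \<in> null_sets sphere_borel"
      using U(1) by (intro null_setsI) auto
    then show ?thesis
      by (rule AE_I') (use U(2) in \<open>auto simp: not_le\<close>)
  qed
  have "AE t in (sphere_borel :: 'a measure). \<forall>i. \<exists>j. sphere_maximal (M j) t \<le> ennreal (1 / Suc i)"
    using * by (simp add: AE_all_countable)
  then show ?thesis
  proof eventually_elim
    case (elim t)
    show ?case
    proof safe
      fix e :: real assume "e > 0"
      then obtain i where i: "inverse (real (Suc i)) < e" using reals_Archimedean by blast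
      obtain j where "sphere_maximal (M j) t \<le> ennreal (1 / Suc i)" using elim by blast
      also have "\<dots> \<le> ennreal e" using i by (intro ennreal_leI) (simp add: inverse_eq_divide)
      finally show "\<exists>j. sphere_maximal (M j) t \<le> ennreal e" by blast
    qed
  qed
qed

section \<open>Kernels controlled by the maximal function\<close>

lemma tendsto_ennreal_0I:
  fixes f :: "'a \<Rightarrow> ennreal"
  assumes "\<And>e. e > 0 \<Longrightarrow> \<forall>\<^sub>F x in F. f x \<le> ennreal e"
  shows "(f \<longlongrightarrow> 0) F"
proof (rule order_tendstoI)
  fix a :: ennreal assume "0 < a"
  then obtain b where b: "0 < b" "b < a" using dense by blast
  then obtain e where e: "b = ennreal e" "e > 0"
    by (cases b) (auto simp: top_unique)
  show "\<forall>\<^sub>F x in F. f x < a"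
    using assms[OF e(2)] by eventually_elim (use b e in auto)
qed auto

text \<open>Up to constants a majorant of two kernels: the Poisson kernel at
  \<open>(1 - d) t\<close> as a function of the boundary point, and the Green function at
  \<open>(1 - d) t\<close>, divided by \<open>(1 - |y|^2)^(n - 1)\<close>, when y is at distance at
  least \<open>d / 2\<close>. In both cases the maximum is comparable with the distance from
  \<open>(1 - d) t\<close> to y.\<close>

definition radial_kernel :: "'a::euclidean_space \<Rightarrow> real \<Rightarrow> 'a \<Rightarrow> real" where
  "radial_kernel t d y = d ^ (DIM('a) - 1) / (max d (dist t y)) ^ (2 * (DIM('a) - 1))"

lemma borel_measurable_radial_kernel [measurable]: "radial_kernel t d \<in> borel_measurable borel"
  unfolding radial_kernel_def by measurable

lemma radial_kernel_nonneg: "d \<ge> 0 \<Longrightarrow> radial_kernel t d y \<ge> 0"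
  by (simp add: radial_kernel_def)

text \<open>On the shell where the distance to t is about \<open>2^k d\<close> the kernel is at most
  \<open>d^(n - 1) / (2^k d)^(2 (n - 1))\<close>, and the surrounding ball has mass at most
  \<open>(2^(k + 1) d)^(n - 1)\<close> times the maximal function. The products are bounded by
  \<open>2^(n - 1) 2^(- k)\<close>, with sum \<open>2^n\<close>.\<close>

lemma nn_integral_radial_kernel_le:
  fixes M :: "'a::euclidean_space measure"
  assumes dim: "DIM('a) \<ge> 2" and sM: "sets M = sets borel" and d: "d > 0"
  shows "(\<integral>\<^sup>+y. ennreal (radial_kernel t d y) \<partial>M) \<le> ennreal (2 ^ DIM('a)) * sphere_maximal M t"
proof -
  let ?n = "DIM('a) - 1"
  let ?c = "\<lambda>k::nat. d ^ ?n / (2 ^ k * d) ^ (2 * ?n)"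
  let ?B = "\<lambda>k::nat. ball t (2 ^ Suc k * d)"
  have mm: "(\<lambda>x. ennreal (?c k) * indicator (?B k) x) \<in> borel_measurable M" for k
    unfolding measurable_cong_sets[OF sM refl]
    by (rule borel_measurable_times_ennreal[OF borel_measurable_const borel_measurable_indicator]) simp
  have "(\<integral>\<^sup>+y. ennreal (radial_kernel t d y) \<partial>M) \<le> (\<integral>\<^sup>+y. (\<Sum>k. ennreal (?c k) * indicator (?B k) y) \<partial>M)"
  proof (rule nn_integral_mono)
    fix y
    define u where "u = dist t y"
    have "\<exists>k. u < 2 ^ Suc k * d \<and> 2 ^ k * d \<le> max d u"
    proof -
      obtain m where m: "u / d < 2 ^ m" using real_arch_pow[of 2 "u / d"] by auto
      have "u < 2 ^ m * d" using m d by (simp add: field_simps)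
      also have "\<dots> \<le> 2 ^ Suc m * d" using d by simp
      finally have ex: "u < 2 ^ Suc m * d" .
      define k where "k = (LEAST m. u < 2 ^ Suc m * d)"
      have k: "u < 2 ^ Suc k * d" unfolding k_def by (rule LeastI[of _ m]) (rule ex)
      have "2 ^ k * d \<le> max d u"
      proof (cases k)
        case (Suc j)
        then have "\<not> u < 2 ^ Suc j * d" using not_less_Least[of j "\<lambda>m. u < 2 ^ Suc m * d"] k_def by auto
        with Suc show ?thesis by simp
      qed simp
      with k show ?thesis by blast
    qed
    then obtain k where k: "u < 2 ^ Suc k * d" "2 ^ k * d \<le> max d u" by blast
    have "radial_kernel t d y \<le> ?c k"
      unfolding radial_kernel_def u_def[symmetric] using k d by (intro divide_left_mono power_mono) auto
    then have "ennreal (radial_kernel t d y) \<le> ennreal (?c k) * indicator (?B k) y"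
      using k by (auto simp: u_def intro!: ennreal_leI)
    also have "\<dots> = (\<Sum>k\<in>{k}. ennreal (?c k) * indicator (?B k) y)"
      by (simp only: sum.insert[OF finite.emptyI] sum.empty empty_iff simp_thms add_0_right)
    also have "\<dots> \<le> (\<Sum>k. ennreal (?c k) * indicator (?B k) y)"
      by (intro sum_le_suminf) auto
    finally show "ennreal (radial_kernel t d y) \<le> (\<Sum>k. ennreal (?c k) * indicator (?B k) y)" .
  qed
  also have "\<dots> = (\<Sum>k. \<integral>\<^sup>+y. ennreal (?c k) * indicator (?B k) y \<partial>M)"
    by (rule nn_integral_suminf) (rule mm)
  also have "\<dots> = (\<Sum>k. ennreal (?c k) * emeasure M (?B k))"
    by (subst nn_integral_cmult_indicator) (simp_all add: sM)
  also have "\<dots> \<le> (\<Sum>k. ennreal (2 ^ ?n * (1/2) ^ k) * sphere_maximal M t)"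
  proof (intro suminf_le allI)
    fix k :: nat
    have "ennreal (?c k) * emeasure M (?B k) \<le> ennreal (?c k) * (ennreal ((2 ^ Suc k * d) ^ ?n) * sphere_maximal M t)"
      using d by (intro mult_left_mono emeasure_ball_le_sphere_maximal) auto
    also have "\<dots> = ennreal (?c k * (2 ^ Suc k * d) ^ ?n) * sphere_maximal M t"
      unfolding mult.assoc[symmetric] using d by (subst ennreal_mult[symmetric]) auto
    also have "\<dots> \<le> ennreal (2 ^ ?n * (1/2) ^ k) * sphere_maximal M t"
    proof (intro mult_right_mono ennreal_leI)
      define a where "a = 2 ^ k * d"
      have a: "a > 0" using d by (simp add: a_def)
      have "?c k * (2 ^ Suc k * d) ^ ?n = d ^ ?n / a ^ (2 * ?n) * (2 * a) ^ ?n"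
        by (simp add: a_def mult.assoc)
      also have "\<dots> = 2 ^ ?n * (d / a) ^ ?n"
        using a by (simp only: power_mult_distrib power_divide mult_2 power_add) (simp add: field_simps)
      also have "d / a = (1/2) ^ k" using d by (simp add: a_def power_one_over)
      finally have "?c k * (2 ^ Suc k * d) ^ ?n = 2 ^ ?n * ((1/2) ^ k) ^ ?n" .
      also have "\<dots> \<le> 2 ^ ?n * ((1/2) ^ k) ^ 1"
        using dim by (intro mult_left_mono power_decreasing) (auto simp: power_le_one)
      finally show "?c k * (2 ^ Suc k * d) ^ ?n \<le> 2 ^ ?n * (1/2) ^ k" by simp
    qed auto
    finally show "ennreal (?c k) * emeasure M (?B k) \<le> ennreal (2 ^ ?n * (1/2) ^ k) * sphere_maximal M t" .
  qed auto
  also have "\<dots> = (\<Sum>k. ennreal (2 ^ ?n * (1/2) ^ k)) * sphere_maximal M t"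
    by simp
  also have "(\<Sum>k. ennreal (2 ^ ?n * (1/2) ^ k)) = ennreal (\<Sum>k. 2 ^ ?n * (1/2) ^ k)"
    by (intro suminf_ennreal2 summable_mult summable_geometric) auto
  also have "(\<Sum>k. 2 ^ ?n * (1/2) ^ k) = (2::real) ^ ?n * 2"
    by (subst suminf_mult) (auto simp: suminf_geometric intro!: summable_geometric)
  also have "(2::real) ^ ?n * 2 = 2 ^ DIM('a)"
    by (rule power_minus_mult) simp
  finally show ?thesis .
qed

text \<open>Split M at \<open>K j\<close>. The point t has positive distance to this closed set, so
  that part of the integral is of order \<open>(1 - r)^(n - 1)\<close>; the rest is bounded by the
  maximal function of a measure of small mass. With compact subsets of a Borel set as
  \<open>K j\<close> this becomes a density theorem; with closed balls exhausting the open ball it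
  concerns measures inside.\<close>

lemma AE_radial_limit_zero:
  fixes M :: "'a::euclidean_space measure" and K :: "nat \<Rightarrow> 'a set"
  assumes dim: "DIM('a) \<ge> 2" and "finite_measure M" and sM: "sets M = sets borel"
    and K: "\<And>j. closed (K j)" and lim: "(\<lambda>j. emeasure M (- K j)) \<longlonglongrightarrow> 0"
  shows "AE t in (sphere_borel :: 'a measure). (\<forall>j. t \<notin> K j) \<longrightarrow>
    ((\<lambda>r. \<integral>\<^sup>+y. ennreal (radial_kernel t (1 - r) y) \<partial>M) \<longlongrightarrow> 0) (at_left 1)"
proof -
  interpret M: finite_measure M by fact
  have spM: "space M = UNIV" using sM by (metis sets_eq_imp_space_eq space_borel)
  define N where "N j = density M (indicator (- K j))" for j
  have KM [measurable]: "K j \<in> sets M" "- K j \<in> sets M" for j using K by (auto simp: sM)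
  have NU: "emeasure (N j) UNIV = emeasure M (- K j)" for j
    unfolding N_def by (subst emeasure_density) (use KM sets.top[of M] in \<open>simp_all add: spM\<close>)
  have sN: "sets (N j) = sets borel" for j by (simp add: N_def sM)
  have spN: "space (N j) = UNIV" for j by (simp add: N_def spM)
  have "AE t in (sphere_borel :: 'a measure). \<forall>e>0. \<exists>j. sphere_maximal (N j) t \<le> ennreal e"
  proof (rule AE_sphere_maximal_small[OF dim _ sN])
    show "finite_measure (N j)" for j
      by (intro finite_measureI) (simp add: spN NU M.emeasure_eq_measure)
  qed (simp add: NU lim)
  then show ?thesis
  proof eventually_elim
    case (elim t)
    show ?case
    proof
      assume t: "\<forall>j. t \<notin> K j"
      let ?I = "\<lambda>r. \<integral>\<^sup>+y. ennreal (radial_kernel t (1 - r) y) \<partial>M"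
      have "\<forall>\<^sub>F r in at_left 1. ?I r \<le> ennreal e" if e: "e > 0" for e
      proof -
        let ?n = "DIM('a) - 1"
        \<comment> \<open>The factor of \<open>nn_integral_radial_kernel_le\<close> is divided out
          in advance, so the part off \<open>K j\<close> contributes at most
          \<open>e / 2\<close>.\<close>
        define e' where "e' = e / 2 / 2 ^ DIM('a)"
        have "e' > 0" using e by (simp add: e'_def)
        with elim obtain j where j: "sphere_maximal (N j) t \<le> ennreal e'" by blast
        have "open (- K j)" "t \<in> - K j" using K t by auto
        then obtain h where h: "h > 0" "ball t h \<subseteq> - K j" using open_contains_ball by blast
        let ?c = "measure M (K j) / h ^ (2 * ?n)"
        have "((\<lambda>r::real. ?c * (1 - r) ^ ?n) \<longlongrightarrow> ?c * (1 - 1) ^ ?n) (at_left 1)"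
          by (intro tendsto_intros)
        then have "((\<lambda>r::real. ?c * (1 - r) ^ ?n) \<longlongrightarrow> 0) (at_left 1)"
          using dim by (simp add: zero_power)
        from order_tendstoD(2)[OF this, of "e / 2"] e
        have "\<forall>\<^sub>F r in at_left 1. ?c * (1 - r) ^ ?n < e / 2" by simp
        moreover have "\<forall>\<^sub>F r in at_left (1::real). r < 1" by (simp add: eventually_at_filter)
        ultimately show ?thesis
        proof eventually_elim
          case (elim r)
          have d: "1 - r > 0" using elim by simp
          have mk: "(\<lambda>y. ennreal (radial_kernel t (1 - r) y)) \<in> borel_measurable M"
            unfolding measurable_cong_sets[OF sM refl] by measurable
          have "?I r = (\<integral>\<^sup>+y. ennreal (radial_kernel t (1 - r) y) * indicator (K j) y
             + indicator (- K j) y * ennreal (radial_kernel t (1 - r) y) \<partial>M)"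
            by (intro nn_integral_cong) (auto simp: indicator_def)
          also have "\<dots> = (\<integral>\<^sup>+y. ennreal (radial_kernel t (1 - r) y) * indicator (K j) y \<partial>M) +
             (\<integral>\<^sup>+y. indicator (- K j) y * ennreal (radial_kernel t (1 - r) y) \<partial>M)"
            using mk by (intro nn_integral_add) auto
          also have "(\<integral>\<^sup>+y. indicator (- K j) y * ennreal (radial_kernel t (1 - r) y) \<partial>M) =
             (\<integral>\<^sup>+y. ennreal (radial_kernel t (1 - r) y) \<partial>N j)"
            unfolding N_def using mk by (subst nn_integral_density) auto
          also have "\<dots> \<le> ennreal (2 ^ DIM('a)) * sphere_maximal (N j) t"
            by (rule nn_integral_radial_kernel_le[OF dim sN d])
          also have "\<dots> \<le> ennreal (2 ^ DIM('a)) * ennreal e'"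
            by (intro mult_left_mono j) simp
          also have "\<dots> = ennreal (e / 2)"
            by (simp add: e'_def flip: ennreal_mult')
          also have "(\<integral>\<^sup>+y. ennreal (radial_kernel t (1 - r) y) * indicator (K j) y \<partial>M) \<le>
             (\<integral>\<^sup>+y. ennreal ((1 - r) ^ ?n / h ^ (2 * ?n)) * indicator (K j) y \<partial>M)"
          proof (rule nn_integral_mono)
            fix y
            show "ennreal (radial_kernel t (1 - r) y) * indicator (K j) y \<le>
              ennreal ((1 - r) ^ ?n / h ^ (2 * ?n)) * indicator (K j) y"
            proof (cases "y \<in> K j")
              case True
              then have "h \<le> dist t y" using h by (auto simp: subset_eq not_less[symmetric])
              then have "radial_kernel t (1 - r) y \<le> (1 - r) ^ ?n / h ^ (2 * ?n)"
                unfolding radial_kernel_def using d h by (intro divide_left_mono power_mono) auto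
              then show ?thesis by (intro mult_right_mono ennreal_leI) auto
            qed auto
          qed
          also have "\<dots> = ennreal (?c * (1 - r) ^ ?n)"
            using d h by (subst nn_integral_cmult_indicator)
              (auto simp: M.emeasure_eq_measure ennreal_mult'[symmetric] mult.commute)
          also have "\<dots> \<le> ennreal (e / 2)" using elim by (intro ennreal_leI) simp
          also have "ennreal (e / 2) + ennreal (e / 2) = ennreal e" using e by (simp flip: ennreal_plus)
          finally show ?case by (simp add: add_mono)
        qed
      qed
      then show "(?I \<longlongrightarrow> 0) (at_left 1)"
        by (rule tendsto_ennreal_0I)
    qed
  qed
qed

subsection \<open>The Green function as a function of the hyperbolic distance\<close>

text \<open>The Green function in the variable p, by \<open>r^2 = p / (1 + p)\<close>. At p = 0 the
  profile is infinite for \<open>n \<ge> 2\<close> and \<open>enn2real\<close> turns this into 0; in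
  integrals over x that exception is the single point y.\<close>

definition green_radial :: "nat \<Rightarrow> real \<Rightarrow> real" where
  "green_radial n p = enn2real (green_profile n (sqrt (p / (1 + p))))"

lemma green_radial_nonneg: "green_radial n p \<ge> 0"
  by (simp add: green_radial_def)

lemma sqrt_ratio_bounds:
  assumes "p > (0::real)"
  shows "0 < sqrt (p / (1 + p))" "sqrt (p / (1 + p)) < 1" "(sqrt (p / (1 + p)))\<^sup>2 = p / (1 + p)"
  using assms by (auto simp: field_simps)

lemma green_radial_eq_integral:
  assumes "p > 0"
  shows "green_radial n p =
      1 / real n * integral {sqrt (p / (1 + p))..1} (\<lambda>t. (1 - t\<^sup>2) ^ (n - 2) / t ^ (n - 1))"
    and "green_profile n (sqrt (p / (1 + p))) = ennreal (green_radial n p)"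
proof -
  let ?f = "\<lambda>t::real. (1 - t\<^sup>2) ^ (n - 2) / t ^ (n - 1)"
  let ?r = "sqrt (p / (1 + p))"
  note r = sqrt_ratio_bounds[OF assms]
  have "0 \<le> integral {?r..1} ?f"
  proof (rule integral_nonneg)
    show "?f integrable_on {?r..1}"
      using r by (intro integrable_continuous_interval continuous_intros) auto
    show "0 \<le> ?f t" if "t \<in> {?r..1}" for t
    proof -
      have "0 \<le> t" "t \<le> 1" using that less_imp_le[OF r(1)] by (auto intro: order_trans simp del: real_sqrt_ge_0_iff)
      then show ?thesis by (auto intro!: divide_nonneg_nonneg zero_le_power simp: power_le_one)
    qed
  qed
  then show *: "green_radial n p = 1 / real n * integral {?r..1} ?f"
    unfolding green_radial_def green_profile_pos[OF r(1)] by simp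
  show "green_profile n ?r = ennreal (green_radial n p)"
    unfolding * green_profile_pos[OF r(1)] ..
qed

text \<open>By \<open>1 - r^2 = 1 / (1 + p)\<close> and \<open>dr/dp = 1 / (2 r (1 + p)^2)\<close>
  the derivative is \<open>- 1 / (2 n (r (1 + p))^n)\<close>, and \<open>r (1 + p)\<close> is the
  square root of \<open>p (1 + p)\<close>.\<close>

lemma DERIV_green_radial:
  assumes n: "n \<ge> 2" and p: "p > 0"
  shows "(green_radial n has_real_derivative - (1 / (2 * real n)) * (p * (1 + p)) powr (- (real n / 2))) (at p)"
proof -
  let ?f = "\<lambda>t::real. (1 - t\<^sup>2) ^ (n - 2) / t ^ (n - 1)"
  let ?r = "\<lambda>p::real. sqrt (p / (1 + p))"
  define R where "R = ?r p"
  have R: "0 < R" "R < 1" "R\<^sup>2 = p / (1 + p)" unfolding R_def by (rule sqrt_ratio_bounds[OF p])+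
  \<comment> \<open>The variable is the lower endpoint of the integral. Writing the integral as a
    difference of integrals that start at a fixed \<open>a < R\<close> makes R an interior point,
    where the fundamental theorem applies.\<close>
  define a where "a = R / 2"
  have a: "0 < a" "a < R" "a < 1" using R by (auto simp: a_def)
  have cont: "continuous_on {a..1} ?f" using a by (intro continuous_intros) auto
  have "((\<lambda>x. integral {a..x} ?f) has_real_derivative ?f R) (at R within {a..1})"
    using a R by (intro integral_has_real_derivative cont) auto
  then have "((\<lambda>x. integral {a..x} ?f) has_real_derivative ?f R) (at R)"
    using a R by (subst (asm) at_within_interior) auto
  then have D1: "((\<lambda>x. 1 / real n * (integral {a..1} ?f - integral {a..x} ?f)) has_real_derivative
      1 / real n * (0 - ?f R)) (at R)"
    by (intro DERIV_cmult DERIV_diff DERIV_const)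
  have D2: "(?r has_real_derivative inverse (sqrt (p / (1 + p))) / 2 * (1 / (1 + p)\<^sup>2)) (at p)"
    using p by (auto intro!: derivative_eq_intros simp: power2_eq_square field_simps)
  have "((\<lambda>p. 1 / real n * (integral {a..1} ?f - integral {a..?r p} ?f)) has_real_derivative
      1 / real n * (0 - ?f R) * (inverse (sqrt (p / (1 + p))) / 2 * (1 / (1 + p)\<^sup>2))) (at p)"
    using DERIV_chain2[OF D1[unfolded R_def] D2] by (simp add: R_def)
  also have "1 / real n * (0 - ?f R) * (inverse (sqrt (p / (1 + p))) / 2 * (1 / (1 + p)\<^sup>2)) =
      - (1 / (2 * real n)) * (p * (1 + p)) powr (- (real n / 2))"
  proof -
    obtain m where m: "n = Suc (Suc m)" using n by (metis Suc_le_D numeral_2_eq_2 Suc_le_mono)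
    have sq: "sqrt (p * (1 + p)) = R * (1 + p)"
    proof (rule real_sqrt_unique)
      have "(R * (1 + p))\<^sup>2 = p / (1 + p) * ((1 + p) * (1 + p))"
        unfolding power_mult_distrib R(3) by (simp only: power2_eq_square)
      also have "\<dots> = p * (1 + p)" using p by (simp add: field_simps)
      finally show "(R * (1 + p))\<^sup>2 = p * (1 + p)" .
      show "0 \<le> R * (1 + p)" using R p by simp
    qed
    have "(p * (1 + p)) powr (real n / 2) = sqrt (p * (1 + p)) ^ n"
      using p by (simp add: powr_half_sqrt[symmetric] powr_powr flip: powr_realpow)
    then have e1: "(p * (1 + p)) powr (- (real n / 2)) = 1 / (R * (1 + p)) ^ n"
      using p by (simp add: powr_minus divide_simps sq)
    have "1 - R\<^sup>2 = 1 / (1 + p)" using p R by (simp add: field_simps)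
    then have e2: "?f R = (1 / (1 + p)) ^ m / R ^ Suc m" by (simp add: m)
    define A where "A = ?f R"
    have A: "A = (1 / (1 + p)) ^ m / R ^ Suc m" using e2 by (simp only: A_def)
    define B where "B = inverse R"
    define C where "C = 1 / (1 + p)\<^sup>2"
    have "A * (B * C) = 1 / (R * (1 + p)) ^ n"
      unfolding A B_def C_def m using R p
      by (simp add: power_mult_distrib power_divide power2_eq_square divide_simps)
    moreover have "1 / real n * (0 - A) * (B / 2 * C) = - (1 / (2 * real n)) * (A * (B * C))"
      using n by (simp add: field_simps)
    ultimately show ?thesis
      unfolding e1 R_def[symmetric] A_def B_def C_def by simp
  qed
  finally have D: "((\<lambda>p. 1 / real n * (integral {a..1} ?f - integral {a..?r p} ?f)) has_real_derivative
      - (1 / (2 * real n)) * (p * (1 + p)) powr (- (real n / 2))) (at p)" .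
  have "isCont ?r p" using D2 by (rule DERIV_isCont)
  then have "(?r \<longlongrightarrow> ?r p) (nhds p)"
    unfolding isCont_def by (rule iffD1[OF tendsto_at_iff_tendsto_nhds[of ?r p]])
  then have "\<forall>\<^sub>F q in nhds p. a < ?r q"
    by (rule order_tendstoD(1)) (use a in \<open>simp only: R_def\<close>)
  moreover have "\<forall>\<^sub>F q in nhds p. q > 0"
    using p by (intro eventually_nhds_in_open[of "{0<..}", simplified]) auto
  ultimately have "\<forall>\<^sub>F q in nhds p. green_radial n q = 1 / real n * (integral {a..1} ?f - integral {a..?r q} ?f)"
  proof eventually_elim
    case (elim q)
    have "integral {a..?r q} ?f + integral {?r q..1} ?f = integral {a..1} ?f"
      using elim sqrt_ratio_bounds[OF elim(2)]
      by (intro Henstock_Kurzweil_Integration.integral_combine integrable_continuous_interval cont) auto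
    then show ?case using elim by (simp add: green_radial_eq_integral)
  qed
  from DERIV_cong_ev[OF refl this refl] D show ?thesis by blast
qed

lemma green_radial_antimono:
  assumes n: "n \<ge> 2" and "0 < p" "p \<le> q"
  shows "green_radial n q \<le> green_radial n p"
proof (rule DERIV_nonpos_imp_nonincreasing[OF assms(3)])
  fix x assume "p \<le> x" "x \<le> q"
  then have "x > 0" using assms by simp
  then show "\<exists>y. (green_radial n has_real_derivative y) (at x) \<and> y \<le> 0"
    using DERIV_green_radial[OF n] by (intro exI conjI) auto
qed

text \<open>Fixes the constant of integration, so that bounds on the derivative become bounds on the
  function. For \<open>p \<ge> 1\<close> the integrand is at most \<open>2^(n - 1)\<close> on an
  interval that shrinks to a point as p grows.\<close>

lemma green_radial_tendsto_0:
  assumes n: "n \<ge> 2"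
  shows "(green_radial n \<longlongrightarrow> 0) at_top"
proof (rule tendsto_sandwich[of "\<lambda>_. 0" _ _ "\<lambda>p. 1 / real n * (2 ^ (n - 1) * (1 - sqrt (p / (1 + p))))"])
  show "\<forall>\<^sub>F p in at_top. 0 \<le> green_radial n p" by (simp add: green_radial_nonneg)
  show "\<forall>\<^sub>F p in at_top. green_radial n p \<le> 1 / real n * (2 ^ (n - 1) * (1 - sqrt (p / (1 + p))))"
  proof (rule eventually_mono[OF eventually_ge_at_top[of 1]])
    fix p :: real assume p: "p \<ge> 1"
    then have p0: "p > 0" by simp
    let ?f = "\<lambda>t::real. (1 - t\<^sup>2) ^ (n - 2) / t ^ (n - 1)"
    let ?r = "sqrt (p / (1 + p))"
    note r = sqrt_ratio_bounds[OF p0]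
    have r2: "1 / 2 \<le> ?r" using p by (intro real_le_rsqrt) (auto simp: field_simps power2_eq_square)
    have "integral {?r..1} ?f \<le> integral {?r..1} (\<lambda>_. 2 ^ (n - 1))"
    proof (rule integral_le)
      show "?f integrable_on {?r..1}"
        using r by (intro integrable_continuous_interval continuous_intros) auto
      fix t assume "t \<in> {?r..1}"
      then have t: "1 / 2 \<le> t" "t \<le> 1" using r2 by auto
      have "?f t \<le> 1 / (1/2) ^ (n - 1)"
        using t by (intro frac_le power_mono power_le_one) (auto simp: power_le_one)
      then show "?f t \<le> 2 ^ (n - 1)" by (simp add: power_divide)
    qed auto
    also have "\<dots> = 2 ^ (n - 1) * (1 - ?r)" using r by simp
    finally show "green_radial n p \<le> 1 / real n * (2 ^ (n - 1) * (1 - ?r))"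
      unfolding green_radial_eq_integral[OF p0] by (intro mult_left_mono) auto
  qed
  have "((\<lambda>p::real. 1 - 1 / (1 + p)) \<longlongrightarrow> 1 - 0) at_top"
    by (intro tendsto_intros tendsto_divide_0[OF tendsto_const] filterlim_at_top_imp_at_infinity
        filterlim_tendsto_add_at_top[OF tendsto_const] filterlim_ident)
  moreover have "\<forall>\<^sub>F p in at_top. 1 - 1 / (1 + p) = p / (1 + p :: real)"
    by (rule eventually_mono[OF eventually_ge_at_top[of 0]]) (simp add: field_simps)
  ultimately have "((\<lambda>p::real. p / (1 + p)) \<longlongrightarrow> 1) at_top"
    by (auto intro: Lim_transform_eventually)
  then have "((\<lambda>p. 1 / real n * (2 ^ (n - 1) * (1 - sqrt (p / (1 + p))))) \<longlongrightarrow>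
      1 / real n * (2 ^ (n - 1) * (1 - sqrt 1))) at_top"
    by (intro tendsto_intros)
  then show "((\<lambda>p. 1 / real n * (2 ^ (n - 1) * (1 - sqrt (p / (1 + p))))) \<longlongrightarrow> 0) at_top" by simp
qed auto

text \<open>Both sides tend to 0 at infinity, so it is enough to compare derivatives:
  \<open>(x (1 + x)) powr (- n/2) \<le> x powr (- b - 1)\<close>. The two ends of the range of b are
  the order \<open>n/2 - 1\<close> of the pole (for \<open>n > 2\<close>) and the order
  \<open>n - 1\<close> of the decay.\<close>

lemma green_radial_le_powr:
  assumes n: "n \<ge> 2" and p: "p > 0" and b: "b > 0" "real n / 2 - 1 \<le> b" "b \<le> real n - 1"
  shows "green_radial n p \<le> p powr - b / (2 * n * b)"
proof -
  define h where "h q = q powr - b / (2 * n * b) - green_radial n q" for q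
  have mono: "h q \<le> h p" if "p \<le> q" for q
  proof (rule DERIV_nonpos_imp_nonincreasing[OF that])
    fix x assume x: "p \<le> x" "x \<le> q"
    then have x0: "x > 0" using p by simp
    have "(h has_real_derivative (- b * x powr (- b - 1)) / (2 * n * b) -
        (- (1 / (2 * real n)) * (x * (1 + x)) powr (- (real n / 2)))) (at x)"
      unfolding h_def using x0
      by (intro DERIV_diff DERIV_cdivide DERIV_green_radial[OF n] has_real_derivative_powr) auto
    moreover have "(x * (1 + x)) powr (- (real n / 2)) \<le> x powr (- b - 1)"
    proof -
      have "x powr (b + 1 - n / 2) \<le> (1 + x) powr (b + 1 - n / 2)"
        using x0 b by (intro powr_mono2) auto
      also have "\<dots> \<le> (1 + x) powr (n / 2)"
        using x0 b by (intro powr_mono) auto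
      finally have "x powr (n / 2) * x powr (b + 1 - n / 2) \<le> x powr (n / 2) * (1 + x) powr (n / 2)"
        by (intro mult_left_mono) auto
      then have "x powr (b + 1) \<le> (x * (1 + x)) powr (n / 2)"
        using x0 by (simp add: powr_mult flip: powr_add)
      then have "1 / (x * (1 + x)) powr (n / 2) \<le> 1 / x powr (b + 1)"
        using x0 by (intro divide_left_mono) auto
      then show ?thesis using x0 by (simp add: powr_minus_divide[symmetric])
    qed
    then have "(- b * x powr (- b - 1)) / (2 * n * b) -
        (- (1 / (2 * real n)) * (x * (1 + x)) powr (- (real n / 2))) \<le> 0"
      using b n by (simp add: field_simps)
    ultimately show "\<exists>y. (h has_real_derivative y) (at x) \<and> y \<le> 0" by blast
  qed
  have "((\<lambda>q. q powr - b / (2 * n * b)) \<longlongrightarrow> 0 / (2 * n * b)) at_top"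
    using b n by (intro tendsto_divide tendsto_neg_powr tendsto_const filterlim_ident) auto
  then have "(h \<longlongrightarrow> 0 / (2 * n * b) - 0) at_top"
    unfolding h_def using green_radial_tendsto_0[OF n] by (intro tendsto_diff)
  moreover have "\<forall>\<^sub>F q in at_top. h q \<le> h p"
    by (rule eventually_mono[OF eventually_ge_at_top[of p]]) (rule mono)
  ultimately have "0 / (2 * n * b) - 0 \<le> h p"
    by (intro tendsto_upperbound) auto
  then show ?thesis by (simp add: h_def)
qed

section \<open>The invariant variable p\<close>

text \<open>Not the hyperbolic distance but the square of \<open>sinh\<close> of half of it, for the
  metric \<open>2 |dx| / (1 - |x|^2)\<close>.\<close>

definition hyp_dist :: "'a::euclidean_space \<Rightarrow> 'a \<Rightarrow> real" where
  "hyp_dist x y = (norm (x - y))\<^sup>2 / ((1 - (norm x)\<^sup>2) * (1 - (norm y)\<^sup>2))"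

lemma one_minus_norm_sq_pos: "norm x < 1 \<Longrightarrow> 0 < 1 - (norm x)\<^sup>2"
  by (simp add: power_less_one_iff abs_square_less_1)

lemma hyp_dist_nonneg: "norm x < 1 \<Longrightarrow> norm y < 1 \<Longrightarrow> hyp_dist x y \<ge> 0"
  using one_minus_norm_sq_pos[of x] one_minus_norm_sq_pos[of y] by (simp add: hyp_dist_def)

lemma hyp_dist_pos: "norm x < 1 \<Longrightarrow> norm y < 1 \<Longrightarrow> x \<noteq> y \<Longrightarrow> hyp_dist x y > 0"
  using one_minus_norm_sq_pos[of x] one_minus_norm_sq_pos[of y] by (simp add: hyp_dist_def)

text \<open>The square of the bracket is \<open>|x - y|^2 + (1 - |x|^2) (1 - |y|^2)\<close>;
  dividing by the product leaves \<open>p / (1 + p)\<close>. The case x = y is included.\<close>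

lemma green_function_eq:
  fixes x y :: "'a::euclidean_space"
  assumes "norm x < 1" "norm y < 1"
  shows "green_function x y = green_profile (DIM('a)) (sqrt (hyp_dist x y / (1 + hyp_dist x y)))"
proof -
  let ?N = "(norm (x - y))\<^sup>2" and ?D = "(1 - (norm x)\<^sup>2) * (1 - (norm y)\<^sup>2)"
  have D: "?D > 0" using assms one_minus_norm_sq_pos[of x] one_minus_norm_sq_pos[of y] by simp
  have "1 + (norm x)\<^sup>2 * (norm y)\<^sup>2 - 2 * (x \<bullet> y) = ?N + ?D"
    by (simp add: power2_norm_eq_inner inner_diff algebra_simps inner_commute)
  then have "norm (x - y) / bracket x y = sqrt (?N / (?N + ?D))"
    by (simp add: bracket_def real_sqrt_divide)
  also have "?N / (?N + ?D) = hyp_dist x y / (1 + hyp_dist x y)"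
  proof -
    have "N / (N + d) = (N / d) / (1 + N / d)" if "d > 0" "N \<ge> 0" for N d :: real
      using that by (simp add: field_simps)
    from this[OF D zero_le_power2] show ?thesis unfolding hyp_dist_def .
  qed
  finally show ?thesis by (simp add: green_function_def)
qed

lemma green_function_eq_radial:
  fixes x y :: "'a::euclidean_space"
  assumes "norm x < 1" "norm y < 1" "x \<noteq> y"
  shows "green_function x y = ennreal (green_radial (DIM('a)) (hyp_dist x y))"
  using green_function_eq[OF assms(1,2)] green_radial_eq_integral(2)[OF hyp_dist_pos[OF assms]] by simp

lemma borel_measurable_green_profile [measurable]: "green_profile n \<in> borel_measurable borel"
proof -
  \<comment> \<open>The interval of integration depends on r; as the indicator of a set of pairs it
    makes the integrand jointly measurable.\<close>
  have "(\<lambda>r. \<integral>\<^sup>+t. ennreal ((1 - t\<^sup>2) ^ (n - 2) / t ^ (n - 1)) * indicator {(r, t). r \<le> t \<and> t \<le> 1} (r, t) \<partial>lborel)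
      \<in> borel_measurable borel"
    by measurable
  also have "(\<lambda>r. \<integral>\<^sup>+t. ennreal ((1 - t\<^sup>2) ^ (n - 2) / t ^ (n - 1)) * indicator {(r, t). r \<le> t \<and> t \<le> 1} (r, t) \<partial>lborel) =
      (\<lambda>r. \<integral>\<^sup>+t\<in>{r..1}. ennreal ((1 - t\<^sup>2) ^ (n - 2) / t ^ (n - 1)) \<partial>lborel)"
    by (intro ext nn_integral_cong) (auto simp: indicator_def)
  finally show ?thesis unfolding green_profile_def[abs_def] by measurable
qed

lemma borel_measurable_green_function [measurable]:
  assumes [measurable]: "f \<in> borel_measurable M" "g \<in> borel_measurable M"
  shows "(\<lambda>z. green_function (f z) (g z :: 'a::euclidean_space)) \<in> borel_measurable M"
  unfolding green_function_def bracket_def by measurable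

subsection \<open>Integration by parts\<close>

abbreviation has_partial :: "('a::euclidean_space \<Rightarrow> real) \<Rightarrow> real \<Rightarrow> 'a \<Rightarrow> 'a \<Rightarrow> bool" where
  "has_partial f D b x \<equiv> ((\<lambda>s. f (x + s *\<^sub>R b)) has_real_derivative D) (at 0)"

lemma has_partial_cong:
  assumes "open S" "x \<in> S" "\<And>y. y \<in> S \<Longrightarrow> f y = g y"
  shows "has_partial f D b x \<longleftrightarrow> has_partial g D b x"
proof (rule DERIV_cong_ev[OF refl _ refl])
  have "((\<lambda>s::real. x + s *\<^sub>R b) \<longlongrightarrow> x + 0 *\<^sub>R b) (nhds 0)"
    by (intro tendsto_intros filterlim_ident)
  then have "\<forall>\<^sub>F s in nhds (0::real). x + s *\<^sub>R b \<in> S"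
    using assms(1,2) by (intro topological_tendstoD) auto
  then show "\<forall>\<^sub>F s in nhds (0::real). f (x + s *\<^sub>R b) = g (x + s *\<^sub>R b)"
    by eventually_elim (rule assms(3))
qed

lemma has_partial_shift:
  assumes "has_partial f D b (x + s *\<^sub>R b)"
  shows "((\<lambda>s. f (x + s *\<^sub>R b)) has_real_derivative D) (at s)"
proof -
  have "((\<lambda>r. f (x + (s + r) *\<^sub>R b)) has_real_derivative D) (at 0)"
    using assms by (simp add: scaleR_add_left add.assoc)
  then show ?thesis
    using DERIV_shift[of "\<lambda>s. f (x + s *\<^sub>R b)" D 0 s] by (simp add: add.commute)
qed

text \<open>Translation invariance gives every difference quotient of X the integral 0, and
  dominated convergence passes to the derivative. Everything happens along the one direction b,
  without iterated integrals over coordinates.\<close>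

lemma integral_partial_zero:
  fixes X D :: "'a::euclidean_space \<Rightarrow> real"
  assumes S: "open S" and K: "compact K" "K \<subseteq> S"
    and cX: "continuous_on S X" and cD: "continuous_on S D"
    and der: "\<And>x. x \<in> S \<Longrightarrow> has_partial X (D x) b x"
    and zero: "\<And>x. x \<in> S \<Longrightarrow> x \<notin> K \<Longrightarrow> X x = 0"
  shows "integrable lborel (\<lambda>x. indicator S x * D x)" "(\<integral>x. indicator S x * D x \<partial>lborel) = 0"
proof -
  define X0 where "X0 x = (if x \<in> S then X x else 0)" for x
  define D0 where "D0 x = (if x \<in> S then D x else 0)" for x
  have oK: "open (- K)" using K by (simp add: compact_imp_closed open_Compl)
  have X0K: "X0 x = 0" if "x \<notin> K" for x using that zero by (simp add: X0_def)
  have D0K: "D0 x = 0" if "x \<notin> K" for x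
  proof (cases "x \<in> S")
    case True
    have "has_partial X 0 b x \<longleftrightarrow> has_partial (\<lambda>_. 0) 0 b x"
      using S oK True that zero by (intro has_partial_cong[where S="S \<inter> - K"]) auto
    with DERIV_unique[OF der[OF True], of 0] show ?thesis by (simp add: D0_def)
  qed (simp add: D0_def)
  \<comment> \<open>The extensions by 0 are continuous because S and the complement of K are open,
    cover the space, and the extensions vanish on the second set.\<close>
  have un: "S \<union> - K = UNIV" using K by auto
  have c0: "continuous_on UNIV F" if "continuous_on S F" "\<And>x. x \<notin> K \<Longrightarrow> F x = 0" for F :: "'a \<Rightarrow> real"
  proof -
    have "continuous_on (- K) F"
      using that(2) by (subst continuous_on_cong[OF refl, of _ _ "\<lambda>_. 0"]) auto
    with continuous_on_open_Un[OF S oK that(1)] show ?thesis by (simp add: un)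
  qed
  have cX0: "continuous_on UNIV X0"
    using cX X0K by (intro c0) (simp_all add: X0_def cong: continuous_on_cong)
  have cD0: "continuous_on UNIV D0"
    using cD D0K by (intro c0) (simp_all add: D0_def cong: continuous_on_cong)
  have der0: "has_partial X0 (D0 x) b x" for x
  proof (cases "x \<in> S")
    case True
    have "has_partial X0 (D x) b x \<longleftrightarrow> has_partial X (D x) b x"
      by (rule has_partial_cong[OF S True]) (simp add: X0_def)
    with der[OF True] True show ?thesis by (simp add: D0_def)
  next
    case False
    then have "x \<in> - K" using K by auto
    have "has_partial X0 0 b x \<longleftrightarrow> has_partial (\<lambda>_. 0) 0 b x"
      by (rule has_partial_cong[OF oK \<open>x \<in> - K\<close>]) (simp add: X0K)
    then show ?thesis using False by (simp add: D0_def)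
  qed
  have [measurable]: "X0 \<in> borel_measurable borel" "D0 \<in> borel_measurable borel"
    using cX0 cD0 by (auto intro: borel_measurable_continuous_onI)
  have "bounded (D0 ` K)"
    using K cD0 by (intro compact_imp_bounded compact_continuous_image) (auto intro: continuous_on_subset)
  then obtain C where C: "\<And>x. x \<in> K \<Longrightarrow> \<bar>D0 x\<bar> \<le> C" by (auto simp: bounded_iff)
  \<comment> \<open>K may be empty, and then C may be negative.\<close>
  define C' where "C' = max C 0"
  have C': "\<bar>D0 x\<bar> \<le> C'" for x
    using C[of x] D0K[of x] by (cases "x \<in> K") (auto simp: C'_def)
  obtain R where R: "\<And>x. x \<in> K \<Longrightarrow> norm x \<le> R"
    using compact_imp_bounded[OF K(1)] by (auto simp: bounded_iff)
  let ?h = "\<lambda>k. 1 / real (Suc k)"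
  define q where "q k x = (X0 (x + ?h k *\<^sub>R b) - X0 x) / ?h k" for k x
  have iX0: "integrable lborel X0"
  proof -
    have "integrable lborel (\<lambda>x. indicator K x *\<^sub>R X0 x)"
      by (rule borel_integrable_compact[OF K(1)]) (use cX0 in \<open>auto intro: continuous_on_subset\<close>)
    then show ?thesis by (rule back_subst[of "integrable lborel"]) (auto simp: X0K indicator_def fun_eq_iff)
  qed
  have "(\<lambda>k. \<integral>x. q k x \<partial>lborel) \<longlonglongrightarrow> (\<integral>x. D0 x \<partial>lborel)"
    and int0: "integrable lborel D0"
  proof -
    \<comment> \<open>By the mean value theorem a quotient is a value of the derivative, hence
      bounded by C'. The steps have length at most \<open>|b|\<close>, so all quotients live in the
      ball of radius \<open>R + |b|\<close>.\<close>
    let ?w = "\<lambda>x::'a. C' * indicator (cball 0 (R + norm b)) x"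
    have w: "integrable lborel ?w"
      using emeasure_lborel_cball_finite[of "0::'a" "R + norm b"]
      by (intro integrable_mult_right integrable_real_indicator) auto
    have lim: "AE x in lborel. (\<lambda>k. q k x) \<longlonglongrightarrow> D0 x"
    proof (rule AE_I2)
      fix x
      have 1: "((\<lambda>s. (X0 (x + s *\<^sub>R b) - X0 x) / s) \<longlongrightarrow> D0 x) (at 0)"
        using der0[of x] unfolding DERIV_def by simp
      have "filterlim ?h (at 0) sequentially"
        using LIMSEQ_inverse_real_of_nat by (simp add: filterlim_at inverse_eq_divide)
      from filterlim_compose[OF 1 this] show "(\<lambda>k. q k x) \<longlonglongrightarrow> D0 x" by (simp add: q_def)
    qed
    have bound: "AE x in lborel. norm (q k x) \<le> ?w x" for k
    proof (rule AE_I2)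
      fix x
      show "norm (q k x) \<le> ?w x"
      proof (cases "x \<in> cball 0 (R + norm b)")
        case True
        have "\<exists>z>0. z < ?h k \<and> X0 (x + ?h k *\<^sub>R b) - X0 (x + 0 *\<^sub>R b) = (?h k - 0) * D0 (x + z *\<^sub>R b)"
          by (rule MVT2[where f="\<lambda>s. X0 (x + s *\<^sub>R b)"]) (auto intro: has_partial_shift der0)
        then obtain z where "X0 (x + ?h k *\<^sub>R b) - X0 x = ?h k * D0 (x + z *\<^sub>R b)" by auto
        then have "q k x = D0 (x + z *\<^sub>R b)" by (simp add: q_def)
        with C'[of "x + z *\<^sub>R b"] True show ?thesis by simp
      next
        case False
        have "x \<notin> K" using R[of x] False norm_ge_zero[of b] by force
        moreover have "x + ?h k *\<^sub>R b \<notin> K"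
        proof
          assume "x + ?h k *\<^sub>R b \<in> K"
          then have "norm (x + ?h k *\<^sub>R b) \<le> R" by (rule R)
          moreover have "norm (?h k *\<^sub>R b) \<le> norm b"
            by (simp add: divide_le_eq mult_le_cancel_left1)
          ultimately have "norm x \<le> R + norm b"
            using norm_triangle_ineq4[of "x + ?h k *\<^sub>R b" "?h k *\<^sub>R b"] by simp
          with False show False by simp
        qed
        ultimately show ?thesis using False by (simp add: q_def X0K)
      qed
    qed
    have mq: "q k \<in> borel_measurable lborel" for k unfolding q_def by measurable
    have mD: "D0 \<in> borel_measurable lborel" by simp
    show "(\<lambda>k. \<integral>x. q k x \<partial>lborel) \<longlonglongrightarrow> (\<integral>x. D0 x \<partial>lborel)"
      by (rule integral_dominated_convergence[OF mD mq w lim bound])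
    show "integrable lborel D0"
      by (rule integrable_dominated_convergence[OF mD mq w lim bound])
  qed
  moreover have "(\<integral>x. q k x \<partial>lborel) = 0" for k
  proof -
    have it: "integrable lborel (\<lambda>x. X0 (x + ?h k *\<^sub>R b))"
    proof -
      have "integrable (distr lborel borel ((+) (?h k *\<^sub>R b))) X0" using iX0 by (simp add: lborel_distr_plus)
      then show ?thesis by (subst (asm) integrable_distr_eq) (auto simp: add.commute)
    qed
    have "(\<integral>x. q k x \<partial>lborel) = ((\<integral>x. X0 (x + ?h k *\<^sub>R b) \<partial>lborel) - (\<integral>x. X0 x \<partial>lborel)) / ?h k"
      unfolding q_def using it iX0 by simp
    also have "(\<integral>x. X0 (x + ?h k *\<^sub>R b) \<partial>lborel) = (\<integral>x. X0 x \<partial>lborel)"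
      by (rule lborel_integral_translate) measurable
    finally show ?thesis by simp
  qed
  ultimately have "(\<integral>x. D0 x \<partial>lborel) = 0" by (simp add: LIMSEQ_const_iff)
  moreover have "(\<lambda>x. indicator S x * D x) = D0" by (auto simp: D0_def indicator_def)
  ultimately show "integrable lborel (\<lambda>x. indicator S x * D x)" "(\<integral>x. indicator S x * D x \<partial>lborel) = 0"
    using int0 by simp_all
qed

definition hyp_weight :: "'a::euclidean_space \<Rightarrow> real" where
  "hyp_weight x = 1 / (1 - (norm x)\<^sup>2) ^ (DIM('a) - 2)"

lemma has_partial_norm_sq:
  fixes x b :: "'a::euclidean_space"
  assumes "b \<in> Basis"
  shows "has_partial (\<lambda>x. (norm (x - y))\<^sup>2) (2 * ((x - y) \<bullet> b)) b x"
proof -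
  have "(norm (x + s *\<^sub>R b - y))\<^sup>2 = (norm (x - y))\<^sup>2 + 2 * s * ((x - y) \<bullet> b) + s\<^sup>2" for s
  proof -
    have eq: "x + s *\<^sub>R b - y = (x - y) + s *\<^sub>R b" by simp
    show ?thesis unfolding eq power2_norm_eq_inner using assms
      by (simp add: inner_add_left inner_add_right inner_commute power2_eq_square)
  qed
  then show ?thesis by (auto intro!: derivative_eq_intros)
qed

lemma has_partial_norm_sq_0:
  fixes x b :: "'a::euclidean_space"
  assumes "b \<in> Basis"
  shows "has_partial (\<lambda>x. (norm x)\<^sup>2) (2 * (x \<bullet> b)) b x"
  using has_partial_norm_sq[OF assms, where y=0 and x=x] by simp

lemma DERIV_one_over_power:
  fixes N :: "real \<Rightarrow> real"
  assumes "(N has_real_derivative N') (at 0)" "1 - N 0 \<noteq> 0"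
  shows "((\<lambda>s. 1 / (1 - N s) ^ m) has_real_derivative real m * N' / (1 - N 0) ^ Suc m) (at 0)"
proof (cases m)
  case (Suc k)
  have 1: "((\<lambda>s. (1 - N s) ^ Suc k) has_real_derivative - real (Suc k) * (1 - N 0) ^ k * N') (at 0)"
    using DERIV_power_Suc[OF DERIV_diff[OF DERIV_const assms(1), of 1], of k] by (simp add: algebra_simps)
  have q: "(1 - N 0) ^ Suc k \<noteq> 0" using assms(2) by simp
  have "(0 * (1 - N 0) ^ Suc k - 1 * (- real (Suc k) * (1 - N 0) ^ k * N')) / ((1 - N 0) ^ Suc k * (1 - N 0) ^ Suc k)
      = real (Suc k) * N' / (1 - N 0) ^ Suc (Suc k)"
    using assms(2) by (simp add: divide_simps) (simp add: algebra_simps)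
  with DERIV_divide[OF DERIV_const 1 q, of 1] show ?thesis unfolding Suc by simp
qed simp

lemma has_partial_weight:
  fixes x b :: "'a::euclidean_space"
  assumes dim: "DIM('a) \<ge> 2" and b: "b \<in> Basis" and x: "norm x < 1"
  shows "has_partial hyp_weight (2 * (real (DIM('a)) - 2) * (x \<bullet> b) / (1 - (norm x)\<^sup>2) ^ (DIM('a) - 1)) b x"
proof -
  obtain m where m: "DIM('a) = Suc (Suc m)" using dim by (metis Suc_le_D numeral_2_eq_2 Suc_le_mono)
  have "1 - (norm (x + 0 *\<^sub>R b))\<^sup>2 \<noteq> 0" using one_minus_norm_sq_pos[OF x] by simp
  from DERIV_one_over_power[OF has_partial_norm_sq_0[OF b] this, of m] show ?thesis
    by (simp add: hyp_weight_def m mult.assoc mult.left_commute[of 2])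
qed

lemma continuous_on_weight: "continuous_on unit_ball (hyp_weight :: 'a::euclidean_space \<Rightarrow> real)"
  unfolding hyp_weight_def
  by (intro continuous_intros) (use one_minus_norm_sq_pos in force)

text \<open>Outside the ball a test function is arbitrary, so all vanishing is stated inside. A
  compact relative support K is closed, hence the ball minus K is open and the derivatives vanish
  there along with the function.\<close>

lemma C2c_ballD:
  fixes \<psi> :: "'a::euclidean_space \<Rightarrow> real"
  assumes "\<psi> \<in> C2c_ball"
  obtains K where "compact K" "K \<subseteq> unit_ball"
    "\<And>x. x \<in> unit_ball \<Longrightarrow> x \<notin> K \<Longrightarrow> \<psi> x = 0"
    "\<And>x b. x \<in> unit_ball \<Longrightarrow> x \<notin> K \<Longrightarrow> partial_deriv b \<psi> x = 0"
    "\<And>x. x \<in> unit_ball \<Longrightarrow> x \<notin> K \<Longrightarrow> hyperbolic_laplacian \<psi> x = 0"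
proof -
  define K where "K = unit_ball \<inter> closure {x \<in> unit_ball. \<psi> x \<noteq> 0}"
  have K: "compact K" using assms by (simp add: C2c_ball_def K_def)
  have sub: "K \<subseteq> unit_ball" by (auto simp: K_def)
  have z: "\<psi> x = 0" if "x \<in> unit_ball" "x \<notin> K" for x
    using that closure_subset[of "{x \<in> unit_ball. \<psi> x \<noteq> 0}"] by (auto simp: K_def)
  have o: "open (unit_ball - K)" using K by (simp add: compact_imp_closed open_Diff)
  have pz: "partial_deriv b f x = 0"
    if "x \<in> unit_ball" "x \<notin> K" "\<And>x. x \<in> unit_ball \<Longrightarrow> x \<notin> K \<Longrightarrow> f x = 0" for f :: "'a \<Rightarrow> real" and b x
  proof -
    have "has_partial f 0 b x \<longleftrightarrow> has_partial (\<lambda>_. 0) 0 b x"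
      using that by (intro has_partial_cong[OF o]) auto
    then show ?thesis by (simp add: partial_deriv_def DERIV_imp_deriv)
  qed
  show thesis
  proof (rule that[OF K sub z])
    show "partial_deriv b \<psi> x = 0" if "x \<in> unit_ball" "x \<notin> K" for b x
      using that z by (intro pz)
    then show "hyperbolic_laplacian \<psi> x = 0" if "x \<in> unit_ball" "x \<notin> K" for x
      using that pz[OF that] by (simp add: hyperbolic_laplacian_def laplacian_def)
  qed
qed

lemma C1_on_has_partial:
  assumes "C1_on S f" "open S" "x \<in> S" 
  shows "has_partial f (partial_deriv b f x) b x"
proof -
  have "f differentiable (at x within S)"
    using assms unfolding C1_on_def differentiable_on_def by blast
  then have "f differentiable (at x)"
    by (simp only: at_within_open[OF assms(3,2)])
  then obtain f' where f': "(f has_derivative f') (at x)" by (auto simp: differentiable_def)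
  have 1: "((\<lambda>s. x + s *\<^sub>R b) has_derivative (\<lambda>s. 0 + s *\<^sub>R b)) (at 0)"
    by (intro has_derivative_add has_derivative_const has_derivative_scaleR_left has_derivative_ident)
  have 2: "(f has_derivative f') (at (x + 0 *\<^sub>R b))" using f' by simp
  note has_derivative_compose[OF 1 2]
  then have "(\<lambda>s. f (x + s *\<^sub>R b)) differentiable (at 0)" by (auto simp: differentiable_def)
  then show ?thesis
    unfolding partial_deriv_def by (simp add: DERIV_deriv_iff_real_differentiable)
qed

lemma C1_on_continuous: "C1_on S f \<Longrightarrow> continuous_on S f"
  by (simp add: C1_on_def differentiable_imp_continuous_on)

lemma C2_on_continuous_laplacian:
  fixes \<psi> :: "'a::euclidean_space \<Rightarrow> real"
  assumes "C2_on unit_ball \<psi>"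
  shows "continuous_on unit_ball (hyperbolic_laplacian \<psi>)"
  using assms unfolding hyperbolic_laplacian_def laplacian_def C2_on_def C1_on_def
  by (intro continuous_intros) auto

text \<open>Green's second identity: the difference of the two integrands is the divergence of
  \<open>w (v grad \<psi> - \<psi> grad v)\<close>, which is compactly supported with \<psi>. Second
  derivatives of v enter as the derivatives \<open>Dv\<close> of the flux \<open>w vb\<close>, the
  quantity that is computed for both kernels.\<close>

lemma green_identity:
  fixes \<psi> v :: "'a::euclidean_space \<Rightarrow> real" and vb Dv :: "'a \<Rightarrow> 'a \<Rightarrow> real"
  assumes dim: "DIM('a) \<ge> 2" and psi: "\<psi> \<in> C2c_ball"
    and cv: "continuous_on unit_ball v"
    and cvb: "\<And>b. b \<in> Basis \<Longrightarrow> continuous_on unit_ball (vb b)"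
    and cDv: "\<And>b. b \<in> Basis \<Longrightarrow> continuous_on unit_ball (Dv b)"
    and v: "\<And>b x. b \<in> Basis \<Longrightarrow> norm x < 1 \<Longrightarrow> has_partial v (vb b x) b x"
    and wv: "\<And>b x. b \<in> Basis \<Longrightarrow> norm x < 1 \<Longrightarrow> has_partial (\<lambda>x. hyp_weight x * vb b x) (Dv b x) b x"
  shows "(\<integral>x. indicator unit_ball x * (v x * hyperbolic_laplacian \<psi> x / (1 - (norm x)\<^sup>2) ^ DIM('a)) \<partial>lborel) =
    (\<integral>x. indicator unit_ball x * (\<psi> x * (\<Sum>b\<in>Basis. Dv b x)) \<partial>lborel)"
proof -
  obtain m where m: "DIM('a) = Suc (Suc m)" using dim by (metis Suc_le_D numeral_2_eq_2 Suc_le_mono)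
  obtain K where K: "compact K" "K \<subseteq> unit_ball"
    "\<And>x. x \<in> unit_ball \<Longrightarrow> x \<notin> K \<Longrightarrow> \<psi> x = 0"
    "\<And>x b. x \<in> unit_ball \<Longrightarrow> x \<notin> K \<Longrightarrow> partial_deriv b \<psi> x = 0"
    "\<And>x. x \<in> unit_ball \<Longrightarrow> x \<notin> K \<Longrightarrow> hyperbolic_laplacian \<psi> x = 0"
    using C2c_ballD[OF psi] by metis
  have C2: "C2_on unit_ball \<psi>" using psi by (simp add: C2c_ball_def)
  then have C1: "C1_on unit_ball \<psi>" and C1b: "\<And>b. b \<in> Basis \<Longrightarrow> C1_on unit_ball (partial_deriv b \<psi>)"
    by (auto simp: C2_on_def)
  have cpsi: "continuous_on unit_ball \<psi>" using C1 by (rule C1_on_continuous)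
  have cpb: "continuous_on unit_ball (partial_deriv b \<psi>)" if "b \<in> Basis" for b
    using C1b[OF that] by (rule C1_on_continuous)
  have cpbb: "continuous_on unit_ball (partial_deriv b (partial_deriv b \<psi>))" if "b \<in> Basis" for b
    using C1b[OF that] that by (simp add: C1_on_def)
  have one: "1 - (norm x)\<^sup>2 \<noteq> 0" if "x \<in> unit_ball" for x :: 'a
    using one_minus_norm_sq_pos[of x] that by auto
  define wb where "wb b x = 2 * (real (DIM('a)) - 2) * (x \<bullet> b) / (1 - (norm x)\<^sup>2) ^ (DIM('a) - 1)" for b x :: 'a
  have cwb: "continuous_on unit_ball (wb b)" for b
    unfolding wb_def by (intro continuous_intros) (use one in auto)
  define T where "T b x = wb b x * partial_deriv b \<psi> x + hyp_weight x * partial_deriv b (partial_deriv b \<psi>) x" for b x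
  \<comment> \<open>The product rule for \<open>div (w grad \<psi>)\<close>: differentiating the
    power \<open>2 - n\<close> in w produces exactly the first order term of the hyperbolic
    Laplacian.\<close>
  have T: "(\<Sum>b\<in>Basis. T b x) = hyperbolic_laplacian \<psi> x / (1 - (norm x)\<^sup>2) ^ DIM('a)"
    if x: "x \<in> unit_ball" for x
  proof -
    let ?r = "1 - (norm x)\<^sup>2"
    have r: "?r \<noteq> 0" using one[OF x] .
    have "(\<Sum>b\<in>Basis. T b x) = 2 * (real (DIM('a)) - 2) / ?r ^ (DIM('a) - 1) * (\<Sum>b\<in>Basis. (x \<bullet> b) * partial_deriv b \<psi> x)
        + 1 / ?r ^ (DIM('a) - 2) * laplacian \<psi> x"
      unfolding T_def wb_def hyp_weight_def laplacian_def sum.distrib sum_distrib_left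
      by (intro arg_cong2[where f="(+)"] sum.cong) simp_all
    also have "\<dots> = hyperbolic_laplacian \<psi> x / ?r ^ DIM('a)"
      unfolding hyperbolic_laplacian_def m using r
      by (simp add: divide_simps power2_eq_square) (simp add: algebra_simps)
    finally show ?thesis .
  qed
  define D where "D b x = v x * T b x - \<psi> x * Dv b x" for b x
  have D: "integrable lborel (\<lambda>x. indicator unit_ball x * D b x)"
     "(\<integral>x. indicator unit_ball x * D b x \<partial>lborel) = 0" if b: "b \<in> Basis" for b
  proof -
    define X where "X x = v x * (hyp_weight x * partial_deriv b \<psi> x) - \<psi> x * (hyp_weight x * vb b x)" for x
    have cX: "continuous_on unit_ball X"
      unfolding X_def by (intro continuous_intros cv cpsi cpb[OF b] cvb[OF b] continuous_on_weight)
    have cD: "continuous_on unit_ball (D b)"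
      unfolding D_def T_def
      by (intro continuous_intros cv cpsi cpb[OF b] cpbb[OF b] cDv[OF b] cwb continuous_on_weight)
    have der: "has_partial X (D b x) b x" if x: "x \<in> unit_ball" for x
    proof -
      have x1: "norm x < 1" using x by simp
      have 1: "has_partial (\<lambda>x. hyp_weight x * partial_deriv b \<psi> x) (T b x) b x"
        using DERIV_mult[OF has_partial_weight[OF dim b x1] C1_on_has_partial[OF C1b[OF b] open_ball x, of b]]
        by (simp add: T_def wb_def algebra_simps)
      have "has_partial X ((vb b x * (hyp_weight x * partial_deriv b \<psi> x) + T b x * v x)
          - (partial_deriv b \<psi> x * (hyp_weight x * vb b x) + Dv b x * \<psi> x)) b x"
        unfolding X_def
        using DERIV_diff[OF DERIV_mult[OF v[OF b x1] 1] DERIV_mult[OF C1_on_has_partial[OF C1 open_ball x, of b] wv[OF b x1]]]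
        by simp
      then show ?thesis by (simp add: D_def algebra_simps)
    qed
    show "integrable lborel (\<lambda>x. indicator unit_ball x * D b x)"
     "(\<integral>x. indicator unit_ball x * D b x \<partial>lborel) = 0"
      by (rule integral_partial_zero[OF open_ball K(1,2) cX cD der]; simp add: X_def K)+
  qed
  have int: "integrable lborel (\<lambda>x. indicator unit_ball x * f x)"
    if "continuous_on unit_ball f" "\<And>x. x \<in> unit_ball \<Longrightarrow> x \<notin> K \<Longrightarrow> f x = 0" for f :: "'a \<Rightarrow> real"
  proof -
    have "integrable lborel (\<lambda>x. indicator K x *\<^sub>R f x)"
      by (rule borel_integrable_compact[OF K(1)]) (use that K in \<open>auto intro: continuous_on_subset\<close>)
    then show ?thesis
      by (rule back_subst[of "integrable lborel"]) (use that K in \<open>auto simp: indicator_def fun_eq_iff\<close>)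
  qed
  have "0 = (\<Sum>b\<in>Basis. \<integral>x. indicator unit_ball x * D b x \<partial>lborel)" using D by simp
  also have "\<dots> = (\<integral>x. (\<Sum>b\<in>Basis. indicator unit_ball x * D b x) \<partial>lborel)"
    by (rule Bochner_Integration.integral_sum[symmetric]) (rule D)
  also have "\<dots> = (\<integral>x. indicator unit_ball x * (v x * hyperbolic_laplacian \<psi> x / (1 - (norm x)\<^sup>2) ^ DIM('a))
      - indicator unit_ball x * (\<psi> x * (\<Sum>b\<in>Basis. Dv b x)) \<partial>lborel)"
  proof (rule Bochner_Integration.integral_cong[OF refl])
    fix x :: 'a
    show "(\<Sum>b\<in>Basis. indicator unit_ball x * D b x) =
      indicator unit_ball x * (v x * hyperbolic_laplacian \<psi> x / (1 - (norm x)\<^sup>2) ^ DIM('a))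
      - indicator unit_ball x * (\<psi> x * (\<Sum>b\<in>Basis. Dv b x))"
    proof (cases "x \<in> unit_ball")
      case True
      have "(\<Sum>b\<in>Basis. D b x) = v x * (\<Sum>b\<in>Basis. T b x) - \<psi> x * (\<Sum>b\<in>Basis. Dv b x)"
        by (simp add: D_def sum_subtractf sum_distrib_left)
      with True T[OF True] show ?thesis by simp
    qed simp
  qed
  also have "\<dots> = (\<integral>x. indicator unit_ball x * (v x * hyperbolic_laplacian \<psi> x / (1 - (norm x)\<^sup>2) ^ DIM('a)) \<partial>lborel)
      - (\<integral>x. indicator unit_ball x * (\<psi> x * (\<Sum>b\<in>Basis. Dv b x)) \<partial>lborel)"
  proof (rule Bochner_Integration.integral_diff)
    show "integrable lborel (\<lambda>x. indicator unit_ball x * (v x * hyperbolic_laplacian \<psi> x / (1 - (norm x)\<^sup>2) ^ DIM('a)))"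
      using K one by (intro int continuous_intros cv C2_on_continuous_laplacian C2) auto
    show "integrable lborel (\<lambda>x. indicator unit_ball x * (\<psi> x * (\<Sum>b\<in>Basis. Dv b x)))"
      using K by (intro int continuous_intros cpsi cDv) auto
  qed
  finally show ?thesis by simp
qed

subsection \<open>The Poisson kernel\<close>

definition poisson_kernel :: "'a::euclidean_space \<Rightarrow> 'a \<Rightarrow> real" where
  "poisson_kernel x t = ((1 - (norm x)\<^sup>2) / (norm (t - x))\<^sup>2) ^ (DIM('a) - 1)"

text \<open>The component along b of \<open>w grad P\<close>. The gradient of the Poisson kernel
  contains the factor \<open>(1 - |x|^2)^(n - 2)\<close>, which w cancels.\<close>

definition poisson_flux :: "'a::euclidean_space \<Rightarrow> 'a \<Rightarrow> 'a \<Rightarrow> real" where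
  "poisson_flux t b x = - 2 * (real (DIM('a)) - 1) *
     ((x \<bullet> b) * (1 / ((norm (x - t))\<^sup>2) ^ (DIM('a) - 1)) +
      (1 - (norm x)\<^sup>2) * ((x - t) \<bullet> b) * (1 / ((norm (x - t))\<^sup>2) ^ DIM('a)))"

definition poisson_flux_deriv :: "'a::euclidean_space \<Rightarrow> 'a \<Rightarrow> 'a \<Rightarrow> real" where
  "poisson_flux_deriv t b x = - 2 * (real (DIM('a)) - 1) *
     (1 / ((norm (x - t))\<^sup>2) ^ (DIM('a) - 1)
      - (real (DIM('a)) - 1) * (2 * ((x - t) \<bullet> b)) * (x \<bullet> b) / ((norm (x - t))\<^sup>2) ^ DIM('a)
      + (1 - (norm x)\<^sup>2 - 2 * (x \<bullet> b) * ((x - t) \<bullet> b)) / ((norm (x - t))\<^sup>2) ^ DIM('a)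
      - (1 - (norm x)\<^sup>2) * ((x - t) \<bullet> b) * real (DIM('a)) * (2 * ((x - t) \<bullet> b)) / ((norm (x - t))\<^sup>2) ^ Suc (DIM('a)))"

lemma DERIV_one_over_power':
  fixes N :: "real \<Rightarrow> real"
  assumes "(N has_real_derivative N') (at 0)" "N 0 \<noteq> 0"
  shows "((\<lambda>s. 1 / N s ^ m) has_real_derivative - (real m * N' / N 0 ^ Suc m)) (at 0)"
proof -
  have "((\<lambda>s. 1 - N s) has_real_derivative 0 - N') (at 0)"
    by (intro DERIV_diff DERIV_const assms)
  from DERIV_one_over_power[OF this, of m] assms(2) show ?thesis by simp
qed

lemma has_partial_inner:
  fixes x b :: "'a::euclidean_space"
  assumes "b \<in> Basis"
  shows "has_partial (\<lambda>x. (x - t) \<bullet> b) 1 b x"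
proof -
  have "(x + s *\<^sub>R b - t) \<bullet> b = (x - t) \<bullet> b + s" for s
    using assms by (simp add: inner_simps)
  then show ?thesis by (auto intro!: derivative_eq_intros)
qed

lemma sphere_ball_neq: "norm x < 1 \<Longrightarrow> norm t = 1 \<Longrightarrow> (norm (x - t))\<^sup>2 \<noteq> 0"
  by auto

lemma has_partial_poisson_flux:
  fixes x t b :: "'a::euclidean_space"
  assumes b: "b \<in> Basis" and x: "norm x < 1" and t: "norm t = 1"
  shows "has_partial (poisson_flux t b) (poisson_flux_deriv t b x) b x"
proof -
  let ?n = "DIM('a)"
  have s0: "(norm (x + 0 *\<^sub>R b - t))\<^sup>2 \<noteq> 0" using sphere_ball_neq[OF x t] by simp
  have n: "Suc (?n - 1) = ?n" by simp
  have rn: "real (?n - 1) = real ?n - 1" by (simp add: of_nat_diff)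
  note q1 = DERIV_one_over_power'[OF has_partial_norm_sq[OF b] s0, of "?n - 1", unfolded n rn]
  note q2 = DERIV_one_over_power'[OF has_partial_norm_sq[OF b] s0, of "?n"]
  have i0: "has_partial (\<lambda>x. x \<bullet> b) 1 b x"
    using has_partial_inner[OF b, where t=0 and x=x] by simp
  note i1 = has_partial_inner[OF b, where t=t and x=x]
  note r = DERIV_diff[OF DERIV_const has_partial_norm_sq_0[OF b, of x], of 1]
  note D = DERIV_cmult[OF DERIV_add[OF DERIV_mult[OF i0 q1] DERIV_mult[OF DERIV_mult[OF r i1] q2]],
    of "- 2 * (real ?n - 1)"]
  show ?thesis
    unfolding poisson_flux_def
    by (rule DERIV_cong[OF D])
       (simp add: poisson_flux_deriv_def algebra_simps add_divide_distrib diff_divide_distrib)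
qed

text \<open>Once the powers of \<open>|x - t|\<close> are collected, the divergence is a multiple of
  \<open>|x - t|^2 - 2 x \<bullet> (x - t) - (1 - |x|^2)\<close>. This is \<open>|t|^2 - 1\<close>,
  so it vanishes because t is on the sphere.\<close>

lemma sum_poisson_flux_deriv:
  fixes x t :: "'a::euclidean_space"
  assumes x: "norm x < 1" and t: "norm t = 1"
  shows "(\<Sum>b\<in>Basis. poisson_flux_deriv t b x) = 0"
proof -
  let ?n = "DIM('a)" and ?s = "(norm (x - t))\<^sup>2" and ?r = "1 - (norm x)\<^sup>2"
  have s: "?s \<noteq> 0" using sphere_ball_neq[OF x t] .
  have xx: "(\<Sum>b\<in>Basis. (x \<bullet> b) * ((x - t) \<bullet> b)) = x \<bullet> (x - t)"
    by (simp add: euclidean_inner[of x "x - t"])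
  have ss: "(\<Sum>b\<in>Basis. ((x - t) \<bullet> b) * ((x - t) \<bullet> b)) = ?s"
    by (simp add: power2_norm_eq_inner euclidean_inner[of "x - t" "x - t"])
  define A where "A = 1 / ?s ^ (?n - 1)"
  define B where "B = 1 / ?s ^ ?n"
  define C where "C = 1 / ?s ^ Suc ?n"
  have "?s ^ ?n = ?s * ?s ^ (?n - 1)"
    using power_minus_mult[of ?n ?s] by (simp add: mult.commute)
  then have AB: "A = ?s * B" using s by (simp add: A_def B_def)
  have BC: "B = ?s * C" using s by (simp add: B_def C_def)
  have "(\<Sum>b\<in>Basis. poisson_flux_deriv t b x) =
    (\<Sum>b\<in>Basis. - 2 * (real ?n - 1) * (A + ?r * B - (2 * real ?n * B) * ((x \<bullet> b) * ((x - t) \<bullet> b))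
       - (2 * real ?n * ?r * C) * (((x - t) \<bullet> b) * ((x - t) \<bullet> b))))"
    by (rule sum.cong) (simp_all add: poisson_flux_deriv_def A_def B_def C_def algebra_simps add_divide_distrib diff_divide_distrib)
  also have "\<dots> = - 2 * (real ?n - 1) * (real ?n * (A + ?r * B) - (2 * real ?n * B) * (x \<bullet> (x - t))
       - (2 * real ?n * ?r * C) * ?s)"
    unfolding sum_distrib_left[symmetric] sum_subtractf sum.distrib xx ss by (simp add: distrib_left)
  also have "\<dots> = - 2 * (real ?n - 1) * (real ?n * B * (?s - 2 * (x \<bullet> (x - t)) - ?r))"
    unfolding AB BC by (simp add: algebra_simps)
  also have "?s - 2 * (x \<bullet> (x - t)) - ?r = 0"
  proof -
    have "t \<bullet> t = 1" using t by (simp add: norm_eq_1)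
    then show ?thesis
      by (simp add: power2_norm_eq_inner inner_diff_left inner_diff_right inner_commute)
  qed
  finally show ?thesis by simp
qed

lemma has_partial_poisson_kernel:
  fixes x t b :: "'a::euclidean_space"
  assumes dim: "DIM('a) \<ge> 2" and b: "b \<in> Basis" and x: "norm x < 1" and t: "norm t = 1"
  shows "has_partial (\<lambda>x. poisson_kernel x t) ((1 - (norm x)\<^sup>2) ^ (DIM('a) - 2) * poisson_flux t b x) b x"
proof -
  obtain m where m: "DIM('a) = Suc (Suc m)" using dim by (metis Suc_le_D numeral_2_eq_2 Suc_le_mono)
  let ?s = "(norm (x - t))\<^sup>2" and ?r = "1 - (norm x)\<^sup>2"
  have s: "?s \<noteq> 0" using sphere_ball_neq[OF x t] .
  have s0: "(norm (x + 0 *\<^sub>R b - t))\<^sup>2 \<noteq> 0" using s by simp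
  note D = DERIV_power_Suc[OF DERIV_divide[OF DERIV_diff[OF DERIV_const has_partial_norm_sq_0[OF b, of x], of 1]
     has_partial_norm_sq[OF b] s0], of m]
  have pk: "poisson_kernel y t = ((1 - (norm y)\<^sup>2) / (norm (y - t))\<^sup>2) ^ Suc m" for y
    by (simp add: poisson_kernel_def m norm_minus_commute)
  show ?thesis
    unfolding pk
  proof (rule DERIV_cong[OF D])
    define S where "S = ?s"
    define r where "r = ?r"
    have S: "S \<noteq> 0" using s by (simp add: S_def)
    have "(1 + real m) * (((0 - 2 * X) * S - r * (2 * T)) / (S * S) * (r / S) ^ m) =
      r ^ m * (- 2 * (real m + 1) * (X * (1 / S ^ Suc m) + r * T * (1 / S ^ Suc (Suc m))))" for X T
      using S unfolding power_divide by (simp add: divide_simps) (simp add: algebra_simps)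
    from this[of "x \<bullet> b" "(x - t) \<bullet> b"] show "(1 + real m) * (((0 - 2 * (x \<bullet> b)) * (norm (x + 0 *\<^sub>R b - t))\<^sup>2 -
        (1 - (norm (x + 0 *\<^sub>R b))\<^sup>2) * (2 * ((x - t) \<bullet> b))) /
        ((norm (x + 0 *\<^sub>R b - t))\<^sup>2 * (norm (x + 0 *\<^sub>R b - t))\<^sup>2) *
        ((1 - (norm (x + 0 *\<^sub>R b))\<^sup>2) / (norm (x + 0 *\<^sub>R b - t))\<^sup>2) ^ m) =
      (1 - (norm x)\<^sup>2) ^ (DIM('a) - 2) * poisson_flux t b x"
      by (simp add: poisson_flux_def m S_def r_def)
  qed
qed

lemma continuous_on_poisson_kernel:
  "norm t = 1 \<Longrightarrow> continuous_on unit_ball (\<lambda>x::'a::euclidean_space. poisson_kernel x t)"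
  unfolding poisson_kernel_def by (intro continuous_intros) auto

lemma continuous_on_poisson_flux:
  "norm t = 1 \<Longrightarrow> continuous_on unit_ball (poisson_flux t (b :: 'a::euclidean_space))"
  unfolding poisson_flux_def by (intro continuous_intros) auto

lemma continuous_on_poisson_flux_deriv:
  "norm t = 1 \<Longrightarrow> continuous_on unit_ball (poisson_flux_deriv t (b :: 'a::euclidean_space))"
  unfolding poisson_flux_deriv_def by (intro continuous_intros) auto

lemma poisson_kernel_weakly_harmonic:
  fixes t :: "'a::euclidean_space"
  assumes dim: "DIM('a) \<ge> 2" and psi: "\<psi> \<in> C2c_ball" and t: "norm t = 1"
  shows "(\<integral>x. indicator unit_ball x * (poisson_kernel x t * hyperbolic_laplacian \<psi> x / (1 - (norm x)\<^sup>2) ^ DIM('a)) \<partial>lborel) = 0"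
proof -
  have "(\<integral>x. indicator unit_ball x * (poisson_kernel x t * hyperbolic_laplacian \<psi> x / (1 - (norm x)\<^sup>2) ^ DIM('a)) \<partial>lborel)
    = (\<integral>x. indicator unit_ball x * (\<psi> x * (\<Sum>b\<in>Basis. poisson_flux_deriv t b x)) \<partial>lborel)"
  proof (rule green_identity[OF dim psi, where vb="\<lambda>b x. (1 - (norm x)\<^sup>2) ^ (DIM('a) - 2) * poisson_flux t b x"])
    show "has_partial (\<lambda>x. hyp_weight x * ((1 - (norm x)\<^sup>2) ^ (DIM('a) - 2) * poisson_flux t b x)) (poisson_flux_deriv t b x) b x"
      if "b \<in> Basis" "norm x < 1" for b x
    proof (subst has_partial_cong[where S=unit_ball])
      show "has_partial (poisson_flux t b) (poisson_flux_deriv t b x) b x"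
        by (rule has_partial_poisson_flux[OF that t])
      show "hyp_weight y * ((1 - (norm y)\<^sup>2) ^ (DIM('a) - 2) * poisson_flux t b y) = poisson_flux t b y"
        if "y \<in> unit_ball" for y
        using that one_minus_norm_sq_pos[of y] by (simp add: hyp_weight_def)
    qed (use that in auto)
  qed (auto intro!: continuous_on_poisson_kernel continuous_on_poisson_flux continuous_on_poisson_flux_deriv
        has_partial_poisson_kernel continuous_intros dim t)
  also have "\<dots> = (\<integral>x. 0 \<partial>(lborel :: 'a measure))"
    using sum_poisson_flux_deriv[OF _ t]
    by (intro Bochner_Integration.integral_cong) (auto simp: indicator_def)
  finally show ?thesis by simp
qed

section \<open>Spherical means of the Poisson kernel\<close>

lemma integral_polar_swap:
  fixes f :: "'a::euclidean_space \<Rightarrow> real"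
  assumes f: "integrable lborel f"
  shows "(\<integral>x. f x \<partial>lborel) =
    (\<integral>s. (\<integral>r. f (r *\<^sub>R s) \<partial>radial_measure TYPE('a)) \<partial>sphere_borel)"
proof -
  interpret S: prob_space "sphere_borel :: 'a measure" by (rule prob_space_sphere_borel)
  interpret R: sigma_finite_measure "radial_measure TYPE('a)" by (rule sigma_finite_radial_measure)
  interpret P: pair_sigma_finite "radial_measure TYPE('a)" "sphere_borel :: 'a measure" ..
  have m: "(\<lambda>(r, s). r *\<^sub>R s) \<in> radial_measure TYPE('a) \<Otimes>\<^sub>M sphere_borel \<rightarrow>\<^sub>M (borel :: 'a measure)"
    by measurable
  have [measurable]: "f \<in> borel_measurable borel" using f by (simp add: integrable_iff_bounded)
  have "integrable (radial_measure TYPE('a) \<Otimes>\<^sub>M sphere_borel) (\<lambda>p. f (case p of (r, s) \<Rightarrow> r *\<^sub>R s))"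
    using f by (subst (asm) polar_coordinates, subst (asm) integrable_distr_eq[OF m]) auto
  then have int: "integrable (radial_measure TYPE('a) \<Otimes>\<^sub>M sphere_borel) (case_prod (\<lambda>r s. f (r *\<^sub>R s)))"
    by (simp add: case_prod_unfold)
  have "(\<integral>x. f x \<partial>lborel) = (\<integral>p. f (case p of (r, s) \<Rightarrow> r *\<^sub>R s) \<partial>(radial_measure TYPE('a) \<Otimes>\<^sub>M sphere_borel))"
    by (subst polar_coordinates, subst integral_distr[OF m]) auto
  also have "\<dots> = (\<integral>p. (case_prod (\<lambda>r s. f (r *\<^sub>R s))) p \<partial>(radial_measure TYPE('a) \<Otimes>\<^sub>M sphere_borel))"
    by (simp add: case_prod_unfold)
  also have "\<dots> = (\<integral>s. (\<integral>r. f (r *\<^sub>R s) \<partial>radial_measure TYPE('a)) \<partial>sphere_borel)"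
    by (rule P.integral_snd[OF int, symmetric])
  finally show ?thesis .
qed

lemma integral_radial_measure:
  fixes g :: "real \<Rightarrow> real"
  assumes [measurable]: "g \<in> borel_measurable borel"
  shows "(\<integral>r. g r \<partial>radial_measure TYPE('a::euclidean_space)) =
    (\<integral>r. (real DIM('a) * unit_ball_vol (DIM('a)) * r ^ (DIM('a) - 1) * indicator {0..} r) * g r \<partial>lborel)"
proof -
  have "radial_measure TYPE('a) = density lborel
     (\<lambda>r. ennreal (real DIM('a) * unit_ball_vol (DIM('a)) * r ^ (DIM('a) - 1) * indicator {0..} r))"
    unfolding radial_measure_def by (rule arg_cong2[where f=density]) (auto simp: indicator_def fun_eq_iff)
  then show ?thesis by (simp only:) (subst integral_density; auto simp: indicator_def)
qed

text \<open>The inner product of x with the divergence-free flux \<open>F = w grad P\<close>; up to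
  the weight and a factor r it is the radial derivative of P.\<close>

definition poisson_radial :: "'a::euclidean_space \<Rightarrow> 'a \<Rightarrow> real" where
  "poisson_radial t x = (\<Sum>b\<in>Basis. (x \<bullet> b) * poisson_flux t b x)"

lemma poisson_radial_eq:
  fixes x t :: "'a::euclidean_space"
  shows "poisson_radial t x = - 2 * (real (DIM('a)) - 1) *
     ((norm x)\<^sup>2 / ((norm (x - t))\<^sup>2) ^ (DIM('a) - 1) +
      (1 - (norm x)\<^sup>2) * (x \<bullet> (x - t)) / ((norm (x - t))\<^sup>2) ^ DIM('a))"
proof -
  have xx: "(\<Sum>b\<in>Basis. (x \<bullet> b) * (x \<bullet> b)) = (norm x)\<^sup>2"
    by (simp add: power2_norm_eq_inner euclidean_inner[of x x])
  have xt: "(\<Sum>b\<in>Basis. (x \<bullet> b) * ((x - t) \<bullet> b)) = x \<bullet> (x - t)"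
    by (simp add: euclidean_inner[of x "x - t"])
  let ?A = "1 / ((norm (x - t))\<^sup>2) ^ (DIM('a) - 1)" and ?B = "1 / ((norm (x - t))\<^sup>2) ^ DIM('a)"
  have alg: "a * (- 2 * N * (a * A + r * c * B)) = (- 2 * N * A) * (a * a) + (- 2 * N * r * B) * (a * c)"
    for a c A B r N :: real by (simp add: algebra_simps)
  have "poisson_radial t x = (\<Sum>b\<in>Basis. (- 2 * (real (DIM('a)) - 1) * ?A) * ((x \<bullet> b) * (x \<bullet> b)) +
      (- 2 * (real (DIM('a)) - 1) * (1 - (norm x)\<^sup>2) * ?B) * ((x \<bullet> b) * ((x - t) \<bullet> b)))"
    unfolding poisson_radial_def poisson_flux_def by (simp only: alg)
  also have "\<dots> = - 2 * (real (DIM('a)) - 1) * ?A * (norm x)\<^sup>2 +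
      - 2 * (real (DIM('a)) - 1) * (1 - (norm x)\<^sup>2) * ?B * (x \<bullet> (x - t))"
    unfolding sum.distrib sum_distrib_left[symmetric] xx xt by simp
  also have "\<dots> = - 2 * (real (DIM('a)) - 1) *
     ((norm x)\<^sup>2 / ((norm (x - t))\<^sup>2) ^ (DIM('a) - 1) +
      (1 - (norm x)\<^sup>2) * (x \<bullet> (x - t)) / ((norm (x - t))\<^sup>2) ^ DIM('a))"
    by (simp add: algebra_simps add_divide_distrib diff_divide_distrib)
  finally show ?thesis .
qed

lemma borel_measurable_poisson_radial [measurable]: "poisson_radial t \<in> borel_measurable borel"
  unfolding poisson_radial_eq[abs_def] by measurable

lemma continuous_on_poisson_radial: "norm t = 1 \<Longrightarrow> continuous_on unit_ball (poisson_radial t)"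
  unfolding poisson_radial_eq[abs_def] by (intro continuous_intros) auto

text \<open>For a primitive k of \<beta> that vanishes near the sphere, \<open>k(|x|^2) F\<close> is
  compactly supported and has divergence \<open>2 \<beta>(|x|^2) (x \<bullet> F)\<close>, since F is
  divergence free. In this form the absence of a net flow of F through spheres is an integral over
  the ball.\<close>

lemma poisson_radial_test:
  fixes t :: "'a::euclidean_space" and \<beta> :: "real \<Rightarrow> real"
  assumes dim: "DIM('a) \<ge> 2" and t: "norm t = 1" and R: "0 < R" "R < 1"
    and c: "continuous_on UNIV \<beta>" and z: "\<And>q. q \<ge> R\<^sup>2 \<Longrightarrow> \<beta> q = 0"
  shows "(\<integral>x. indicator unit_ball x * (\<beta> ((norm x)\<^sup>2) * poisson_radial t x) \<partial>lborel) = 0"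
proof -
  \<comment> \<open>Subtracting the integral up to 1 makes k vanish on \<open>[R^2, 1)\<close>. The
    lower endpoint -1 keeps 0, the value at the origin, an interior point for the
    derivative.\<close>
  define k where "k q = integral {-1..q} \<beta> - integral {-1..1} \<beta>" for q
  have ci: "continuous_on {-1..1} \<beta>" using c continuous_on_subset by blast
  have int: "\<beta> integrable_on {a..b}" for a b
    using c continuous_on_subset by (intro integrable_continuous_interval) blast
  have R2: "R\<^sup>2 < 1" "0 \<le> R\<^sup>2" using R by (auto simp: abs_square_less_1)
  have kz: "k q = 0" if "R\<^sup>2 \<le> q" "q < 1" for q
  proof -
    have "0 \<le> q" using that R2 by linarith
    then have "integral {-1..q} \<beta> + integral {q..1} \<beta> = integral {-1..1} \<beta>"
      using that int by (intro Henstock_Kurzweil_Integration.integral_combine) auto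
    moreover have "integral {q..1} \<beta> = integral {q..1} (\<lambda>_. 0 :: real)"
      by (rule Henstock_Kurzweil_Integration.integral_cong) (use that z in auto)
    ultimately show ?thesis by (simp add: k_def)
  qed
  have dk: "(k has_real_derivative \<beta> q) (at q)" if "0 \<le> q" "q < 1" for q
  proof -
    have "((\<lambda>x. integral {-1..x} \<beta>) has_real_derivative \<beta> q) (at q within {-1..1})"
      using that by (intro integral_has_real_derivative ci) auto
    then have "((\<lambda>x. integral {-1..x} \<beta>) has_real_derivative \<beta> q) (at q)"
      using that by (subst (asm) at_within_interior) auto
    from DERIV_diff[OF this DERIV_const, of "integral {-1..1} \<beta>"] show ?thesis by (simp add: k_def[abs_def])
  qed
  have sq: "(norm x)\<^sup>2 < 1" if "x \<in> unit_ball" for x :: 'a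
    using one_minus_norm_sq_pos[of x] that by simp
  have ck: "continuous_on unit_ball (\<lambda>x::'a. k ((norm x)\<^sup>2))"
  proof (rule continuous_on_compose2[of "{0..<1}" k])
    show "continuous_on {0..<1} k"
      by (rule DERIV_continuous_on[of _ _ \<beta>]) (auto intro: has_field_derivative_at_within dk)
  qed (use sq in \<open>auto intro!: continuous_intros\<close>)
  have cb: "continuous_on unit_ball (\<lambda>x::'a. \<beta> ((norm x)\<^sup>2))"
    by (rule continuous_on_compose2[OF c]) (auto intro!: continuous_intros)
  define D where "D b x = \<beta> ((norm x)\<^sup>2) * (2 * (x \<bullet> b)) * poisson_flux t b x + poisson_flux_deriv t b x * k ((norm x)\<^sup>2)" for b x
  have D: "integrable lborel (\<lambda>x. indicator unit_ball x * D b x)"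
     "(\<integral>x. indicator unit_ball x * D b x \<partial>lborel) = 0" if b: "b \<in> Basis" for b
  proof -
    define X where "X x = k ((norm x)\<^sup>2) * poisson_flux t b x" for x
    have cX: "continuous_on unit_ball X"
      unfolding X_def by (intro continuous_intros ck continuous_on_poisson_flux t)
    have cD: "continuous_on unit_ball (D b)"
      unfolding D_def by (intro continuous_intros ck cb continuous_on_poisson_flux continuous_on_poisson_flux_deriv t)
    have der: "has_partial X (D b x) b x" if x: "x \<in> unit_ball" for x
    proof -
      have x1: "norm x < 1" using x by simp
      have "(k has_real_derivative \<beta> ((norm x)\<^sup>2)) (at ((norm (x + 0 *\<^sub>R b))\<^sup>2))"
        using dk[of "(norm x)\<^sup>2"] sq[OF x] by simp
      from DERIV_mult[OF DERIV_chain2[OF this has_partial_norm_sq_0[OF b]] has_partial_poisson_flux[OF b x1 t]]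
      show ?thesis by (simp add: X_def D_def)
    qed
    have zero: "X x = 0" if "x \<in> unit_ball" "x \<notin> cball 0 R" for x
    proof -
      have "R\<^sup>2 \<le> (norm x)\<^sup>2" using that R by (intro power_mono) auto
      then show ?thesis using kz sq[OF that(1)] by (simp add: X_def)
    qed
    have sub: "cball 0 R \<subseteq> (unit_ball :: 'a set)" using R by auto
    show "integrable lborel (\<lambda>x. indicator unit_ball x * D b x)"
     "(\<integral>x. indicator unit_ball x * D b x \<partial>lborel) = 0"
      by (rule integral_partial_zero[OF open_ball compact_cball sub cX cD der zero]; assumption)+
  qed
  have "0 = (\<Sum>b\<in>Basis. \<integral>x. indicator unit_ball x * D b x \<partial>lborel)" using D by simp
  also have "\<dots> = (\<integral>x. (\<Sum>b\<in>Basis. indicator unit_ball x * D b x) \<partial>lborel)"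
    by (rule Bochner_Integration.integral_sum[symmetric]) (rule D)
  also have "\<dots> = (\<integral>x. 2 * (indicator unit_ball x * (\<beta> ((norm x)\<^sup>2) * poisson_radial t x)) \<partial>lborel)"
  proof (rule Bochner_Integration.integral_cong[OF refl])
    fix x :: 'a
    show "(\<Sum>b\<in>Basis. indicator unit_ball x * D b x) = 2 * (indicator unit_ball x * (\<beta> ((norm x)\<^sup>2) * poisson_radial t x))"
    proof (cases "x \<in> unit_ball")
      case True
      have "(\<Sum>b\<in>Basis. D b x) = 2 * \<beta> ((norm x)\<^sup>2) * poisson_radial t x + k ((norm x)\<^sup>2) * (\<Sum>b\<in>Basis. poisson_flux_deriv t b x)"
        by (simp add: D_def sum.distrib poisson_radial_def sum_distrib_left sum_distrib_right algebra_simps)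
      with True sum_poisson_flux_deriv[OF _ t, of x] show ?thesis by simp
    qed simp
  qed
  finally show ?thesis by simp
qed

lemma poisson_kernel_bounds:
  fixes x t :: "'a::euclidean_space"
  assumes "norm x \<le> r" "r < 1" "norm t = 1"
  shows "0 \<le> poisson_kernel x t" "poisson_kernel x t \<le> (1 / (1 - r)\<^sup>2) ^ (DIM('a) - 1)"
proof -
  have "(norm x)\<^sup>2 \<le> 1" using assms by (simp add: abs_square_le_1)
  then show "0 \<le> poisson_kernel x t" by (simp add: poisson_kernel_def)
  have "1 - r \<le> norm (t - x)" using assms norm_triangle_ineq2[of t x] by simp
  then have "(1 - r)\<^sup>2 \<le> (norm (t - x))\<^sup>2" using assms by (intro power_mono) auto
  then have "(1 - (norm x)\<^sup>2) / (norm (t - x))\<^sup>2 \<le> 1 / (1 - r)\<^sup>2"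
    using assms \<open>(norm x)\<^sup>2 \<le> 1\<close> by (intro frac_le) auto
  then show "poisson_kernel x t \<le> (1 / (1 - r)\<^sup>2) ^ (DIM('a) - 1)"
    unfolding poisson_kernel_def using \<open>(norm x)\<^sup>2 \<le> 1\<close> by (intro power_mono) auto
qed

lemma borel_measurable_poisson_kernel [measurable]:
  assumes [measurable]: "f \<in> borel_measurable M" "g \<in> borel_measurable M"
  shows "(\<lambda>z. poisson_kernel (f z) (g z :: 'a::euclidean_space)) \<in> borel_measurable M"
  unfolding poisson_kernel_def by measurable

lemma integrable_poisson_kernel_sphere:
  fixes t :: "'a::euclidean_space"
  assumes "0 \<le> r" "r < 1" "norm t = 1"
  shows "integrable sphere_borel (\<lambda>s. poisson_kernel (r *\<^sub>R s) t)"
proof -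
  interpret S: prob_space "sphere_borel :: 'a measure" by (rule prob_space_sphere_borel)
  show ?thesis
  proof (rule S.integrable_const_bound[where B="(1 / (1 - r)\<^sup>2) ^ (DIM('a) - 1)"])
    show "AE s in sphere_borel. norm (poisson_kernel (r *\<^sub>R s) t) \<le> (1 / (1 - r)\<^sup>2) ^ (DIM('a) - 1)"
      using AE_sphere_borel_norm
    proof eventually_elim
      case (elim s)
      then show ?case using poisson_kernel_bounds[of "r *\<^sub>R s" r t] assms by simp
    qed
  qed measurable
qed

lemma DERIV_poisson_kernel_radial:
  fixes s t :: "'a::euclidean_space"
  assumes dim: "DIM('a) \<ge> 2" and r: "0 < r" "r < 1" and s: "norm s = 1" and t: "norm t = 1"
  shows "((\<lambda>r. poisson_kernel (r *\<^sub>R s) t) has_real_derivative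
     (1 - r\<^sup>2) ^ (DIM('a) - 2) * poisson_radial t (r *\<^sub>R s) / r) (at r)"
proof -
  obtain m where m: "DIM('a) = Suc (Suc m)" using dim by (metis Suc_le_D numeral_2_eq_2 Suc_le_mono)
  define c where "c = s \<bullet> t"
  define S where "S r = 1 + r\<^sup>2 - 2 * r * c" for r :: real
  have "s \<bullet> s = 1" "t \<bullet> t = 1" using s t by (simp_all add: norm_eq_1)
  then have Seq: "(norm (r *\<^sub>R s - t))\<^sup>2 = S r" for r
    unfolding power2_norm_eq_inner S_def c_def
    by (simp add: inner_simps inner_commute power2_eq_square algebra_simps)
  have xt: "(r *\<^sub>R s) \<bullet> (r *\<^sub>R s - t) = r\<^sup>2 - r * c"
    using \<open>s \<bullet> s = 1\<close> by (simp add: c_def inner_simps inner_commute power2_eq_square)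
  have S0: "S r \<noteq> 0" using Seq[of r] sphere_ball_neq[of "r *\<^sub>R s" t] r s t by simp
  have pk: "poisson_kernel (q *\<^sub>R s) t = ((1 - q\<^sup>2) / S q) ^ Suc m" for q
    using s by (simp add: poisson_kernel_def m norm_minus_commute[of t] Seq power_mult_distrib)
  have dS: "(S has_real_derivative 2 * r - 2 * c) (at r)"
    unfolding S_def by (auto intro!: derivative_eq_intros)
  have d1: "((\<lambda>q. 1 - q\<^sup>2) has_real_derivative - 2 * r) (at r)"
    by (auto intro!: derivative_eq_intros)
  note D = DERIV_power_Suc[OF DERIV_divide[OF d1 dS S0], of m]
  show ?thesis
    unfolding pk
  proof (rule DERIV_cong[OF D])
    have "(1 + real m) * ((- 2 * r * T - u * (2 * r - 2 * c)) / (T * T) * (u / T) ^ m) =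
      u ^ m * (- 2 * (real m + 1) * (r\<^sup>2 / T ^ Suc m + u * (r\<^sup>2 - r * c) / T ^ Suc (Suc m))) / r" if "T \<noteq> 0" for T u
      using that r unfolding power_divide by (simp add: divide_simps) (simp add: algebra_simps power2_eq_square)
    from this[OF S0, of "1 - r\<^sup>2"]
    show "(1 + real m) * ((- 2 * r * S r - (1 - r\<^sup>2) * (2 * r - 2 * c)) / (S r * S r) * ((1 - r\<^sup>2) / S r) ^ m) =
      (1 - r\<^sup>2) ^ (DIM('a) - 2) * poisson_radial t (r *\<^sub>R s) / r"
      unfolding poisson_radial_eq xt Seq using s by (simp add: m power_mult_distrib)
  qed
qed

text \<open>The difference of the means is the integral of the radial derivative over the shell
  between the two radii. In polar coordinates this is a multiple of the integral of
  \<open>f\<close>, which is a limit of the vanishing integrals of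
  \<open>poisson_radial_test\<close>.\<close>

lemma poisson_sphere_mean_const:
  fixes t :: "'a::euclidean_space"
  assumes dim: "DIM('a) \<ge> 2" and t: "norm t = 1" and r: "0 < r1" "r1 < r0" "r0 < 1"
  shows "(\<integral>s. poisson_kernel (r0 *\<^sub>R s) t \<partial>sphere_borel) = (\<integral>s. poisson_kernel (r1 *\<^sub>R s) t \<partial>sphere_borel)"
proof -
  let ?n = "DIM('a)"
  let ?V = "unit_ball_vol ?n"
  \<comment> \<open>A piecewise linear cutoff of slope k to the open shell. In \<open>be k\<close>
    the variable q is \<open>|x|^2\<close>, and the factor \<open>(1 - q)^(n - 2) / |x|^n\<close>
    turns the radial part of the flux into the radial derivative of P divided by the Jacobian
    \<open>r^(n - 1)\<close>. The maximum with r1 keeps \<open>be k\<close> continuous at 0 and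
    changes nothing where the cutoff is positive.\<close>
  define ch where "ch k q = max 0 (min 1 (real k * min (q - r1) (r0 - q)))" for k and q :: real
  define be where "be k q = ch k (sqrt q) * (1 - q) ^ (?n - 2) / (max r1 (sqrt q)) ^ ?n" for k q
  have ch0: "ch k q = 0" if "q \<ge> r0 \<or> q \<le> r1" for k q
  proof -
    have "real k * min (q - r1) (r0 - q) \<le> 0"
      using that by (intro mult_nonneg_nonpos) auto
    then show ?thesis by (simp add: ch_def)
  qed
  have ch1: "0 \<le> ch k q" "ch k q \<le> 1" for k q by (auto simp: ch_def)
  have cbe: "continuous_on UNIV (be k)" for k
    unfolding be_def ch_def using r by (intro continuous_intros) auto
  have test: "(\<integral>x. indicator unit_ball x * (be k ((norm x)\<^sup>2) * poisson_radial t x) \<partial>lborel) = 0" for k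
  proof (rule poisson_radial_test[OF dim t _ r(3) cbe])
    show "be k q = 0" if "r0\<^sup>2 \<le> q" for q
      using ch0[of "sqrt q" k] that r by (simp add: be_def real_le_rsqrt)
  qed (use r in simp)
  define f where "f x = indicator {x. r1 < norm x \<and> norm x < r0} x * ((1 - (norm x)\<^sup>2) ^ (?n - 2) / norm x ^ ?n * poisson_radial t x)" for x
  have sub: "cball 0 r0 \<subseteq> (unit_ball :: 'a set)" using r by auto
  have "bounded (poisson_radial t ` cball 0 r0)"
    using sub by (intro compact_imp_bounded compact_continuous_image compact_cball)
      (blast intro: continuous_on_subset continuous_on_poisson_radial t)
  then obtain B where "\<forall>x\<in>cball 0 r0. \<bar>poisson_radial t x\<bar> \<le> B" by (auto simp: bounded_iff)
  then have B: "\<bar>poisson_radial t x\<bar> \<le> B" if "x \<in> cball 0 r0" for x using that by blast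
  have B0: "B \<ge> 0" using B[of 0] r by force
  let ?w = "\<lambda>x::'a. 1 / r1 ^ ?n * B * indicator (cball 0 r0) x"
  have w: "integrable lborel ?w"
    using emeasure_lborel_cball_finite[of "0::'a" r0]
    by (intro integrable_mult_right integrable_real_indicator) auto
  have [measurable]: "be k \<in> borel_measurable borel" for k
    using cbe by (rule borel_measurable_continuous_onI)
  have mk: "(\<lambda>x. indicator unit_ball x * (be k ((norm x)\<^sup>2) * poisson_radial t x)) \<in> borel_measurable lborel" for k
  proof -
    have 1: "(\<lambda>x::'a. be k ((norm x)\<^sup>2)) \<in> borel_measurable borel"
      by (rule measurable_compose[where g="be k" and N=borel]) measurable
    have 2: "(indicator unit_ball :: 'a \<Rightarrow> real) \<in> borel_measurable borel"
      by (rule borel_measurable_indicator) simp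
    show ?thesis
      unfolding measurable_lborel2
      by (intro borel_measurable_times 1 2 borel_measurable_poisson_radial)
  qed
  have mf: "f \<in> borel_measurable lborel" unfolding f_def by measurable
  have lim: "AE x in lborel. (\<lambda>k. indicator unit_ball x * (be k ((norm x)\<^sup>2) * poisson_radial t x)) \<longlonglongrightarrow> f x"
  proof (rule AE_I2)
    fix x :: 'a
    show "(\<lambda>k. indicator unit_ball x * (be k ((norm x)\<^sup>2) * poisson_radial t x)) \<longlonglongrightarrow> f x"
    proof (cases "r1 < norm x \<and> norm x < r0")
      case True
      define d where "d = min (norm x - r1) (r0 - norm x)"
      have d: "d > 0" using True by (simp add: d_def)
      obtain N where N: "1 / d < real N" using reals_Archimedean2 by blast
      have "indicator unit_ball x * (be k ((norm x)\<^sup>2) * poisson_radial t x) = f x" if "k \<ge> N" for k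
      proof -
        have "1 / d < real k" using N that by linarith
        then have "1 < real k * d" using d by (simp add: field_simps)
        then have "ch k (norm x) = 1" by (simp add: ch_def d_def[symmetric])
        then show ?thesis using True r by (simp add: be_def f_def max_def)
      qed
      then show ?thesis by (intro tendsto_eventually) (auto simp: eventually_sequentially)
    next
      case False
      then have "ch k (norm x) = 0" for k using ch0 by auto
      then show ?thesis using False by (simp add: be_def f_def)
    qed
  qed
  have bd: "AE x in lborel. norm (indicator unit_ball x * (be k ((norm x)\<^sup>2) * poisson_radial t x)) \<le> ?w x" for k
  proof (rule AE_I2)
    fix x :: 'a
    show "norm (indicator unit_ball x * (be k ((norm x)\<^sup>2) * poisson_radial t x)) \<le> ?w x"
    proof (cases "norm x \<le> r0")
      case True
      then have x1: "norm x < 1" using r by simp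
      have n1: "0 \<le> (1 - (norm x)\<^sup>2) ^ (?n - 2)" "(1 - (norm x)\<^sup>2) ^ (?n - 2) \<le> 1"
        using one_minus_norm_sq_pos[OF x1] by (auto intro!: power_le_one)
      have "\<bar>be k ((norm x)\<^sup>2)\<bar> = ch k (norm x) * (1 - (norm x)\<^sup>2) ^ (?n - 2) / (max r1 (norm x)) ^ ?n"
        using n1 ch1[of k "norm x"] r by (simp add: be_def)
      also have "\<dots> \<le> (1 * 1) / r1 ^ ?n"
        using n1 ch1[of k "norm x"] r by (intro frac_le mult_mono power_mono) auto
      finally have "\<bar>be k ((norm x)\<^sup>2)\<bar> * \<bar>poisson_radial t x\<bar> \<le> 1 / r1 ^ ?n * B"
        using B[of x] True r by (intro mult_mono) auto
      then show ?thesis using True x1 by (simp add: abs_mult)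
    next
      case False
      then show ?thesis using ch0[of "norm x" k] by (simp add: be_def)
    qed
  qed
  have intf: "integrable lborel f"
    by (rule integrable_dominated_convergence[OF mf mk w lim bd])
  have "(\<lambda>k::nat. 0) \<longlonglongrightarrow> (\<integral>x. f x \<partial>lborel)"
    using integral_dominated_convergence[OF mf mk w lim bd] by (simp add: test)
  then have f0: "(\<integral>x. f x \<partial>lborel) = 0" by (simp add: LIMSEQ_const_iff)
  have inner: "(\<integral>r. f (r *\<^sub>R s) \<partial>radial_measure TYPE('a)) =
      real ?n * ?V * (poisson_kernel (r0 *\<^sub>R s) t - poisson_kernel (r1 *\<^sub>R s) t)" if s: "norm s = 1" for s
  proof -
    let ?g = "\<lambda>r. (1 - r\<^sup>2) ^ (?n - 2) * poisson_radial t (r *\<^sub>R s) / r"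
    have ms: "(\<lambda>r. f (r *\<^sub>R s)) \<in> borel_measurable borel" using mf by simp
    have "(\<integral>r. f (r *\<^sub>R s) \<partial>radial_measure TYPE('a)) =
      (\<integral>r. (real ?n * ?V * r ^ (?n - 1) * indicator {0..} r) * f (r *\<^sub>R s) \<partial>lborel)"
      by (rule integral_radial_measure[OF ms])
    also have "\<dots> = (\<integral>r. real ?n * ?V * (indicator {r1..r0} r *\<^sub>R ?g r) \<partial>lborel)"
    proof (rule integral_cong_AE)
      have "AE r in lborel. r \<noteq> r1 \<and> r \<noteq> r0" using AE_lborel_singleton[of r1] AE_lborel_singleton[of r0] by auto
      then show "AE r in lborel. (real ?n * ?V * r ^ (?n - 1) * indicator {0..} r) * f (r *\<^sub>R s) =
         real ?n * ?V * (indicator {r1..r0} r *\<^sub>R ?g r)"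
      proof eventually_elim
        case (elim q)
        show ?case
        proof (cases "r1 < q \<and> q < r0")
          case True
          have "q ^ ?n = q * q ^ (?n - 1)" using power_minus_mult[of ?n q] by (simp add: mult.commute)
          then have "q ^ (?n - 1) / q ^ ?n = 1 / q" using True r by simp
          then show ?thesis using True r s by (simp add: f_def field_simps)
        next
          case False
          then have "\<not> (r1 \<le> q \<and> q \<le> r0)" using elim by auto
          moreover have "q \<ge> 0 \<Longrightarrow> \<not> (r1 < norm (q *\<^sub>R s) \<and> norm (q *\<^sub>R s) < r0)"
            using False s by auto
          ultimately show ?thesis by (auto simp: f_def indicator_def)
        qed
      qed
    qed (use ms in measurable)
    also have "\<dots> = real ?n * ?V * (\<integral>r. indicator {r1..r0} r *\<^sub>R ?g r \<partial>lborel)"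
      by (rule integral_mult_right_zero)
    also have "(\<integral>r. indicator {r1..r0} r *\<^sub>R ?g r \<partial>lborel) = poisson_kernel (r0 *\<^sub>R s) t - poisson_kernel (r1 *\<^sub>R s) t"
    proof (rule integral_FTC_Icc)
      show "((\<lambda>r. poisson_kernel (r *\<^sub>R s) t) has_vector_derivative ?g x) (at x within {r1..r0})" if "r1 \<le> x" "x \<le> r0" for x
        using DERIV_poisson_kernel_radial[OF dim _ _ s t, of x] that r
        by (auto simp: has_real_derivative_iff_has_vector_derivative[symmetric] intro: has_field_derivative_at_within)
      show "continuous_on {r1..r0} ?g"
        using r s by (intro continuous_intros continuous_on_compose2[OF continuous_on_poisson_radial[OF t]]) auto
    qed (use r in auto)
    finally show ?thesis .
  qed
  have "0 = (\<integral>s. (\<integral>r. f (r *\<^sub>R s) \<partial>radial_measure TYPE('a)) \<partial>sphere_borel)"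
    using f0 integral_polar_swap[OF intf] by simp
  also have "\<dots> = (\<integral>s. real ?n * ?V * (poisson_kernel (r0 *\<^sub>R s) t - poisson_kernel (r1 *\<^sub>R s) t) \<partial>sphere_borel)"
  proof (rule integral_cong_AE)
    show "AE s in sphere_borel. (\<integral>r. f (r *\<^sub>R s) \<partial>radial_measure TYPE('a)) =
       real ?n * ?V * (poisson_kernel (r0 *\<^sub>R s) t - poisson_kernel (r1 *\<^sub>R s) t)"
      using AE_sphere_borel_norm by eventually_elim (rule inner)
    have "(\<lambda>(s, r). f (r *\<^sub>R s)) \<in> borel_measurable (sphere_borel \<Otimes>\<^sub>M radial_measure TYPE('a))"
      using mf by measurable
    then show "(\<lambda>s. \<integral>r. f (r *\<^sub>R s) \<partial>radial_measure TYPE('a)) \<in> borel_measurable sphere_borel"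
      by (rule sigma_finite_measure.borel_measurable_lebesgue_integral[OF sigma_finite_radial_measure])
  qed measurable
  also have "\<dots> = real ?n * ?V * ((\<integral>s. poisson_kernel (r0 *\<^sub>R s) t \<partial>sphere_borel) - (\<integral>s. poisson_kernel (r1 *\<^sub>R s) t \<partial>sphere_borel))"
    using r t by (simp add: integrable_poisson_kernel_sphere)
  finally show ?thesis by simp
qed

text \<open>Letting the smaller radius tend to 0 turns the mean into the value 1 of the kernel at
  the centre. The means so far run over the first argument; \<open>|s - r t| = |t - r s|\<close> for
  unit vectors exchanges the roles.\<close>

lemma poisson_sphere_mean:
  fixes t :: "'a::euclidean_space"
  assumes dim: "DIM('a) \<ge> 2" and t: "norm t = 1" and r: "0 < r" "r < 1"
  shows "(\<integral>s. poisson_kernel (r *\<^sub>R t) s \<partial>sphere_borel) = 1"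
proof -
  interpret S: prob_space "sphere_borel :: 'a measure" by (rule prob_space_sphere_borel)
  \<comment> \<open>Starting the denominators at 2 keeps the radius strictly below r, as the
    comparison of two means requires.\<close>
  let ?q = "\<lambda>k. r / real (Suc (Suc k))"
  have q: "0 < ?q k" "?q k < r" "?q k < 1" for k using r by (auto simp: field_simps add_strict_increasing)
  have q0: "?q \<longlonglongrightarrow> 0"
    using LIMSEQ_Suc[OF LIMSEQ_inverse_real_of_nat] tendsto_mult_right_zero[of "\<lambda>n. inverse (real (Suc (Suc n)))" sequentially r]
    by (simp add: divide_inverse)
  have "(\<lambda>k. \<integral>s. poisson_kernel (?q k *\<^sub>R s) t \<partial>sphere_borel) \<longlonglongrightarrow> (\<integral>s. 1 \<partial>(sphere_borel :: 'a measure))"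
  proof (rule integral_dominated_convergence[where w="\<lambda>_. (1 / (1 - r)\<^sup>2) ^ (DIM('a) - 1)"])
    show "AE s in sphere_borel. (\<lambda>k. poisson_kernel (?q k *\<^sub>R s) t) \<longlonglongrightarrow> 1"
    proof (rule AE_I2)
      fix s :: 'a
      have "(\<lambda>k. poisson_kernel (?q k *\<^sub>R s) t) \<longlonglongrightarrow> ((1 - (norm (0 *\<^sub>R s))\<^sup>2) / (norm (t - 0 *\<^sub>R s))\<^sup>2) ^ (DIM('a) - 1)"
        unfolding poisson_kernel_def using t by (intro tendsto_intros q0) auto
      then show "(\<lambda>k. poisson_kernel (?q k *\<^sub>R s) t) \<longlonglongrightarrow> 1" using t by simp
    qed
    show "AE s in sphere_borel. norm (poisson_kernel (?q k *\<^sub>R s) t) \<le> (1 / (1 - r)\<^sup>2) ^ (DIM('a) - 1)" for k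
      using AE_sphere_borel_norm
    proof eventually_elim
      case (elim s)
      have "norm (?q k *\<^sub>R s) \<le> r" using q[of k] elim r by (simp del: of_nat_Suc)
      then show ?case using poisson_kernel_bounds[of "?q k *\<^sub>R s" r t] t r by simp
    qed
  qed (simp_all, measurable)
  moreover have "(\<integral>s. poisson_kernel (?q k *\<^sub>R s) t \<partial>sphere_borel) = (\<integral>s. poisson_kernel (r *\<^sub>R s) t \<partial>sphere_borel)" for k
    by (rule poisson_sphere_mean_const[OF dim t q(1,2) r(2), symmetric])
  ultimately have "(\<integral>s. poisson_kernel (r *\<^sub>R s) t \<partial>sphere_borel) = 1"
    using S.prob_space by (simp add: LIMSEQ_const_iff)
  moreover have "(\<integral>s. poisson_kernel (r *\<^sub>R t) s \<partial>sphere_borel) = (\<integral>s. poisson_kernel (r *\<^sub>R s) t \<partial>sphere_borel)"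
  proof (rule integral_cong_AE)
    show "AE s in sphere_borel. poisson_kernel (r *\<^sub>R t) s = poisson_kernel (r *\<^sub>R s) t"
      using AE_sphere_borel_norm
    proof eventually_elim
      case (elim s)
      have "s \<bullet> s = 1" "t \<bullet> t = 1" using elim t by (simp_all add: norm_eq_1)
      then have "(norm (s - r *\<^sub>R t))\<^sup>2 = (norm (t - r *\<^sub>R s))\<^sup>2"
        by (simp add: power2_norm_eq_inner inner_simps inner_commute)
      then show ?case using elim t by (simp add: poisson_kernel_def)
    qed
  qed measurable
  ultimately show ?thesis by simp
qed

subsection \<open>The regularized Green function\<close>

text \<open>As for the Poisson kernel, three quantities along b: the derivative of p in x, the flux
  obtained from it by multiplication with w, and the derivative of the flux.\<close>

definition hyp_dist_partial :: "'a::euclidean_space \<Rightarrow> 'a \<Rightarrow> 'a \<Rightarrow> real" where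
  "hyp_dist_partial y b x = 2 / (1 - (norm y)\<^sup>2) *
     (((x - y) \<bullet> b) / (1 - (norm x)\<^sup>2) + (norm (x - y))\<^sup>2 * (x \<bullet> b) / (1 - (norm x)\<^sup>2)\<^sup>2)"

definition hyp_dist_flux :: "'a::euclidean_space \<Rightarrow> 'a \<Rightarrow> 'a \<Rightarrow> real" where
  "hyp_dist_flux y b x = 2 / (1 - (norm y)\<^sup>2) *
     (((x - y) \<bullet> b) * (1 / (1 - (norm x)\<^sup>2) ^ (DIM('a) - 1)) +
      (norm (x - y))\<^sup>2 * (x \<bullet> b) * (1 / (1 - (norm x)\<^sup>2) ^ DIM('a)))"

definition hyp_dist_flux_deriv :: "'a::euclidean_space \<Rightarrow> 'a \<Rightarrow> 'a \<Rightarrow> real" where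
  "hyp_dist_flux_deriv y b x = 2 / (1 - (norm y)\<^sup>2) *
     (1 / (1 - (norm x)\<^sup>2) ^ (DIM('a) - 1)
      + (real (DIM('a)) - 1) * (2 * (x \<bullet> b)) / (1 - (norm x)\<^sup>2) ^ DIM('a) * ((x - y) \<bullet> b)
      + (2 * ((x - y) \<bullet> b) * (x \<bullet> b) + (norm (x - y))\<^sup>2) / (1 - (norm x)\<^sup>2) ^ DIM('a)
      + real (DIM('a)) * (2 * (x \<bullet> b)) / (1 - (norm x)\<^sup>2) ^ Suc (DIM('a)) * ((norm (x - y))\<^sup>2 * (x \<bullet> b)))"

lemma has_partial_hyp_dist:
  fixes x y b :: "'a::euclidean_space"
  assumes b: "b \<in> Basis" and x: "norm x < 1"
  shows "has_partial (\<lambda>x. hyp_dist x y) (hyp_dist_partial y b x) b x"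
proof -
  have r: "1 - (norm x)\<^sup>2 \<noteq> 0" using one_minus_norm_sq_pos[OF x] by simp
  have r0: "1 - (norm (x + 0 *\<^sub>R b))\<^sup>2 \<noteq> 0" using r by simp
  have eq: "hyp_dist z y = 1 / (1 - (norm y)\<^sup>2) * ((norm (z - y))\<^sup>2 / (1 - (norm z)\<^sup>2))" for z
    by (simp add: hyp_dist_def)
  note D = DERIV_cmult[OF DERIV_divide[OF has_partial_norm_sq[OF b]
      DERIV_diff[OF DERIV_const has_partial_norm_sq_0[OF b, of x], of 1] r0], of "1 / (1 - (norm y)\<^sup>2)"]
  show ?thesis
    unfolding eq
  proof (rule DERIV_cong[OF D])
    have "K * ((2 * X * R - S * (0 - 2 * T)) / (R * R)) = 2 * K * (X / R + S * T / R\<^sup>2)"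
      if "R \<noteq> 0" for K X S T R :: real
      using that by (simp add: field_simps power2_eq_square)
    from this[OF r, of "1 / (1 - (norm y)\<^sup>2)" "(x - y) \<bullet> b" "(norm (x - y))\<^sup>2" "x \<bullet> b"]
    show "1 / (1 - (norm y)\<^sup>2) * ((2 * ((x - y) \<bullet> b) * (1 - (norm (x + 0 *\<^sub>R b))\<^sup>2) -
        (norm (x + 0 *\<^sub>R b - y))\<^sup>2 * (0 - 2 * (x \<bullet> b))) /
        ((1 - (norm (x + 0 *\<^sub>R b))\<^sup>2) * (1 - (norm (x + 0 *\<^sub>R b))\<^sup>2))) = hyp_dist_partial y b x"
      by (simp add: hyp_dist_partial_def)
  qed
qed

lemma has_partial_hyp_dist_flux:
  fixes x y b :: "'a::euclidean_space"
  assumes b: "b \<in> Basis" and x: "norm x < 1"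
  shows "has_partial (hyp_dist_flux y b) (hyp_dist_flux_deriv y b x) b x"
proof -
  let ?n = "DIM('a)"
  have r0: "1 - (norm (x + 0 *\<^sub>R b))\<^sup>2 \<noteq> 0" using one_minus_norm_sq_pos[OF x] by simp
  have n: "Suc (?n - 1) = ?n" by simp
  have rn: "real (?n - 1) = real ?n - 1" by (simp add: of_nat_diff)
  note q1 = DERIV_one_over_power[OF has_partial_norm_sq_0[OF b] r0, of "?n - 1", unfolded n rn]
  note q2 = DERIV_one_over_power[OF has_partial_norm_sq_0[OF b] r0, of "?n"]
  have i0: "has_partial (\<lambda>x. x \<bullet> b) 1 b x"
    using has_partial_inner[OF b, where t=0 and x=x] by simp
  note i1 = has_partial_inner[OF b, where t=y and x=x]
  note s = has_partial_norm_sq[OF b, where y=y and x=x]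
  note D = DERIV_cmult[OF DERIV_add[OF DERIV_mult[OF i1 q1] DERIV_mult[OF DERIV_mult[OF s i0] q2]],
    of "2 / (1 - (norm y)\<^sup>2)"]
  have alg: "K * ((1 * (1 / u1) + (N - 1) * (2 * T) / u2 * X) + ((2 * X * T + 1 * S) * (1 / u2) + N * (2 * T) / u3 * (S * T))) =
      K * (1 / u1 + (N - 1) * (2 * T) / u2 * X + (2 * X * T + S) / u2 + N * (2 * T) / u3 * (S * T))"
    for K u1 u2 u3 N T X S :: real by simp
  show ?thesis
    unfolding hyp_dist_flux_def
    by (rule DERIV_cong[OF D]) (simp only: scaleR_zero_left add_0_right hyp_dist_flux_deriv_def, rule alg)
qed

lemma hyp_weight_hyp_dist_partial:
  fixes x y b :: "'a::euclidean_space"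
  assumes dim: "DIM('a) \<ge> 2" and x: "norm x < 1"
  shows "hyp_weight x * hyp_dist_partial y b x = hyp_dist_flux y b x"
proof -
  obtain m where m: "DIM('a) = Suc (Suc m)" using dim by (metis Suc_le_D numeral_2_eq_2 Suc_le_mono)
  have r: "1 - (norm x)\<^sup>2 \<noteq> 0" using one_minus_norm_sq_pos[OF x] by simp
  have "1 / R ^ m * (K * (X / R + S * T / R\<^sup>2)) = K * (X * (1 / R ^ Suc m) + S * T * (1 / R ^ Suc (Suc m)))"
    if "R \<noteq> 0" for K X S T R :: real
    using that by (simp add: field_simps power2_eq_square)
  note alg = this[OF r]
  have e: "Suc (Suc m) - 2 = m" "Suc (Suc m) - 1 = Suc m" by simp_all
  show ?thesis
    unfolding hyp_weight_def hyp_dist_partial_def hyp_dist_flux_def m e by (rule alg)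
qed

text \<open>Both sums become polynomials in p by the single relation
  \<open>1 - |x|^2 + 2 (x \<bullet> (x - y)) - |x - y|^2 = 1 - |y|^2\<close>. On functions f of p
  the operator \<open>(1 - |x|^2)^n div (w grad f)\<close> is therefore
  \<open>4 p (1 + p) f'' + 2 n (1 + 2 p) f'\<close>, which annihilates \<open>green_radial\<close>
  for \<open>p > 0\<close>.\<close>

lemma hyp_dist_sum_identities:
  fixes x y :: "'a::euclidean_space"
  assumes x: "norm x < 1" and y: "norm y < 1"
  shows "(\<Sum>b\<in>Basis. hyp_dist_partial y b x * hyp_dist_flux y b x) =
      4 * hyp_dist x y * (1 + hyp_dist x y) / (1 - (norm x)\<^sup>2) ^ DIM('a)" (is ?th1)
    and "(\<Sum>b\<in>Basis. hyp_dist_flux_deriv y b x) =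
      2 * real DIM('a) * (1 + 2 * hyp_dist x y) / (1 - (norm x)\<^sup>2) ^ DIM('a)" (is ?th2)
proof -
  let ?n = "DIM('a)"
  define r where "r = 1 - (norm x)\<^sup>2"
  define k where "k = 1 - (norm y)\<^sup>2"
  define s where "s = (norm (x - y))\<^sup>2"
  define c where "c = x \<bullet> (x - y)"
  have rk: "r > 0" "k > 0" using one_minus_norm_sq_pos[OF x] one_minus_norm_sq_pos[OF y] by (simp_all add: r_def k_def)
  have nx: "(norm x)\<^sup>2 = 1 - r" by (simp add: r_def)
  have key: "r + 2 * c - s = k"
    by (simp add: r_def c_def s_def k_def power2_norm_eq_inner inner_diff_left inner_diff_right inner_commute)
  have xx: "(\<Sum>b\<in>Basis. (x \<bullet> b) * (x \<bullet> b)) = 1 - r"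
    unfolding nx[symmetric] by (simp add: power2_norm_eq_inner euclidean_inner[of x x])
  have xt: "(\<Sum>b\<in>Basis. (x \<bullet> b) * ((x - y) \<bullet> b)) = c"
    by (simp add: euclidean_inner[of x "x - y"] c_def)
  have ss: "(\<Sum>b\<in>Basis. ((x - y) \<bullet> b) * ((x - y) \<bullet> b)) = s"
    by (simp add: s_def power2_norm_eq_inner euclidean_inner[of "x - y" "x - y"])
  have p: "hyp_dist x y = s / (r * k)" by (simp add: hyp_dist_def r_def k_def s_def)
  have rn: "r ^ ?n = r * r ^ (?n - 1)" using power_minus_mult[of ?n r] by (simp add: mult.commute)
  have "(\<Sum>b\<in>Basis. hyp_dist_partial y b x * hyp_dist_flux y b x) =
    (\<Sum>b\<in>Basis. (4 / k\<^sup>2 / r ^ ?n) * (((x - y) \<bullet> b) * ((x - y) \<bullet> b))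
       + (8 * s / k\<^sup>2 / r / r ^ ?n) * ((x \<bullet> b) * ((x - y) \<bullet> b))
       + (4 * s\<^sup>2 / k\<^sup>2 / r\<^sup>2 / r ^ ?n) * ((x \<bullet> b) * (x \<bullet> b)))"
  proof (rule sum.cong[OF refl])
    fix b :: 'a
    have "2 / k * (X / r + s * T / r\<^sup>2) * (2 / k * (X * (1 / u) + s * T * (1 / (r * u)))) =
      (4 / k\<^sup>2 / (r * u)) * (X * X) + (8 * s / k\<^sup>2 / r / (r * u)) * (T * X) + (4 * s\<^sup>2 / k\<^sup>2 / r\<^sup>2 / (r * u)) * (T * T)"
      if "u > 0" for X T u
      using that rk by (simp add: divide_simps) (simp add: algebra_simps power2_eq_square)
    from this[of "r ^ (?n - 1)"] rk
    show "hyp_dist_partial y b x * hyp_dist_flux y b x = (4 / k\<^sup>2 / r ^ ?n) * (((x - y) \<bullet> b) * ((x - y) \<bullet> b))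
       + (8 * s / k\<^sup>2 / r / r ^ ?n) * ((x \<bullet> b) * ((x - y) \<bullet> b))
       + (4 * s\<^sup>2 / k\<^sup>2 / r\<^sup>2 / r ^ ?n) * ((x \<bullet> b) * (x \<bullet> b))"
      unfolding hyp_dist_partial_def hyp_dist_flux_def r_def[symmetric] k_def[symmetric] s_def[symmetric] rn
      by simp
  qed
  also have "\<dots> = (4 / k\<^sup>2 / r ^ ?n) * s + (8 * s / k\<^sup>2 / r / r ^ ?n) * c + (4 * s\<^sup>2 / k\<^sup>2 / r\<^sup>2 / r ^ ?n) * (1 - r)"
    unfolding sum.distrib sum_distrib_left[symmetric] xx xt ss ..
  also have "\<dots> = 4 * s / (k\<^sup>2 * r\<^sup>2 * r ^ ?n) * (r * (r + 2 * c - s) + s)"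
    using rk by (simp add: divide_simps) (simp add: algebra_simps power2_eq_square)
  also have "\<dots> = 4 * s / (k\<^sup>2 * r\<^sup>2 * r ^ ?n) * (r * k + s)" unfolding key ..
  also have "\<dots> = 4 * hyp_dist x y * (1 + hyp_dist x y) / r ^ ?n"
    unfolding p using rk by (simp add: divide_simps) (simp add: algebra_simps power2_eq_square)
  finally show ?th1 by (simp add: r_def)
  have "(\<Sum>b\<in>Basis. hyp_dist_flux_deriv y b x) = (\<Sum>b\<in>Basis. 2 / k * ((r + s) / r ^ ?n)
       + (2 / k * (2 * real ?n / r ^ ?n)) * ((x \<bullet> b) * ((x - y) \<bullet> b))
       + (2 / k * (2 * real ?n * s / (r * r ^ ?n))) * ((x \<bullet> b) * (x \<bullet> b)))"
  proof (rule sum.cong[OF refl])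
    fix b :: 'a
    have "2 / k * (1 / u + (N - 1) * (2 * T) / (r * u) * X + (2 * X * T + s) / (r * u) + N * (2 * T) / (r * (r * u)) * (s * T)) =
      2 / k * ((r + s) / (r * u)) + (2 / k * (2 * N / (r * u))) * (T * X) + (2 / k * (2 * N * s / (r * (r * u)))) * (T * T)"
      if "u > 0" for X T u N
      using that rk by (simp add: divide_simps) (simp add: algebra_simps)
    from this[of "r ^ (?n - 1)"] rk
    show "hyp_dist_flux_deriv y b x = 2 / k * ((r + s) / r ^ ?n)
       + (2 / k * (2 * real ?n / r ^ ?n)) * ((x \<bullet> b) * ((x - y) \<bullet> b))
       + (2 / k * (2 * real ?n * s / (r * r ^ ?n))) * ((x \<bullet> b) * (x \<bullet> b))"
      unfolding hyp_dist_flux_deriv_def r_def[symmetric] k_def[symmetric] s_def[symmetric] power_Suc rn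
      by simp
  qed
  also have "\<dots> = real ?n * (2 / k * ((r + s) / r ^ ?n)) + (2 / k * (2 * real ?n / r ^ ?n)) * c
       + (2 / k * (2 * real ?n * s / (r * r ^ ?n))) * (1 - r)"
    unfolding sum.distrib sum_distrib_left[symmetric] xx xt by simp
  also have "\<dots> = 2 * real ?n / (k * r * r ^ ?n) * (r * (r + 2 * c - s) + 2 * s)"
    using rk by (simp add: divide_simps) (simp add: algebra_simps)
  also have "\<dots> = 2 * real ?n / (k * r * r ^ ?n) * (r * k + 2 * s)" unfolding key ..
  also have "\<dots> = 2 * real ?n * (1 + 2 * hyp_dist x y) / r ^ ?n"
    unfolding p using rk by (simp add: divide_simps)
  finally show ?th2 by (simp add: r_def)
qed

text \<open>Minus this operator applied to \<open>green_radial n (p + \<epsilon>)\<close>. The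
  coefficients are taken at p but the function at \<open>P = p + \<epsilon>\<close>; the mismatch
  leaves the factor \<epsilon> and the bracket
  \<open>(1 + 2 P)^2 - 2 P (1 + P) - \<epsilon> (1 + 2 P)\<close>.\<close>

definition bubble :: "nat \<Rightarrow> real \<Rightarrow> real \<Rightarrow> real" where
  "bubble n \<epsilon> p = \<epsilon> * ((p + \<epsilon>) * (1 + (p + \<epsilon>))) powr (- (real n / 2) - 1) *
     (1 + 2 * (p + \<epsilon>) + 2 * (p + \<epsilon>)\<^sup>2 - \<epsilon> - 2 * \<epsilon> * (p + \<epsilon>))"

lemma continuous_on_hyp_dist:
  assumes "norm y < 1"
  shows "continuous_on unit_ball (\<lambda>x. hyp_dist x y)"
  unfolding hyp_dist_def
  using one_minus_norm_sq_pos[OF assms] one_minus_norm_sq_pos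
  by (intro continuous_intros) force

text \<open>The shifted variable stays positive on the whole ball, even at y, so Green's identity
  applies to the kernel without any exceptional point.\<close>

lemma green_regularized_identity:
  fixes \<psi> :: "'a::euclidean_space \<Rightarrow> real"
  assumes dim: "DIM('a) \<ge> 2" and psi: "\<psi> \<in> C2c_ball" and y: "norm y < 1" and e: "\<epsilon> > 0"
  shows "(\<integral>x. indicator unit_ball x * (green_radial (DIM('a)) (hyp_dist x y + \<epsilon>) * hyperbolic_laplacian \<psi> x / (1 - (norm x)\<^sup>2) ^ DIM('a)) \<partial>lborel) =
    - (\<integral>x. indicator unit_ball x * (\<psi> x * bubble (DIM('a)) \<epsilon> (hyp_dist x y) / (1 - (norm x)\<^sup>2) ^ DIM('a)) \<partial>lborel)"
proof -
  let ?n = "DIM('a)"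
  define d1 where "d1 P = - (1 / (2 * real ?n)) * (P * (1 + P)) powr (- (real ?n / 2))" for P
  define d2 where "d2 P = 1 / 4 * (P * (1 + P)) powr (- (real ?n / 2) - 1) * (1 + 2 * P)" for P
  have D1: "(green_radial ?n has_real_derivative d1 P) (at P)" if "P > 0" for P
    unfolding d1_def by (rule DERIV_green_radial[OF dim that])
  have D2: "(d1 has_real_derivative d2 P) (at P)" if "P > 0" for P
  proof -
    have "((\<lambda>P. P * (1 + P)) has_real_derivative 1 + 2 * P) (at P)"
      by (auto intro!: derivative_eq_intros)
    from DERIV_cmult[OF DERIV_chain2[OF has_real_derivative_powr[of "P * (1 + P)" "- (real ?n / 2)"] this], of "- (1 / (2 * real ?n))"]
    have "(d1 has_real_derivative - (1 / (2 * real ?n)) *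
        (- (real ?n / 2) * (P * (1 + P)) powr (- (real ?n / 2) - 1) * (1 + 2 * P))) (at P)"
      unfolding d1_def using that by simp
    then show ?thesis by (rule DERIV_cong) (simp add: d2_def)
  qed
  define p where "p x = hyp_dist x y" for x
  have p0: "p x + \<epsilon> > 0" if "norm x < 1" for x
    using hyp_dist_nonneg[OF that y] e by (simp add: p_def)
  define vb where "vb b x = d1 (p x + \<epsilon>) * hyp_dist_partial y b x" for b x
  define Dv where "Dv b x = d2 (p x + \<epsilon>) * hyp_dist_partial y b x * hyp_dist_flux y b x + hyp_dist_flux_deriv y b x * d1 (p x + \<epsilon>)" for b x
  have pder: "has_partial (\<lambda>x. p x + \<epsilon>) (hyp_dist_partial y b x) b x" if "b \<in> Basis" "norm x < 1" for b x
    unfolding p_def using DERIV_add[OF has_partial_hyp_dist[OF that] DERIV_const] by simp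
  have cp: "continuous_on unit_ball (\<lambda>x. p x + \<epsilon>)"
    unfolding p_def by (intro continuous_intros continuous_on_hyp_dist y)
  have cc: "continuous_on unit_ball (\<lambda>x. F (p x + \<epsilon>))" if "\<And>P. P > 0 \<Longrightarrow> isCont F P" for F :: "real \<Rightarrow> real"
    by (rule continuous_on_compose2[where t="{0<..}", OF _ cp])
       (use p0 that in \<open>auto intro!: continuous_at_imp_continuous_on\<close>)
  have nz: "1 - (norm x)\<^sup>2 \<noteq> 0" if "x \<in> unit_ball" for x :: 'a
    using one_minus_norm_sq_pos[of x] that by auto
  have c1: "continuous_on unit_ball (hyp_dist_partial y b)" "continuous_on unit_ball (hyp_dist_flux y b)"
    "continuous_on unit_ball (hyp_dist_flux_deriv y b)" for b
    unfolding hyp_dist_partial_def hyp_dist_flux_def hyp_dist_flux_deriv_def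
    by (intro continuous_intros; use nz one_minus_norm_sq_pos[OF y] in force)+
  have cd2: "isCont d2 P" if "P > 0" for P
    unfolding d2_def using that by (intro continuous_intros) auto
  have "(\<integral>x. indicator unit_ball x * (green_radial ?n (p x + \<epsilon>) * hyperbolic_laplacian \<psi> x / (1 - (norm x)\<^sup>2) ^ ?n) \<partial>lborel)
    = (\<integral>x. indicator unit_ball x * (\<psi> x * (\<Sum>b\<in>Basis. Dv b x)) \<partial>lborel)"
  proof (rule green_identity[OF dim psi, where vb=vb])
    show "continuous_on unit_ball (\<lambda>x. green_radial ?n (p x + \<epsilon>))"
      by (intro cc) (rule DERIV_isCont[OF D1])
    show "continuous_on unit_ball (vb b)" for b
      unfolding vb_def by (intro continuous_intros c1 cc) (rule DERIV_isCont[OF D2])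
    show "continuous_on unit_ball (Dv b)" for b
      unfolding Dv_def by (intro continuous_intros c1 cc) (auto intro: DERIV_isCont[OF D2] cd2)
    show "has_partial (\<lambda>x. green_radial ?n (p x + \<epsilon>)) (vb b x) b x" if b: "b \<in> Basis" and x: "norm x < 1" for b x
      unfolding vb_def using DERIV_chain2[OF _ pder[OF b x], of "green_radial ?n" "d1 (p x + \<epsilon>)"] D1[OF p0[OF x]] by simp
    show "has_partial (\<lambda>x. hyp_weight x * vb b x) (Dv b x) b x" if b: "b \<in> Basis" and x: "norm x < 1" for b x
    proof (subst has_partial_cong[where S=unit_ball])
      show "hyp_weight z * vb b z = d1 (p z + \<epsilon>) * hyp_dist_flux y b z" if "z \<in> unit_ball" for z
        using hyp_weight_hyp_dist_partial[OF dim, of z y b] that by (simp add: vb_def mult.left_commute)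
      have "(d1 has_real_derivative d2 (p x + \<epsilon>)) (at (p (x + 0 *\<^sub>R b) + \<epsilon>))"
        using D2[OF p0[OF x]] by simp
      from DERIV_mult[OF DERIV_chain2[OF this pder[OF b x]] has_partial_hyp_dist_flux[OF b x, of y]]
      show "has_partial (\<lambda>z. d1 (p z + \<epsilon>) * hyp_dist_flux y b z) (Dv b x) b x"
        by (simp add: Dv_def)
    qed (use x in auto)
  qed
  also have "\<dots> = (\<integral>x. - (indicator unit_ball x * (\<psi> x * bubble ?n \<epsilon> (p x) / (1 - (norm x)\<^sup>2) ^ ?n)) \<partial>lborel)"
  proof (rule Bochner_Integration.integral_cong[OF refl])
    fix x :: 'a
    show "indicator unit_ball x * (\<psi> x * (\<Sum>b\<in>Basis. Dv b x)) = - (indicator unit_ball x * (\<psi> x * bubble ?n \<epsilon> (p x) / (1 - (norm x)\<^sup>2) ^ ?n))"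
    proof (cases "x \<in> unit_ball")
      case True
      then have x: "norm x < 1" by simp
      define P where "P = p x + \<epsilon>"
      have P: "P > 0" using p0[OF x] by (simp add: P_def)
      define Z where "Z = (P * (1 + P)) powr (- (real ?n / 2) - 1)"
      have Z: "(P * (1 + P)) powr (- (real ?n / 2)) = Z * (P * (1 + P))"
        using P by (simp add: Z_def powr_diff)
      have px: "p x = P - \<epsilon>" by (simp add: P_def)
      have "(\<Sum>b\<in>Basis. Dv b x) = d2 P * (\<Sum>b\<in>Basis. hyp_dist_partial y b x * hyp_dist_flux y b x) + (\<Sum>b\<in>Basis. hyp_dist_flux_deriv y b x) * d1 P"
        by (simp add: Dv_def P_def sum.distrib sum_distrib_left sum_distrib_right mult.assoc)
      also have "\<dots> = (d2 P * (4 * p x * (1 + p x)) + 2 * real ?n * (1 + 2 * p x) * d1 P) / (1 - (norm x)\<^sup>2) ^ ?n"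
        unfolding hyp_dist_sum_identities[OF x y] p_def by (simp add: add_divide_distrib)
      \<comment> \<open>The terms free of \<epsilon> cancel because \<open>d1\<close> and its
        derivative \<open>d2\<close> solve the differential equation at P.\<close>
      also have "d2 P * (4 * p x * (1 + p x)) + 2 * real ?n * (1 + 2 * p x) * d1 P = - bubble ?n \<epsilon> (p x)"
      proof -
        have b: "bubble ?n \<epsilon> (p x) = \<epsilon> * Z * (1 + 2 * P + 2 * P\<^sup>2 - \<epsilon> - 2 * \<epsilon> * P)"
          by (simp only: bubble_def P_def Z_def)
        have e2: "d2 P = 1 / 4 * Z * (1 + 2 * P)" by (simp only: d2_def Z_def)
        have e1: "2 * real ?n * (1 + 2 * p x) * d1 P = - ((1 + 2 * p x) * (Z * (P * (1 + P))))"
          by (simp add: d1_def Z)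
        show ?thesis unfolding b e1 e2 unfolding px by (simp add: algebra_simps power2_eq_square)
      qed
      finally show ?thesis using True by simp
    qed simp
  qed
  finally show ?thesis by (simp add: p_def)
qed

lemma norm_sq_le_hyp_dist:
  assumes "norm x < 1" "norm y < 1"
  shows "(norm (x - y))\<^sup>2 \<le> hyp_dist x y"
proof -
  let ?r = "(1 - (norm x)\<^sup>2) * (1 - (norm y)\<^sup>2)"
  have "0 < ?r" using one_minus_norm_sq_pos[OF assms(1)] one_minus_norm_sq_pos[OF assms(2)] by simp
  moreover have "?r \<le> 1 * 1"
    using one_minus_norm_sq_pos[OF assms(1)] one_minus_norm_sq_pos[OF assms(2)] by (intro mult_mono) auto
  moreover have "s \<le> s / r" if "0 < r" "r \<le> 1" "0 \<le> s" for r s :: real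
    using that by (simp add: pos_le_divide_eq mult_left_le)
  ultimately show ?thesis unfolding hyp_dist_def by simp
qed

text \<open>The polynomial factor lies between 0 and \<open>2 (1 + P)^2\<close>, the lower bound
  thanks to \<open>\<epsilon> < 1\<close>, and \<open>(1 + P) powr (- n/2 - 1)\<close> absorbs it
  because \<open>n \<ge> 2\<close>. What is left scales like the Euclidean bubble.\<close>

lemma bubble_bounds:
  assumes n: "n \<ge> 2" and e: "0 < \<epsilon>" "\<epsilon> < 1" and p: "0 \<le> p"
  shows "0 \<le> bubble n \<epsilon> p" "bubble n \<epsilon> p \<le> 2 * \<epsilon> * (p + \<epsilon>) powr (- (real n / 2) - 1)"
proof -
  define P where "P = p + \<epsilon>"
  have P: "P > 0" using e p by (simp add: P_def)
  let ?a = "- (real n / 2) - 1"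
  let ?c = "1 + 2 * P + 2 * P\<^sup>2 - \<epsilon> - 2 * \<epsilon> * P"
  have c: "?c = (1 - \<epsilon>) + 2 * P * (1 - \<epsilon>) + 2 * P\<^sup>2" by (simp add: algebra_simps)
  have c0: "0 \<le> ?c" unfolding c using P e by simp
  then show "0 \<le> bubble n \<epsilon> p" using e by (simp add: bubble_def P_def[symmetric])
  have "?c \<le> 2 * (1 + P)\<^sup>2" using P e by (simp add: power2_eq_square algebra_simps add_nonneg_nonneg)
  then have "(1 + P) powr ?a * ?c \<le> (1 + P) powr ?a * (2 * (1 + P)\<^sup>2)"
    by (intro mult_left_mono) auto
  also have "\<dots> = 2 * (1 + P) powr (1 - real n / 2)"
  proof -
    have "(1 + P)\<^sup>2 = (1 + P) powr 2" using P by (simp flip: powr_numeral)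
    then show ?thesis by (simp flip: powr_add)
  qed
  also have "(1 + P) powr (1 - real n / 2) \<le> (1 + P) powr 0"
    using P n by (intro powr_mono) auto
  finally have m: "(1 + P) powr ?a * ?c \<le> 2" using P by simp
  have "bubble n \<epsilon> p = \<epsilon> * P powr ?a * ((1 + P) powr ?a * ?c)"
    using P by (simp add: bubble_def P_def[symmetric] powr_mult)
  also have "\<dots> \<le> \<epsilon> * P powr ?a * 2"
    using m e by (intro mult_left_mono) auto
  finally show "bubble n \<epsilon> p \<le> 2 * \<epsilon> * (p + \<epsilon>) powr ?a" by (simp add: P_def)
qed

lemma borel_measurable_hyp_dist [measurable]:
  assumes [measurable]: "f \<in> borel_measurable M" "g \<in> borel_measurable M"
  shows "(\<lambda>z. hyp_dist (f z) (g z :: 'a::euclidean_space)) \<in> borel_measurable M"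
  unfolding hyp_dist_def by measurable

lemma borel_measurable_bubble [measurable]: "bubble n \<epsilon> \<in> borel_measurable borel"
  unfolding bubble_def by measurable

lemma bubble_integrable:
  "integrable lborel (\<lambda>z. (1 + (norm (z::'a::euclidean_space))\<^sup>2) powr (- (DIM('a) / 2) - 1))"
  "(\<integral>z. (1 + (norm (z::'a::euclidean_space))\<^sup>2) powr (- (DIM('a) / 2) - 1) \<partial>lborel) = unit_ball_vol (DIM('a))"
proof -
  have "has_bochner_integral lborel (\<lambda>z. (1 + (norm (z::'a))\<^sup>2) powr (- (DIM('a) / 2) - 1)) (unit_ball_vol (DIM('a)))"
    by (rule has_bochner_integral_nn_integral) (auto simp: nn_integral_bubble)
  then show "integrable lborel (\<lambda>z. (1 + (norm (z::'a))\<^sup>2) powr (- (DIM('a) / 2) - 1))"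
    "(\<integral>z. (1 + (norm (z::'a))\<^sup>2) powr (- (DIM('a) / 2) - 1) \<partial>lborel) = unit_ball_vol (DIM('a))"
    by (simp_all add: has_bochner_integral_iff)
qed

text \<open>
  The substitution \<open>x = y + \<delta> z\<close> turns the bubble of size \<open>\<delta>^2\<close> into a perturbation of
  \<open>(1 + k^2 |z|^2)^(- n/2 - 1)\<close> with \<open>k = 1 / (1 - |y|^2)\<close>.
\<close>
lemma bubble_approximate_identity:
  fixes H :: "'a::euclidean_space \<Rightarrow> real"
  assumes dim: "DIM('a) \<ge> 2" and y: "norm y < 1" and mH [measurable]: "H \<in> borel_measurable borel"
    and B: "\<And>x. \<bar>H x\<bar> \<le> B" and z: "\<And>x. norm x \<ge> 1 \<Longrightarrow> H x = 0" and c: "isCont H y"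
  shows "(\<lambda>j. \<integral>x. H x * bubble (DIM('a)) ((1 / real (Suc (Suc j)))\<^sup>2) (hyp_dist x y) \<partial>lborel) \<longlonglongrightarrow>
    unit_ball_vol (DIM('a)) * (1 - (norm y)\<^sup>2) ^ DIM('a) * H y"
proof -
  let ?n = "DIM('a)"
  let ?a = "- (real ?n / 2) - 1"
  define d where "d j = 1 / real (Suc (Suc j))" for j
  have d: "0 < d j" "d j < 1" for j by (auto simp: d_def)
  have d0: "d \<longlonglongrightarrow> 0"
    using LIMSEQ_Suc[OF LIMSEQ_inverse_real_of_nat] by (simp add: d_def[abs_def] inverse_eq_divide)
  have e: "0 < (d j)\<^sup>2" "(d j)\<^sup>2 < 1" for j
    using d[of j] by (auto simp: power_less_one_iff abs_square_less_1)
  define k where "k = 1 / (1 - (norm y)\<^sup>2)"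
  have k: "k > 0" using one_minus_norm_sq_pos[OF y] by (simp add: k_def)
  define F where "F j z = d j ^ ?n * (H (y + d j *\<^sub>R z) * bubble ?n ((d j)\<^sup>2) (hyp_dist (y + d j *\<^sub>R z) y))" for j z
  have B0: "B \<ge> 0" using B[of 0] by linarith
  have affine: "(\<integral>x. H x * bubble ?n ((d j)\<^sup>2) (hyp_dist x y) \<partial>lborel) = (\<integral>z. F j z \<partial>lborel)" for j
    unfolding F_def using d[of j]
    by (subst lborel_integral_affine[where c="d j" and t=y]) (simp_all, measurable)
  \<comment> \<open>The majorant comes from \<open>|x - y|^2 \<le> p\<close>, which gives
    \<open>p + \<delta>^2 \<ge> \<delta>^2 (1 + |z|^2)\<close>. The Jacobian
    \<open>\<delta>^n\<close> and the factor \<open>\<delta>^2\<close> of the bubble cancel the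
    power of \<delta> that comes out.\<close>
  have "(\<lambda>j. \<integral>z. F j z \<partial>lborel) \<longlonglongrightarrow> (\<integral>z. H y * (1 + (norm (k *\<^sub>R (z::'a)))\<^sup>2) powr ?a \<partial>lborel)"
  proof (rule integral_dominated_convergence[where w="\<lambda>z::'a. 2 * B * (1 + (norm z)\<^sup>2) powr ?a"])
    show "(\<lambda>z::'a. H y * (1 + (norm (k *\<^sub>R z))\<^sup>2) powr ?a) \<in> borel_measurable lborel" by measurable
    show "F j \<in> borel_measurable lborel" for j unfolding F_def by measurable
    show "integrable lborel (\<lambda>z::'a. 2 * B * (1 + (norm z)\<^sup>2) powr ?a)"
      by (intro integrable_mult_right bubble_integrable)
    show "AE z in lborel. norm (F j z) \<le> 2 * B * (1 + (norm z)\<^sup>2) powr ?a" for j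
    proof (rule AE_I2)
      fix z :: 'a
      define x where "x = y + d j *\<^sub>R z"
      show "norm (F j z) \<le> 2 * B * (1 + (norm z)\<^sup>2) powr ?a"
      proof (cases "norm x < 1")
        case True
        let ?p = "hyp_dist x y"
        have p: "(d j)\<^sup>2 * (1 + (norm z)\<^sup>2) \<le> ?p + (d j)\<^sup>2"
          using norm_sq_le_hyp_dist[OF True y] d[of j] by (simp add: x_def power_mult_distrib algebra_simps)
        have pos: "0 < (d j)\<^sup>2 * (1 + (norm z)\<^sup>2)" using e by (simp add: add_pos_nonneg)
        note bb = bubble_bounds[OF dim e(1)[of j] e(2)[of j] hyp_dist_nonneg[OF True y]]
        have "bubble ?n ((d j)\<^sup>2) ?p \<le> 2 * (d j)\<^sup>2 * (?p + (d j)\<^sup>2) powr ?a" by (rule bb)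
        also have "\<dots> \<le> 2 * (d j)\<^sup>2 * ((d j)\<^sup>2 * (1 + (norm z)\<^sup>2)) powr ?a"
          using p pos by (intro mult_left_mono powr_mono2') auto
        also have "((d j)\<^sup>2 * (1 + (norm z)\<^sup>2)) powr ?a = d j powr (- real ?n - 2) * (1 + (norm z)\<^sup>2) powr ?a"
        proof -
          have "(d j)\<^sup>2 = d j powr 2" using d[of j] by (simp flip: powr_numeral)
          then have "((d j)\<^sup>2) powr ?a = d j powr (- real ?n - 2)" by (simp add: powr_powr algebra_simps)
          then show ?thesis by (simp add: powr_mult)
        qed
        finally have le: "bubble ?n ((d j)\<^sup>2) ?p \<le> 2 * (d j)\<^sup>2 * (d j powr (- real ?n - 2) * (1 + (norm z)\<^sup>2) powr ?a)" .
        have "d j ^ ?n * (d j)\<^sup>2 * d j powr (- real ?n - 2) = d j powr (real ?n + 2 + (- real ?n - 2))"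
          using d[of j] by (simp only: powr_add powr_realpow[symmetric] of_nat_numeral)
        then have one: "d j ^ ?n * (d j)\<^sup>2 * d j powr (- real ?n - 2) = 1" using d[of j] by simp
        have "norm (F j z) = d j ^ ?n * (\<bar>H x\<bar> * bubble ?n ((d j)\<^sup>2) ?p)"
          using d[of j] bb(1) by (simp add: F_def x_def[symmetric] abs_mult)
        also have "\<dots> \<le> d j ^ ?n * (B * (2 * (d j)\<^sup>2 * (d j powr (- real ?n - 2) * (1 + (norm z)\<^sup>2) powr ?a)))"
          using d[of j] B0 bb(1) by (intro mult_left_mono mult_mono B le) auto
        also have "\<dots> = (d j ^ ?n * (d j)\<^sup>2 * d j powr (- real ?n - 2)) * (2 * B * (1 + (norm z)\<^sup>2) powr ?a)"
          by (simp add: ac_simps)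
        finally show ?thesis by (simp add: one)
      next
        case False
        then show ?thesis using z B0 by (simp add: F_def x_def)
      qed
    qed
    show "AE z in lborel. (\<lambda>j. F j z) \<longlonglongrightarrow> H y * (1 + (norm (k *\<^sub>R z))\<^sup>2) powr ?a"
    proof (rule AE_I2)
      fix z :: 'a
      define x where "x j = y + d j *\<^sub>R z" for j
      have x: "x \<longlonglongrightarrow> y"
        unfolding x_def using tendsto_add[OF tendsto_const tendsto_scaleR[OF d0 tendsto_const], of y z] by simp
      \<comment> \<open>This is \<open>(p + \<delta>^2) / \<delta>^2\<close> at \<open>x j\<close>;
        the powers of \<delta> then factor out of the bubble and cancel, and what remains has a
        visible limit.\<close>
      define Q where "Q j = (norm z)\<^sup>2 * k / (1 - (norm (x j))\<^sup>2) + 1" for j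
      have "Q \<longlonglongrightarrow> (norm z)\<^sup>2 * k / (1 - (norm y)\<^sup>2) + 1"
        unfolding Q_def using one_minus_norm_sq_pos[OF y] by (intro tendsto_intros x) auto
      also have "(norm z)\<^sup>2 * k / (1 - (norm y)\<^sup>2) + 1 = 1 + (norm (k *\<^sub>R z))\<^sup>2"
        by (simp add: k_def power_mult_distrib power_divide power2_eq_square)
      finally have Q: "Q \<longlonglongrightarrow> 1 + (norm (k *\<^sub>R z))\<^sup>2" .
      have P: "(\<lambda>j. (d j)\<^sup>2 * Q j) \<longlonglongrightarrow> 0"
        using tendsto_mult[OF tendsto_power[OF d0, of 2] Q] by simp
      have q0: "1 + (norm (k *\<^sub>R z))\<^sup>2 \<noteq> 0"
        using zero_le_power2[of "norm (k *\<^sub>R z)"] by linarith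
      have "(\<lambda>j. H (x j) * (Q j powr ?a * ((1 + (d j)\<^sup>2 * Q j) powr ?a *
          (1 + 2 * ((d j)\<^sup>2 * Q j) + 2 * ((d j)\<^sup>2 * Q j)\<^sup>2 - (d j)\<^sup>2 - 2 * (d j)\<^sup>2 * ((d j)\<^sup>2 * Q j)))))
        \<longlonglongrightarrow> H y * ((1 + (norm (k *\<^sub>R z))\<^sup>2) powr ?a * ((1 + 0) powr ?a * (1 + 2 * 0 + 2 * 0\<^sup>2 - 0\<^sup>2 - 2 * 0\<^sup>2 * 0)))"
        by (intro tendsto_intros P Q d0 isCont_tendsto_compose[OF c x]) (use q0 in simp_all)
      moreover have "\<forall>\<^sub>F j in sequentially. H (x j) * (Q j powr ?a * ((1 + (d j)\<^sup>2 * Q j) powr ?a *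
          (1 + 2 * ((d j)\<^sup>2 * Q j) + 2 * ((d j)\<^sup>2 * Q j)\<^sup>2 - (d j)\<^sup>2 - 2 * (d j)\<^sup>2 * ((d j)\<^sup>2 * Q j)))) = F j z"
      proof -
        have "\<forall>\<^sub>F j in sequentially. norm (x j) < 1"
          using tendsto_norm[OF x] y by (rule order_tendstoD(2))
        then show ?thesis
        proof eventually_elim
          case (elim j)
          have r: "1 - (norm (x j))\<^sup>2 > 0" using one_minus_norm_sq_pos[OF elim] .
          have Qp: "Q j > 0" using r k by (simp add: Q_def add_nonneg_pos)
          have "hyp_dist (x j) y = (d j)\<^sup>2 * ((norm z)\<^sup>2 * k / (1 - (norm (x j))\<^sup>2))"
            by (simp add: hyp_dist_def x_def power_mult_distrib k_def)
          then have pQ: "hyp_dist (x j) y + (d j)\<^sup>2 = (d j)\<^sup>2 * Q j" by (simp add: Q_def algebra_simps)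
          have "((d j)\<^sup>2 * Q j) powr ?a = d j powr (- real ?n - 2) * Q j powr ?a"
          proof -
            have "(d j)\<^sup>2 = d j powr 2" using d[of j] by (simp flip: powr_numeral)
            then have "((d j)\<^sup>2) powr ?a = d j powr (- real ?n - 2)" by (simp add: powr_powr algebra_simps)
            then show ?thesis by (simp add: powr_mult)
          qed
          moreover have "((d j)\<^sup>2 * Q j * (1 + (d j)\<^sup>2 * Q j)) powr ?a = ((d j)\<^sup>2 * Q j) powr ?a * (1 + (d j)\<^sup>2 * Q j) powr ?a"
            by (rule powr_mult)
          moreover have "d j ^ ?n * (d j)\<^sup>2 * d j powr (- real ?n - 2) = 1"
          proof -
            have "d j ^ ?n * (d j)\<^sup>2 * d j powr (- real ?n - 2) = d j powr (real ?n + 2 + (- real ?n - 2))"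
              using d[of j] by (simp only: powr_add powr_realpow[symmetric] of_nat_numeral)
            then show ?thesis using d[of j] by simp
          qed
          moreover have "dn * (h * (d2 * (dm * q * w) * v)) = h * (q * (w * v))"
            if "dn * d2 * dm = 1" for dn h d2 dm q w v :: real
          proof -
            have "dn * (h * (d2 * (dm * q * w) * v)) = (dn * d2 * dm) * (h * (q * (w * v)))" by (simp only: ac_simps)
            with that show ?thesis by simp
          qed
          ultimately show ?case
            unfolding F_def bubble_def x_def[symmetric] pQ by simp
        qed
      qed
      ultimately show "(\<lambda>j. F j z) \<longlonglongrightarrow> H y * (1 + (norm (k *\<^sub>R z))\<^sup>2) powr ?a"
        by (auto intro: Lim_transform_eventually)
    qed
  qed
  also have "(\<integral>z. H y * (1 + (norm (k *\<^sub>R (z::'a)))\<^sup>2) powr ?a \<partial>lborel) = H y * (\<integral>z. (1 + (norm (k *\<^sub>R (z::'a)))\<^sup>2) powr ?a \<partial>lborel)"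
    by (rule integral_mult_right_zero)
  also have "(\<integral>z. (1 + (norm (k *\<^sub>R (z::'a)))\<^sup>2) powr ?a \<partial>lborel) = unit_ball_vol ?n * (1 - (norm y)\<^sup>2) ^ ?n"
  proof -
    \<comment> \<open>The dilation by k puts the factor \<open>(1 - |y|^2)^n\<close> into the limit.
      It cancels the weight \<open>(1 - |x|^2)^(- n)\<close> inside the function H to which the
      lemma is applied.\<close>
    have "unit_ball_vol ?n = k ^ ?n * (\<integral>z. (1 + (norm (0 + k *\<^sub>R (z::'a)))\<^sup>2) powr ?a \<partial>lborel)"
      unfolding bubble_integrable(2)[symmetric, where 'a='a]
      by (rule lborel_integral_affine[OF _ k]) measurable
    then show ?thesis using one_minus_norm_sq_pos[OF y] by (simp add: k_def power_divide field_simps)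
  qed
  finally show ?thesis unfolding affine[symmetric] unfolding d_def by (simp only: ac_simps)
qed

section \<open>Integrability of the Green function and removal of the regularization\<close>

lemma compact_subset_unit_ball:
  fixes K :: "'a::euclidean_space set"
  assumes "compact K" "K \<subseteq> unit_ball"
  obtains R where "0 < R" "R < 1" "K \<subseteq> cball 0 R"
proof (cases "K = {}")
  case True
  then show ?thesis using that[of "1/2"] by simp
next
  case False
  obtain x where x: "x \<in> K" "\<And>y. y \<in> K \<Longrightarrow> norm y \<le> norm x"
    using continuous_attains_sup[OF assms(1) False, of norm] by (auto intro: continuous_intros)
  show ?thesis
    by (rule that[of "max (1/2) (norm x)"]) (use x assms(2) in \<open>auto simp: le_max_iff_disj\<close>)
qed

lemma borel_measurable_green_radial [measurable]: "green_radial n \<in> borel_measurable borel"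
  unfolding green_radial_def by measurable

text \<open>Two regimes for y. Near the sphere, y is at distance at least e from the ball of radius
  R, and the decay \<open>p^(- (n - 1))\<close> supplies the factor
  \<open>(1 - |y|^2)^(n - 1)\<close>. Elsewhere that factor is bounded below, and a uniform bound
  from the Riesz integral of the pole is enough.\<close>

lemma green_local_bound:
  assumes dim: "DIM('a::euclidean_space) \<ge> 2" and R: "0 < R" "R < 1"
  obtains C where "C \<ge> 0" "\<And>y::'a. norm y < 1 \<Longrightarrow>
    (\<integral>\<^sup>+x\<in>cball 0 R. green_function x y \<partial>lborel) \<le> ennreal (C * (1 - (norm y)\<^sup>2) ^ (DIM('a) - 1))"
proof -
  let ?n = "DIM('a)"
  let ?V = "unit_ball_vol ?n"
  \<comment> \<open>The pole has order \<open>n - 2\<close> in \<open>|x - y|\<close> and is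
    logarithmic for \<open>n = 2\<close>; any b with \<open>0 < b\<close>,
    \<open>n - 2 \<le> b\<close> and \<open>b < n\<close> would serve here. The same value suits the
    sphere later, where \<open>b < n - 1\<close> is required.\<close>
  define b where "b = real ?n - 3 / 2"
  have b: "b > 0" "b < real ?n" "real ?n / 2 - 1 \<le> b / 2" "b / 2 \<le> real ?n - 1"
    using dim by (auto simp: b_def)
  define R' where "R' = (1 + R) / 2"
  define e where "e = (1 - R) / 2"
  have R': "R < R'" "R' < 1" "0 < e" using R by (auto simp: R'_def e_def)
  define c1 where "c1 = 1 / (2 * real ?n * (real ?n - 1))"
  define c2 where "c2 = 1 / (2 * real ?n * (b / 2))"
  have c: "c1 \<ge> 0" "c2 \<ge> 0" using b dim by (auto simp: c1_def c2_def)
  have G1: "green_radial ?n p \<le> c1 * (1 / p) ^ (?n - 1)" if "p > 0" for p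
  proof -
    have "p powr - (real ?n - 1) = (1 / p) ^ (?n - 1)"
    proof -
      have "real ?n - 1 = real (?n - 1)" using dim by (simp add: of_nat_diff)
      then show ?thesis using that by (simp only: powr_minus_divide powr_realpow power_one_over)
    qed
    then show ?thesis using green_radial_le_powr[OF dim that, of "real ?n - 1"] dim by (simp add: c1_def)
  qed
  have G2: "green_radial ?n p \<le> c2 * p powr - (b / 2)" if "p > 0" for p
    using green_radial_le_powr[OF dim that, of "b / 2"] b by (simp add: c2_def)
  define C3 where "C3 = ?V * 2 powr b / (1 - 2 powr (b - real ?n)) * 2 powr (real ?n - b)"
  have q: "2 powr (b - real ?n) < 1" using b by (intro powr_less_one) auto
  have C3: "C3 \<ge> 0" unfolding C3_def using q by simp
  have riesz: "(\<integral>\<^sup>+x\<in>ball y 2. ennreal (norm (x - y) powr - b) \<partial>lborel) \<le> ennreal C3" for y :: 'a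
    unfolding C3_def
    by (rule nn_integral_riesz_le) (use b in \<open>auto simp: emeasure_ball powr_realpow\<close>)
  define C where "C = max (c1 * (1 / e\<^sup>2) ^ (?n - 1) * (?V * R ^ ?n)) (c2 * C3 / (1 - R'\<^sup>2) ^ (?n - 1))"
  have R'1: "0 < 1 - R'\<^sup>2" using R' R by (simp add: abs_square_less_1)
  have C: "C \<ge> 0" using c C3 R'1 by (simp add: C_def le_max_iff_disj)
  show ?thesis
  proof (rule that[OF C])
    fix y :: 'a assume y: "norm y < 1"
    let ?r = "1 - (norm y)\<^sup>2"
    have r: "?r > 0" using one_minus_norm_sq_pos[OF y] .
    show "(\<integral>\<^sup>+x\<in>cball 0 R. green_function x y \<partial>lborel) \<le> ennreal (C * ?r ^ (?n - 1))"
    proof (cases "norm y \<ge> R'")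
      case True
      have "(\<integral>\<^sup>+x\<in>cball 0 R. green_function x y \<partial>lborel) \<le>
        (\<integral>\<^sup>+x. ennreal (c1 * (?r / e\<^sup>2) ^ (?n - 1)) * indicator (cball 0 R) x \<partial>(lborel :: 'a measure))"
      proof (rule nn_integral_mono)
        fix x :: 'a
        show "green_function x y * indicator (cball 0 R) x \<le> ennreal (c1 * (?r / e\<^sup>2) ^ (?n - 1)) * indicator (cball 0 R) x"
        proof (cases "x \<in> cball 0 R")
          case x: True
          have x1: "norm x < 1" using x R by simp
          have xy: "e \<le> norm (x - y)" using x True norm_triangle_ineq3[of y x] R' by (simp add: e_def R'_def norm_minus_commute)
          then have "x \<noteq> y" using R' by auto
          have e2: "e\<^sup>2 \<le> (norm (x - y))\<^sup>2" using xy R' by (intro power_mono) auto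
          have p0: "hyp_dist x y > 0" by (rule hyp_dist_pos[OF x1 y \<open>x \<noteq> y\<close>])
          have "1 / hyp_dist x y = (1 - (norm x)\<^sup>2) * ?r / (norm (x - y))\<^sup>2" by (simp add: hyp_dist_def)
          also have "\<dots> \<le> 1 * ?r / e\<^sup>2"
            using r R' e2 one_minus_norm_sq_pos[OF x1] by (intro frac_le mult_mono) auto
          finally have "(1 / hyp_dist x y) ^ (?n - 1) \<le> (?r / e\<^sup>2) ^ (?n - 1)"
            using p0 by (intro power_mono) auto
          then have "green_radial ?n (hyp_dist x y) \<le> c1 * (?r / e\<^sup>2) ^ (?n - 1)"
            using G1[OF p0] mult_left_mono[OF _ c(1)] by (meson order_trans)
          then show ?thesis
            using green_function_eq_radial[OF x1 y \<open>x \<noteq> y\<close>] x by (simp add: ennreal_leI)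
        qed simp
      qed
      also have "\<dots> = ennreal (c1 * (?r / e\<^sup>2) ^ (?n - 1)) * ennreal (?V * R ^ ?n)"
        using R by (subst nn_integral_cmult_indicator) (auto simp: emeasure_cball)
      also have "\<dots> = ennreal (c1 * (1 / e\<^sup>2) ^ (?n - 1) * (?V * R ^ ?n) * ?r ^ (?n - 1))"
        using c r R R' by (simp add: ennreal_mult'[symmetric] power_divide ac_simps)
      also have "\<dots> \<le> ennreal (C * ?r ^ (?n - 1))"
        using r by (intro ennreal_leI mult_right_mono) (auto simp: C_def)
      finally show ?thesis .
    next
      case False
      have "(\<integral>\<^sup>+x\<in>cball 0 R. green_function x y \<partial>lborel) \<le>
        (\<integral>\<^sup>+x. ennreal c2 * (ennreal (norm (x - y) powr - b) * indicator (ball y 2) x) \<partial>(lborel :: 'a measure))"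
      proof (rule nn_integral_mono_AE)
        show "AE x in lborel. green_function x y * indicator (cball 0 R) x \<le> ennreal c2 * (ennreal (norm (x - y) powr - b) * indicator (ball y 2) x)"
          using AE_lborel_singleton[of y]
        proof eventually_elim
          case (elim x)
          show ?case
          proof (cases "x \<in> cball 0 R")
            case x: True
            have x1: "norm x < 1" using x R by simp
            have p0: "hyp_dist x y > 0" by (rule hyp_dist_pos[OF x1 y elim])
            have "green_radial ?n (hyp_dist x y) \<le> c2 * hyp_dist x y powr - (b / 2)" by (rule G2[OF p0])
            also have "hyp_dist x y powr - (b / 2) \<le> ((norm (x - y))\<^sup>2) powr - (b / 2)"
              using norm_sq_le_hyp_dist[OF x1 y] elim b by (intro powr_mono2') auto
            also have "((norm (x - y))\<^sup>2) powr - (b / 2) = norm (x - y) powr - b"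
            proof -
              have "(norm (x - y))\<^sup>2 = norm (x - y) powr 2" using elim by (simp flip: powr_numeral)
              then show ?thesis by (simp only: powr_powr) simp
            qed
            finally have "green_radial ?n (hyp_dist x y) \<le> c2 * norm (x - y) powr - b" using c by (simp add: mult_left_mono)
            moreover have "dist y x < 2" using x1 y norm_triangle_ineq4[of y x] by (simp add: dist_norm)
            ultimately show ?thesis
              using green_function_eq_radial[OF x1 y elim] x c by (simp add: ennreal_leI ennreal_mult[symmetric])
          qed simp
        qed
      qed
      also have "\<dots> = ennreal c2 * (\<integral>\<^sup>+x\<in>ball y 2. ennreal (norm (x - y) powr - b) \<partial>lborel)"
        by (rule nn_integral_cmult) (intro borel_measurable_times_ennreal borel_measurable_indicator; measurable)
      also have "\<dots> \<le> ennreal c2 * ennreal C3" by (intro mult_left_mono riesz) auto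
      also have "\<dots> = ennreal (c2 * C3 / (1 - R'\<^sup>2) ^ (?n - 1) * (1 - R'\<^sup>2) ^ (?n - 1))"
        using c C3 R'1 by (simp add: ennreal_mult[symmetric])
      also have "\<dots> \<le> ennreal (C * ?r ^ (?n - 1))"
      proof (intro ennreal_leI mult_mono power_mono)
        have "(norm y)\<^sup>2 \<le> R'\<^sup>2" using False by (intro power_mono) auto
        then show "1 - R'\<^sup>2 \<le> ?r" by simp
      qed (use R'1 C in \<open>auto simp: C_def\<close>)
      finally show ?thesis .
    qed
  qed
qed

text \<open>Up to the volume of the unit ball, the density of
  \<open>\<Delta>\<^sub>h \<psi> d\<tau>\<close> with respect to Lebesgue measure. It is cut off
  outside the ball, where \<psi> is unconstrained.\<close>

definition laplacian_density :: "('a::euclidean_space \<Rightarrow> real) \<Rightarrow> 'a \<Rightarrow> real" where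
  "laplacian_density \<psi> x = indicator unit_ball x * (hyperbolic_laplacian \<psi> x / (1 - (norm x)\<^sup>2) ^ DIM('a))"

lemma borel_measurable_continuous_on_ball:
  fixes f :: "'a::euclidean_space \<Rightarrow> real"
  assumes "continuous_on unit_ball f"
  shows "(\<lambda>x. indicator unit_ball x * f x) \<in> borel_measurable borel"
  using borel_measurable_continuous_on_indicator[OF _ assms] by simp

lemma C2c_ball_continuous_quotient:
  fixes \<psi> :: "'a::euclidean_space \<Rightarrow> real"
  assumes psi: "\<psi> \<in> C2c_ball"
  shows "continuous_on unit_ball \<psi>"
    and "continuous_on unit_ball (\<lambda>x. hyperbolic_laplacian \<psi> x / (1 - (norm x)\<^sup>2) ^ m)"
    and "continuous_on unit_ball (\<lambda>x. \<psi> x / (1 - (norm x)\<^sup>2) ^ m)"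
proof -
  have C2: "C2_on unit_ball \<psi>" using psi by (simp add: C2c_ball_def)
  then show cpsi: "continuous_on unit_ball \<psi>" by (auto simp: C2_on_def intro: C1_on_continuous)
  have one: "1 - (norm x)\<^sup>2 \<noteq> 0" if "x \<in> unit_ball" for x :: 'a
    using one_minus_norm_sq_pos[of x] that by auto
  show "continuous_on unit_ball (\<lambda>x. hyperbolic_laplacian \<psi> x / (1 - (norm x)\<^sup>2) ^ m)"
    by (intro continuous_intros C2_on_continuous_laplacian C2) (use one in auto)
  show "continuous_on unit_ball (\<lambda>x. \<psi> x / (1 - (norm x)\<^sup>2) ^ m)"
    by (intro continuous_intros cpsi) (use one in auto)
qed

lemma borel_measurable_C2c_ball:
  fixes \<psi> :: "'a::euclidean_space \<Rightarrow> real"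
  assumes psi: "\<psi> \<in> C2c_ball"
  shows "(\<lambda>x. indicator unit_ball x * \<psi> x) \<in> borel_measurable borel"
    and "laplacian_density \<psi> \<in> borel_measurable borel"
  unfolding laplacian_density_def[abs_def]
  by (rule borel_measurable_continuous_on_ball[OF C2c_ball_continuous_quotient(1)[OF psi]]
      borel_measurable_continuous_on_ball[OF C2c_ball_continuous_quotient(2)[OF psi]])+

lemma C2c_ball_bounds:
  fixes \<psi> :: "'a::euclidean_space \<Rightarrow> real"
  assumes psi: "\<psi> \<in> C2c_ball"
  obtains R B where "0 < R" "R < 1" "B \<ge> 0"
    "\<And>x. \<bar>laplacian_density \<psi> x\<bar> \<le> B * indicator (cball 0 R) x"
    "\<And>x. \<bar>indicator unit_ball x * (\<psi> x / (1 - (norm x)\<^sup>2) ^ DIM('a))\<bar> \<le> B * indicator (cball 0 R) x"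
proof -
  let ?n = "DIM('a)"
  obtain K where K: "compact K" "K \<subseteq> unit_ball"
    "\<And>x. x \<in> unit_ball \<Longrightarrow> x \<notin> K \<Longrightarrow> \<psi> x = 0"
    "\<And>x. x \<in> unit_ball \<Longrightarrow> x \<notin> K \<Longrightarrow> hyperbolic_laplacian \<psi> x = 0"
    using C2c_ballD[OF psi] by metis
  obtain R where R: "0 < R" "R < 1" "K \<subseteq> cball 0 R"
    using compact_subset_unit_ball[OF K(1,2)] by metis
  have sub: "cball 0 R \<subseteq> (unit_ball :: 'a set)" using R by auto
  note c = C2c_ball_continuous_quotient(2,3)[OF psi, of ?n]
  have bd: "\<exists>B\<ge>0. \<forall>x. \<bar>indicator unit_ball x * f x\<bar> \<le> B * indicator (cball 0 R) x"
    if f: "continuous_on unit_ball f" "\<And>x. x \<in> unit_ball \<Longrightarrow> x \<notin> K \<Longrightarrow> f x = 0" for f :: "'a \<Rightarrow> real"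
  proof -
    have "bounded (f ` cball 0 R)"
      using sub f(1) by (intro compact_imp_bounded compact_continuous_image compact_cball) (blast intro: continuous_on_subset)
    then obtain B where B: "\<forall>x\<in>cball 0 R. \<bar>f x\<bar> \<le> B" by (auto simp: bounded_iff)
    have "\<bar>indicator unit_ball x * f x\<bar> \<le> max B 0 * indicator (cball 0 R) x" for x
    proof (cases "x \<in> cball 0 R")
      case True
      then have "\<bar>f x\<bar> \<le> max B 0" using B by (auto simp: le_max_iff_disj)
      with True sub show ?thesis by (auto simp: indicator_def)
    next
      case False
      then have "x \<notin> K" using R by auto
      then show ?thesis using f(2)[of x] by (auto simp: indicator_def)
    qed
    then show ?thesis by (intro exI[of _ "max B 0"]) auto
  qed
  obtain B1 where B1: "B1 \<ge> 0" "\<And>x. \<bar>laplacian_density \<psi> x\<bar> \<le> B1 * indicator (cball 0 R) x"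
    using bd[OF c(1)] K(4) by (auto simp: laplacian_density_def)
  obtain B2 where B2: "\<And>x. \<bar>indicator unit_ball x * (\<psi> x / (1 - (norm x)\<^sup>2) ^ ?n)\<bar> \<le> B2 * indicator (cball 0 R) x"
    using bd[OF c(2)] K(3) by auto
  show thesis
  proof (rule that[OF R(1,2), of "max B1 B2"])
    show "max B1 B2 \<ge> 0" using B1(1) by simp
    have "B1 * indicator (cball 0 R) x \<le> max B1 B2 * indicator (cball 0 R) x"
      "B2 * indicator (cball 0 R) x \<le> max B1 B2 * indicator (cball 0 R) x" for x :: 'a
      by (intro mult_right_mono; simp)+
    then show "\<bar>laplacian_density \<psi> x\<bar> \<le> max B1 B2 * indicator (cball 0 R) x"
      "\<bar>indicator unit_ball x * (\<psi> x / (1 - (norm x)\<^sup>2) ^ ?n)\<bar> \<le> max B1 B2 * indicator (cball 0 R) x" for x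
      using B1(2) B2 by (blast intro: order_trans)+
  qed
qed

text \<open>The regularized identity in the limit. On the left \<open>green_radial\<close> decreases
  in p, so the unshifted kernel is a majorant, integrable by the local bound; on the right the
  bubbles concentrate at y. The volume of the unit ball is the mass of the bubble, and it disappears
  later with the normalization of \<nu>.\<close>

lemma green_weak_identity:
  fixes \<psi> :: "'a::euclidean_space \<Rightarrow> real"
  assumes dim: "DIM('a) \<ge> 2" and psi: "\<psi> \<in> C2c_ball" and y: "norm y < 1"
  shows "(\<integral>x. enn2real (green_function x y) * laplacian_density \<psi> x \<partial>lborel) = - (unit_ball_vol (DIM('a)) * \<psi> y)"
proof -
  let ?n = "DIM('a)" and ?V = "unit_ball_vol (DIM('a))"
  obtain R B where RB: "0 < R" "R < 1" "B \<ge> 0" "\<And>x. \<bar>laplacian_density \<psi> x\<bar> \<le> B * indicator (cball 0 R) x"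
    "\<And>x. \<bar>indicator unit_ball x * (\<psi> x / (1 - (norm x)\<^sup>2) ^ DIM('a))\<bar> \<le> B * indicator (cball 0 R) x"
    by (rule C2c_ball_bounds[OF psi]) (rule that; assumption)
  note mpL = borel_measurable_C2c_ball[OF psi]
  note [measurable] = mpL
  let ?L = "laplacian_density \<psi>"
  have L0: "?L x = 0" if "norm x \<ge> 1" for x using RB(4)[of x] RB(2) that by simp
  obtain C where C: "C \<ge> 0" "\<And>y::'a. norm y < 1 \<Longrightarrow>
    (\<integral>\<^sup>+x\<in>cball 0 R. green_function x y \<partial>lborel) \<le> ennreal (C * (1 - (norm y)\<^sup>2) ^ (DIM('a) - 1))"
    by (rule green_local_bound[OF dim RB(1,2)]) (rule that; assumption)
  let ?e = "\<lambda>j. (1 / real (Suc (Suc j)))\<^sup>2"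
  have e: "?e j > 0" for j by simp
  have e0: "?e \<longlonglongrightarrow> 0"
    using tendsto_power[OF LIMSEQ_Suc[OF LIMSEQ_inverse_real_of_nat], of 2] by (simp add: inverse_eq_divide)
  let ?w = "\<lambda>x. green_radial ?n (hyp_dist x y) * \<bar>?L x\<bar>"
  have w: "integrable lborel ?w"
  proof (rule integrableI_bounded)
    have "(\<integral>\<^sup>+x. ennreal (norm (?w x)) \<partial>lborel) \<le> (\<integral>\<^sup>+x. ennreal B * (green_function x y * indicator (cball 0 R) x) \<partial>lborel)"
    proof (rule nn_integral_mono_AE)
      show "AE x in lborel. ennreal (norm (?w x)) \<le> ennreal B * (green_function x y * indicator (cball 0 R) x)"
        using AE_lborel_singleton[of y]
      proof eventually_elim
        case (elim x)
        show ?case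
        proof (cases "x \<in> cball 0 R")
          case True
          have x1: "norm x < 1" using True RB(2) by simp
          have "?w x \<le> green_radial ?n (hyp_dist x y) * B"
            using RB(4)[of x] True by (intro mult_left_mono green_radial_nonneg) simp
          then have "ennreal (norm (?w x)) \<le> ennreal (B * green_radial ?n (hyp_dist x y))"
            by (intro ennreal_leI) (simp add: green_radial_nonneg abs_mult mult.commute)
          then show ?thesis
            using True RB(3) by (simp add: green_function_eq_radial[OF x1 y elim] ennreal_mult green_radial_nonneg)
        next
          case False
          then show ?thesis using RB(4)[of x] by simp
        qed
      qed
    qed
    also have "\<dots> = ennreal B * (\<integral>\<^sup>+x\<in>cball 0 R. green_function x y \<partial>lborel)"
      by (rule nn_integral_cmult) (intro borel_measurable_times_ennreal borel_measurable_indicator; measurable)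
    also have "\<dots> \<le> ennreal B * ennreal (C * (1 - (norm y)\<^sup>2) ^ (DIM('a) - 1))"
      by (intro mult_left_mono C y) simp
    also have "\<dots> < \<infinity>" by (simp add: ennreal_mult_less_top)
    finally show "(\<integral>\<^sup>+x. ennreal (norm (?w x)) \<partial>lborel) < \<infinity>" .
  qed measurable
  have lim1: "(\<lambda>j. \<integral>x. green_radial ?n (hyp_dist x y + ?e j) * ?L x \<partial>lborel) \<longlonglongrightarrow> (\<integral>x. green_radial ?n (hyp_dist x y) * ?L x \<partial>lborel)"
  proof (rule integral_dominated_convergence[OF _ _ w])
    show "AE x in lborel. (\<lambda>j. green_radial ?n (hyp_dist x y + ?e j) * ?L x) \<longlonglongrightarrow> green_radial ?n (hyp_dist x y) * ?L x"
      using AE_lborel_singleton[of y]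
    proof eventually_elim
      case (elim x)
      show ?case
      proof (cases "norm x < 1")
        case True
        have "isCont (green_radial ?n) (hyp_dist x y)"
          by (rule DERIV_isCont[OF DERIV_green_radial[OF dim hyp_dist_pos[OF True y elim]]])
        moreover have "(\<lambda>j. hyp_dist x y + ?e j) \<longlonglongrightarrow> hyp_dist x y"
          using tendsto_add[OF tendsto_const e0, of "hyp_dist x y"] by simp
        ultimately show ?thesis by (rule tendsto_mult[OF isCont_tendsto_compose tendsto_const])
      qed (simp add: L0)
    qed
    show "AE x in lborel. norm (green_radial ?n (hyp_dist x y + ?e j) * ?L x) \<le> ?w x" for j
      using AE_lborel_singleton[of y]
    proof eventually_elim
      case (elim x)
      show ?case
      proof (cases "norm x < 1")
        case True
        have "green_radial ?n (hyp_dist x y + ?e j) \<le> green_radial ?n (hyp_dist x y)"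
          by (rule green_radial_antimono[OF dim hyp_dist_pos[OF True y elim]]) simp
        then show ?thesis by (simp add: abs_mult green_radial_nonneg mult_right_mono)
      qed (simp add: L0)
    qed
  qed measurable
  define H where "H x = indicator unit_ball x * (\<psi> x / (1 - (norm x)\<^sup>2) ^ ?n)" for x
  have reg: "(\<integral>x. green_radial ?n (hyp_dist x y + ?e j) * ?L x \<partial>lborel) = - (\<integral>x. H x * bubble ?n (?e j) (hyp_dist x y) \<partial>lborel)" for j
    using green_regularized_identity[OF dim psi y e[of j]]
    by (simp add: laplacian_density_def H_def mult_ac)
  have Hy: "H y = \<psi> y / (1 - (norm y)\<^sup>2) ^ ?n" using y by (simp add: H_def)
  have "(\<lambda>j. \<integral>x. H x * bubble ?n (?e j) (hyp_dist x y) \<partial>lborel) \<longlonglongrightarrow> ?V * (1 - (norm y)\<^sup>2) ^ ?n * H y"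
  proof (rule bubble_approximate_identity[OF dim y])
    have "(\<lambda>x. (indicator unit_ball x * \<psi> x) / (1 - (norm x)\<^sup>2) ^ ?n) \<in> borel_measurable borel" by measurable
    then show "H \<in> borel_measurable borel" by (simp add: H_def[abs_def])
    show "\<bar>H x\<bar> \<le> B" for x
      using RB(5)[of x] mult_left_mono[OF indicator_le_1 RB(3), of "cball 0 R" x] by (simp add: H_def)
    show "H x = 0" if "norm x \<ge> 1" for x using that by (simp add: H_def)
    have "continuous_on unit_ball (\<lambda>x. \<psi> x / (1 - (norm x)\<^sup>2) ^ ?n)"
      by (rule C2c_ball_continuous_quotient(3)[OF psi])
    then have "continuous_on unit_ball H"
      by (rule continuous_on_eq) (simp add: H_def)
    then show "isCont H y" using y by (simp add: continuous_on_eq_continuous_at)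
  qed
  also have "?V * (1 - (norm y)\<^sup>2) ^ ?n * H y = ?V * \<psi> y"
    using one_minus_norm_sq_pos[OF y] by (simp add: Hy)
  finally have "(\<lambda>j. \<integral>x. green_radial ?n (hyp_dist x y + ?e j) * ?L x \<partial>lborel) \<longlonglongrightarrow> - (?V * \<psi> y)"
    unfolding reg by (rule tendsto_minus)
  from LIMSEQ_unique[OF lim1 this] have "(\<integral>x. green_radial ?n (hyp_dist x y) * ?L x \<partial>lborel) = - (?V * \<psi> y)" .
  moreover have "(\<integral>x. enn2real (green_function x y) * ?L x \<partial>lborel) = (\<integral>x. green_radial ?n (hyp_dist x y) * ?L x \<partial>lborel)"
  proof (rule integral_cong_AE)
    show "AE x in lborel. enn2real (green_function x y) * ?L x = green_radial ?n (hyp_dist x y) * ?L x"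
      using AE_lborel_singleton[of y]
    proof eventually_elim
      case (elim x)
      show ?case
      proof (cases "norm x < 1")
        case True
        then show ?thesis using green_function_eq_radial[OF True y elim] by (simp add: green_radial_nonneg)
      qed (simp add: L0)
    qed
  qed measurable
  ultimately show ?thesis by simp
qed

subsection \<open>The weak equation\<close>

lemma Fubini_lborel:
  fixes k :: "'a::euclidean_space \<Rightarrow> 'b::euclidean_space \<Rightarrow> real" and N :: "'b measure"
  assumes "sigma_finite_measure N" and sN [measurable_cong]: "sets N = sets borel"
    and mk [measurable]: "case_prod k \<in> borel_measurable (borel \<Otimes>\<^sub>M borel)"
    and fin: "(\<integral>\<^sup>+y. (\<integral>\<^sup>+x. ennreal \<bar>k x y\<bar> \<partial>lborel) \<partial>N) < \<infinity>"
  shows "integrable lborel (\<lambda>x. \<integral>y. k x y \<partial>N)"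
    and "(\<integral>x. (\<integral>y. k x y \<partial>N) \<partial>lborel) = (\<integral>y. (\<integral>x. k x y \<partial>lborel) \<partial>N)"
    and "integrable N (\<lambda>y. \<integral>x. k x y \<partial>lborel)"
proof -
  interpret N: sigma_finite_measure N by fact
  interpret P: pair_sigma_finite "lborel :: 'a measure" N ..
  have m: "case_prod k \<in> borel_measurable (lborel \<Otimes>\<^sub>M N)"
    using mk by (simp add: measurable_cong_sets[OF sets_pair_measure_cong[OF sets_lborel sN] refl])
  have int: "integrable (lborel \<Otimes>\<^sub>M N) (case_prod k)"
  proof (rule integrableI_bounded[OF m])
    have m2: "(\<lambda>(x, y). ennreal \<bar>k x y\<bar>) \<in> borel_measurable (lborel \<Otimes>\<^sub>M N)"
      using measurable_compose[OF m, of "\<lambda>z. ennreal \<bar>z\<bar>" borel] by (simp add: case_prod_unfold)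
    have "(\<integral>\<^sup>+p. ennreal (norm (case_prod k p)) \<partial>(lborel \<Otimes>\<^sub>M N)) = (\<integral>\<^sup>+x. (\<integral>\<^sup>+y. ennreal \<bar>k x y\<bar> \<partial>N) \<partial>lborel)"
      using N.nn_integral_fst[OF m2] by (simp add: case_prod_unfold)
    also have "\<dots> = (\<integral>\<^sup>+y. (\<integral>\<^sup>+x. ennreal \<bar>k x y\<bar> \<partial>lborel) \<partial>N)"
      by (rule P.Fubini'[OF m2, symmetric])
    finally show "(\<integral>\<^sup>+p. ennreal (norm (case_prod k p)) \<partial>(lborel \<Otimes>\<^sub>M N)) < \<infinity>" using fin by simp
  qed
  show "integrable lborel (\<lambda>x. \<integral>y. k x y \<partial>N)" using P.integrable_fst[OF int] .
  show "integrable N (\<lambda>y. \<integral>x. k x y \<partial>lborel)" using P.integrable_snd[OF int] .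
  show "(\<integral>x. (\<integral>y. k x y \<partial>N) \<partial>lborel) = (\<integral>y. (\<integral>x. k x y \<partial>lborel) \<partial>N)"
    using P.Fubini_integral[OF int] by simp
qed

lemma borel_measurable_enn2real_id: "enn2real \<in> borel_measurable borel"
  by measurable

text \<open>The measure may have infinite mass, but by Markov's inequality the part of the ball
  where the weight is at least \<open>1 / k\<close> has finite measure, and these parts exhaust the
  ball. The applications of Fubini's theorem rest on this.\<close>

lemma sigma_finite_weighted:
  fixes M :: "'a::euclidean_space measure"
  assumes sM: "sets M = sets borel" and ae: "AE y in M. norm y < 1"
    and fin: "(\<integral>\<^sup>+y. ennreal ((1 - (norm y)\<^sup>2) ^ m) \<partial>M) < \<infinity>"
  shows "sigma_finite_measure M"
proof
  have sp: "space M = UNIV" using sM by (metis sets_eq_imp_space_eq space_borel)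
  define A where "A k = {y::'a. norm y < 1 \<and> 1 \<le> real k * (1 - (norm y)\<^sup>2) ^ m}" for k :: nat
  have mA: "A k \<in> sets M" for k
    unfolding A_def sM by measurable
  have mf: "(\<lambda>y. ennreal ((1 - (norm y)\<^sup>2) ^ m)) \<in> borel_measurable M"
    unfolding measurable_cong_sets[OF sM refl] by measurable
  have fA: "emeasure M (A k) \<noteq> \<infinity>" for k
  proof -
    have "emeasure M (A k) = (\<integral>\<^sup>+y. indicator (A k) y \<partial>M)" using mA by simp
    also have "\<dots> \<le> (\<integral>\<^sup>+y. ennreal (real k) * ennreal ((1 - (norm y)\<^sup>2) ^ m) \<partial>M)"
    proof (rule nn_integral_mono)
      fix y
      show "indicator (A k) y \<le> ennreal (real k) * ennreal ((1 - (norm y)\<^sup>2) ^ m)"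
      proof (cases "y \<in> A k")
        case True
        then have "ennreal 1 \<le> ennreal (real k * (1 - (norm y)\<^sup>2) ^ m)" by (intro ennreal_leI) (simp add: A_def)
        with True show ?thesis by (simp add: ennreal_mult')
      qed simp
    qed
    also have "\<dots> = ennreal (real k) * (\<integral>\<^sup>+y. ennreal ((1 - (norm y)\<^sup>2) ^ m) \<partial>M)"
      using mf by (rule nn_integral_cmult)
    also have "\<dots> < \<infinity>" using fin by (simp add: ennreal_mult_less_top)
    finally show ?thesis by simp
  qed
  have mB: "- unit_ball \<in> sets M" by (simp add: sM)
  have fB: "emeasure M (- unit_ball) = 0"
    using ae mB by (subst (asm) AE_iff_measurable[of "- unit_ball"]) (auto simp: sp)
  have cover: "\<exists>k. y \<in> A k" if "norm y < 1" for y
  proof -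
    have "(1 - (norm y)\<^sup>2) ^ m > 0" using one_minus_norm_sq_pos[OF that] by simp
    then obtain k where "1 < real k * (1 - (norm y)\<^sup>2) ^ m" using ex_less_of_nat_mult by blast
    then show ?thesis using that by (auto simp: A_def intro!: exI[of _ k])
  qed
  show "\<exists>A. countable A \<and> A \<subseteq> sets M \<and> \<Union>A = space M \<and> (\<forall>a\<in>A. emeasure M a \<noteq> \<infinity>)"
  proof (intro exI conjI)
    show "countable (insert (- unit_ball) (range A))" by simp
    show "insert (- unit_ball) (range A) \<subseteq> sets M" using mA mB by auto
    show "\<Union> (insert (- unit_ball) (range A)) = space M"
    proof -
      have "y \<in> \<Union> (insert (- unit_ball) (range A))" for y
        using cover[of y] by (cases "norm y < 1") auto
      then show ?thesis unfolding sp by blast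
    qed
    show "\<forall>a\<in>insert (- unit_ball) (range A). emeasure M a \<noteq> \<infinity>" using fA fB by auto
  qed
qed

lemma green_potential_local_bound:
  fixes M :: "'a::euclidean_space measure"
  assumes dim: "DIM('a) \<ge> 2" and sM: "sets M = sets borel" and ae: "AE y in M. norm y < 1"
    and fin: "(\<integral>\<^sup>+y. ennreal ((1 - (norm y)\<^sup>2) ^ (DIM('a) - 1)) \<partial>M) < \<infinity>"
    and R: "0 < R" "R < 1"
  shows "(\<integral>\<^sup>+y. (\<integral>\<^sup>+x\<in>cball 0 R. green_function x y \<partial>lborel) \<partial>M) < \<infinity>"
proof -
  obtain C where C: "C \<ge> 0" "\<And>y::'a. norm y < 1 \<Longrightarrow>
    (\<integral>\<^sup>+x\<in>cball 0 R. green_function x y \<partial>lborel) \<le> ennreal (C * (1 - (norm y)\<^sup>2) ^ (DIM('a) - 1))"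
    by (rule green_local_bound[OF dim R]) (rule that; assumption)
  have mf: "(\<lambda>y. ennreal ((1 - (norm y)\<^sup>2) ^ (DIM('a) - 1))) \<in> borel_measurable M"
    unfolding measurable_cong_sets[OF sM refl] by measurable
  have "(\<integral>\<^sup>+y. (\<integral>\<^sup>+x\<in>cball 0 R. green_function x y \<partial>lborel) \<partial>M) \<le>
    (\<integral>\<^sup>+y. ennreal C * ennreal ((1 - (norm y)\<^sup>2) ^ (DIM('a) - 1)) \<partial>M)"
    using ae by (intro nn_integral_mono_AE) (use C in \<open>auto elim!: eventually_mono simp: ennreal_mult'\<close>)
  also have "\<dots> = ennreal C * (\<integral>\<^sup>+y. ennreal ((1 - (norm y)\<^sup>2) ^ (DIM('a) - 1)) \<partial>M)"
    using mf by (rule nn_integral_cmult)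
  also have "\<dots> < \<infinity>" using fin by (simp add: ennreal_mult_less_top)
  finally show ?thesis .
qed

lemma measurable_green_cball:
  "(\<lambda>(x, y). green_function x y * indicator (cball 0 R) x) \<in> borel_measurable (borel \<Otimes>\<^sub>M (borel :: 'a::euclidean_space measure))"
proof -
  have "(indicator (cball 0 R) :: 'a \<Rightarrow> ennreal) \<in> borel_measurable borel"
    by (rule borel_measurable_indicator) simp
  then have "(\<lambda>p. green_function (fst p) (snd p) * indicator (cball 0 R) (fst p)) \<in> borel_measurable (borel \<Otimes>\<^sub>M (borel :: 'a measure))"
    by (intro borel_measurable_times_ennreal borel_measurable_green_function measurable_compose[OF measurable_fst]) auto
  then show ?thesis by (simp add: case_prod_unfold)
qed

text \<open>By Tonelli and the local bound the potential is integrable over each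
  \<open>cball 0 (R k)\<close>, hence finite at almost every point there, and these balls exhaust
  the open ball.\<close>

lemma AE_green_potential_finite:
  fixes M :: "'a::euclidean_space measure"
  assumes dim: "DIM('a) \<ge> 2" and sM: "sets M = sets borel" and ae: "AE y in M. norm y < 1"
    and fin: "(\<integral>\<^sup>+y. ennreal ((1 - (norm y)\<^sup>2) ^ (DIM('a) - 1)) \<partial>M) < \<infinity>"
  shows "AE x in lborel. norm x < 1 \<longrightarrow> (\<integral>\<^sup>+y. green_function x y \<partial>M) \<noteq> \<infinity>"
proof -
  interpret M: sigma_finite_measure M by (rule sigma_finite_weighted[OF sM ae fin])
  interpret P: pair_sigma_finite "lborel :: 'a measure" M ..
  define R where "R k = 1 - 1 / real (Suc (Suc k))" for k
  have R: "0 < R k" "R k < 1" for k by (auto simp: R_def)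
  have "AE x in lborel. x \<in> cball 0 (R k) \<longrightarrow> (\<integral>\<^sup>+y. green_function x y \<partial>M) \<noteq> \<infinity>" for k
  proof -
    have m: "(\<lambda>(x, y). green_function x y * indicator (cball 0 (R k)) x) \<in> borel_measurable (lborel \<Otimes>\<^sub>M M)"
      using measurable_green_cball[of "R k", where 'a='a] by (simp add: measurable_cong_sets[OF sets_pair_measure_cong[OF sets_lborel sM] refl])
    have "(\<integral>\<^sup>+x. (\<integral>\<^sup>+y. green_function x y * indicator (cball 0 (R k)) x \<partial>M) \<partial>lborel) =
       (\<integral>\<^sup>+y. (\<integral>\<^sup>+x\<in>cball 0 (R k). green_function x y \<partial>lborel) \<partial>M)"
      by (rule P.Fubini'[OF m, symmetric])
    also have "\<dots> < \<infinity>" by (rule green_potential_local_bound[OF dim sM ae fin R])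
    finally have "AE x in lborel. (\<integral>\<^sup>+y. green_function x y * indicator (cball 0 (R k)) x \<partial>M) \<noteq> \<infinity>"
      using M.borel_measurable_nn_integral_fst[OF m] by (intro nn_integral_PInf_AE) auto
    then show ?thesis by eventually_elim auto
  qed
  then have "\<forall>k. AE x in lborel. x \<in> cball 0 (R k) \<longrightarrow> (\<integral>\<^sup>+y. green_function x y \<partial>M) \<noteq> \<infinity>"
    by blast
  then have "AE x in lborel. \<forall>k. x \<in> cball 0 (R k) \<longrightarrow> (\<integral>\<^sup>+y. green_function x y \<partial>M) \<noteq> \<infinity>"
    by (rule iffD2[OF AE_all_countable])
  then show ?thesis
  proof eventually_elim
    case (elim x)
    show ?case
    proof
      assume x: "norm x < 1"
      then obtain k where k: "inverse (real (Suc k)) < 1 - norm x" using reals_Archimedean[of "1 - norm x"] by auto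
      have "1 / real (Suc (Suc k)) \<le> inverse (real (Suc k))" by (simp add: field_simps)
      with k have "x \<in> cball 0 (R k)" by (simp add: R_def)
      with elim show "(\<integral>\<^sup>+y. green_function x y \<partial>M) \<noteq> \<infinity>" by blast
    qed
  qed
qed

text \<open>Fubini for the Green function times the density of the Laplacian; for each y the inner
  integral is \<open>- V \<psi>(y)\<close> with V the volume of the unit ball. Fubini also makes
  this integrable in y, which yields the integrability of \<psi>.\<close>

lemma green_potential_weak:
  fixes M :: "'a::euclidean_space measure"
  assumes dim: "DIM('a) \<ge> 2" and sM: "sets M = sets borel" and ae: "AE y in M. norm y < 1"
    and fin: "(\<integral>\<^sup>+y. ennreal ((1 - (norm y)\<^sup>2) ^ (DIM('a) - 1)) \<partial>M) < \<infinity>"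
    and psi: "\<psi> \<in> C2c_ball"
  shows "integrable M (\<lambda>y. indicator unit_ball y * \<psi> y)"
    and "has_bochner_integral lborel (\<lambda>x. enn2real (\<integral>\<^sup>+y. green_function x y \<partial>M) * laplacian_density \<psi> x)
      (- (unit_ball_vol (DIM('a)) * (\<integral>y. indicator unit_ball y * \<psi> y \<partial>M)))"
proof -
  let ?V = "unit_ball_vol (DIM('a))"
  let ?L = "laplacian_density \<psi>"
  have sgM: "sigma_finite_measure M" by (rule sigma_finite_weighted[OF sM ae fin])
  interpret M: sigma_finite_measure M by (rule sgM)
  obtain R B where RB: "0 < R" "R < 1" "B \<ge> 0" "\<And>x. \<bar>laplacian_density \<psi> x\<bar> \<le> B * indicator (cball 0 R) x"
    "\<And>x. \<bar>indicator unit_ball x * (\<psi> x / (1 - (norm x)\<^sup>2) ^ DIM('a))\<bar> \<le> B * indicator (cball 0 R) x"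
    by (rule C2c_ball_bounds[OF psi]) (rule that; assumption)
  note mpL = borel_measurable_C2c_ball[OF psi]
  have L0: "?L x = 0" if "norm x \<ge> 1" for x using RB(4)[of x] RB(2) that by simp
  define k where "k x y = enn2real (green_function x y) * ?L x" for x y
  have mg: "(\<lambda>p. green_function (fst p) (snd p)) \<in> borel_measurable (borel \<Otimes>\<^sub>M (borel :: 'a measure))"
    by (intro borel_measurable_green_function) auto
  have mk: "case_prod k \<in> borel_measurable (borel \<Otimes>\<^sub>M borel)"
    unfolding k_def case_prod_unfold
    by (intro borel_measurable_times measurable_compose[OF mg borel_measurable_enn2real_id] measurable_compose[OF measurable_fst mpL(2)])
  have mkM: "(\<lambda>y. \<integral>\<^sup>+x. green_function x y * indicator (cball 0 R) x \<partial>lborel) \<in> borel_measurable M"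
  proof -
    have "(\<lambda>(y, x). green_function x y * indicator (cball 0 R) x) \<in> borel_measurable (borel \<Otimes>\<^sub>M (lborel :: 'a measure))"
      using measurable_compose[OF measurable_pair_swap' measurable_green_cball[of R, where 'a='a]]
      by (simp add: case_prod_unfold measurable_cong_sets[OF sets_pair_measure_cong[OF refl sets_lborel] refl])
    from lborel.borel_measurable_nn_integral_fst[OF this] show ?thesis
      by (simp add: measurable_cong_sets[OF sM refl])
  qed
  have finite: "(\<integral>\<^sup>+y. (\<integral>\<^sup>+x. ennreal \<bar>k x y\<bar> \<partial>lborel) \<partial>M) < \<infinity>"
  proof -
    have "(\<integral>\<^sup>+y. (\<integral>\<^sup>+x. ennreal \<bar>k x y\<bar> \<partial>lborel) \<partial>M) \<le> (\<integral>\<^sup>+y. ennreal B * (\<integral>\<^sup>+x\<in>cball 0 R. green_function x y \<partial>lborel) \<partial>M)"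
    proof (rule nn_integral_mono)
      fix y :: 'a
      have "(\<integral>\<^sup>+x. ennreal \<bar>k x y\<bar> \<partial>lborel) \<le> (\<integral>\<^sup>+x. ennreal B * (green_function x y * indicator (cball 0 R) x) \<partial>lborel)"
      proof (rule nn_integral_mono)
        fix x :: 'a
        have "\<bar>k x y\<bar> \<le> enn2real (green_function x y) * (B * indicator (cball 0 R) x)"
          unfolding k_def using RB(4)[of x] by (simp add: abs_mult mult_left_mono)
        then have "ennreal \<bar>k x y\<bar> \<le> ennreal (B * (enn2real (green_function x y) * indicator (cball 0 R) x))"
          by (intro ennreal_leI) (simp add: ac_simps)
        also have "\<dots> \<le> ennreal B * (green_function x y * indicator (cball 0 R) x)"
          using RB(3) by (cases "green_function x y") (auto simp: ennreal_mult' indicator_def)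
        finally show "ennreal \<bar>k x y\<bar> \<le> ennreal B * (green_function x y * indicator (cball 0 R) x)" .
      qed
      also have "\<dots> = ennreal B * (\<integral>\<^sup>+x\<in>cball 0 R. green_function x y \<partial>lborel)"
        by (rule nn_integral_cmult) (intro borel_measurable_times_ennreal borel_measurable_indicator; measurable)
      finally show "(\<integral>\<^sup>+x. ennreal \<bar>k x y\<bar> \<partial>lborel) \<le> ennreal B * (\<integral>\<^sup>+x\<in>cball 0 R. green_function x y \<partial>lborel)" .
    qed
    also have "\<dots> = ennreal B * (\<integral>\<^sup>+y. (\<integral>\<^sup>+x\<in>cball 0 R. green_function x y \<partial>lborel) \<partial>M)"
      by (rule nn_integral_cmult[OF mkM])
    also have "\<dots> < \<infinity>"
      using green_potential_local_bound[OF dim sM ae fin RB(1,2)] by (simp add: ennreal_mult_less_top)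
    finally show ?thesis .
  qed
  note F = Fubini_lborel[OF sgM sM mk finite]
  have inner: "AE y in M. (\<integral>x. k x y \<partial>lborel) = - (?V * (indicator unit_ball y * \<psi> y))"
    using ae by eventually_elim (simp add: k_def green_weak_identity[OF dim psi])
  have mpsi: "(\<lambda>y. indicator unit_ball y * \<psi> y) \<in> borel_measurable M"
    using mpL(1) by (simp add: measurable_cong_sets[OF sM refl])
  have mpsi': "(\<lambda>y. - (?V * (indicator unit_ball y * \<psi> y))) \<in> borel_measurable M"
    by (intro borel_measurable_uminus borel_measurable_times borel_measurable_const mpsi)
  have "integrable M (\<lambda>y. - (?V * (indicator unit_ball y * \<psi> y)))"
    using F(3) integrable_cong_AE[OF borel_measurable_integrable[OF F(3)] mpsi' inner] by blast
  then have "integrable M (\<lambda>y. - (1 / ?V) * (- (?V * (indicator unit_ball y * \<psi> y))))"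
    by (rule integrable_mult_right)
  then show ip: "integrable M (\<lambda>y. indicator unit_ball y * \<psi> y)" by simp
  have "(\<integral>y. (\<integral>x. k x y \<partial>lborel) \<partial>M) = (\<integral>y. - (?V * (indicator unit_ball y * \<psi> y)) \<partial>M)"
    by (rule integral_cong_AE[OF borel_measurable_integrable[OF F(3)] mpsi' inner])
  also have "\<dots> = - (?V * (\<integral>y. indicator unit_ball y * \<psi> y \<partial>M))"
    by (simp only: integral_minus integral_mult_right_zero)
  finally have I: "(\<integral>x. (\<integral>y. k x y \<partial>M) \<partial>lborel) = - (?V * (\<integral>y. indicator unit_ball y * \<psi> y \<partial>M))"
    using F(2) by simp
  have mgx: "(\<lambda>y. green_function x y) \<in> borel_measurable M" for x
    unfolding measurable_cong_sets[OF sM refl] by measurable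
  \<comment> \<open>\<open>enn2real\<close> commutes with the integral wherever the potential is
    finite, because the Green function is then finite for almost every y; the remaining points of
    the ball form a null set.\<close>
  have "AE x in lborel. (\<integral>y. k x y \<partial>M) = enn2real (\<integral>\<^sup>+y. green_function x y \<partial>M) * ?L x"
    using AE_green_potential_finite[OF dim sM ae fin]
  proof eventually_elim
    case (elim x)
    show ?case
    proof (cases "norm x < 1")
      case True
      with elim have f: "(\<integral>\<^sup>+y. green_function x y \<partial>M) \<noteq> \<infinity>" by blast
      have af: "AE y in M. green_function x y \<noteq> \<infinity>" using nn_integral_PInf_AE[OF mgx f] .
      have "(\<integral>y. enn2real (green_function x y) \<partial>M) = enn2real (\<integral>\<^sup>+y. ennreal (enn2real (green_function x y)) \<partial>M)"
        by (rule integral_eq_nn_integral) (use measurable_compose[OF mgx borel_measurable_enn2real_id] in auto)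
      also have "(\<integral>\<^sup>+y. ennreal (enn2real (green_function x y)) \<partial>M) = (\<integral>\<^sup>+y. green_function x y \<partial>M)"
        using af by (intro nn_integral_cong_AE) (auto elim!: eventually_mono simp: less_top)
      finally show ?thesis by (simp add: k_def)
    qed (simp add: k_def L0)
  qed
  moreover have mG: "(\<lambda>x. \<integral>\<^sup>+y. green_function x y \<partial>M) \<in> borel_measurable borel"
  proof -
    have "(\<lambda>(x, y). green_function x y) \<in> borel_measurable (borel \<Otimes>\<^sub>M M)"
      using mg by (simp add: case_prod_unfold measurable_cong_sets[OF sets_pair_measure_cong[OF refl sM] refl])
    from M.borel_measurable_nn_integral_fst[OF this] show ?thesis by simp
  qed
  have mGL: "(\<lambda>x. enn2real (\<integral>\<^sup>+y. green_function x y \<partial>M) * ?L x) \<in> borel_measurable lborel"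
    unfolding measurable_lborel2
    by (intro borel_measurable_times measurable_compose[OF mG borel_measurable_enn2real_id] mpL(2))
  ultimately have aeq: "AE x in lborel. (\<integral>y. k x y \<partial>M) = enn2real (\<integral>\<^sup>+y. green_function x y \<partial>M) * ?L x" by blast
  have "integrable lborel (\<lambda>x. enn2real (\<integral>\<^sup>+y. green_function x y \<partial>M) * ?L x)"
    using F(1) integrable_cong_AE[OF borel_measurable_integrable[OF F(1)] mGL aeq] by blast
  moreover have "(\<integral>x. enn2real (\<integral>\<^sup>+y. green_function x y \<partial>M) * ?L x \<partial>lborel) = - (?V * (\<integral>y. indicator unit_ball y * \<psi> y \<partial>M))"
    using integral_cong_AE[OF borel_measurable_integrable[OF F(1)] mGL aeq] I by simp
  ultimately show "has_bochner_integral lborel (\<lambda>x. enn2real (\<integral>\<^sup>+y. green_function x y \<partial>M) * ?L x)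
      (- (?V * (\<integral>y. indicator unit_ball y * \<psi> y \<partial>M)))"
    by (simp add: has_bochner_integral_iff)
qed

text \<open>The test function confines x to \<open>cball 0 R\<close>, where the kernel is bounded
  uniformly in t. So Fubini applies to every integrable f and reduces the claim to a single
  t.\<close>

lemma poisson_integral_weak:
  fixes f :: "'a::euclidean_space \<Rightarrow> real"
  assumes dim: "DIM('a) \<ge> 2" and psi: "\<psi> \<in> C2c_ball" and f: "integrable sphere_borel f"
  shows "has_bochner_integral lborel (\<lambda>x. (\<integral>t. poisson_kernel x t * f t \<partial>sphere_borel) * laplacian_density \<psi> x) 0"
proof -
  interpret S: prob_space "sphere_borel :: 'a measure" by (rule prob_space_sphere_borel)
  let ?L = "laplacian_density \<psi>"
  obtain R B where RB: "0 < R" "R < 1" "B \<ge> 0" "\<And>x. \<bar>laplacian_density \<psi> x\<bar> \<le> B * indicator (cball 0 R) x"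
    "\<And>x. \<bar>indicator unit_ball x * (\<psi> x / (1 - (norm x)\<^sup>2) ^ DIM('a))\<bar> \<le> B * indicator (cball 0 R) x"
    by (rule C2c_ball_bounds[OF psi]) (rule that; assumption)
  note mpL = borel_measurable_C2c_ball[OF psi]
  have mf: "f \<in> borel_measurable borel"
    using iffD1[OF arg_cong2[where f="(\<in>)", OF refl measurable_cong_sets[OF sets_sphere_borel refl]] borel_measurable_integrable[OF f]] .
  define k where "k x t = poisson_kernel x t * f t * ?L x" for x t
  have mk: "case_prod k \<in> borel_measurable (borel \<Otimes>\<^sub>M borel)"
    unfolding k_def case_prod_unfold
    by (intro borel_measurable_times borel_measurable_poisson_kernel measurable_compose[OF measurable_snd mf]
        measurable_compose[OF measurable_fst mpL(2)]) auto
  define c where "c = (1 / (1 - R)\<^sup>2) ^ (DIM('a) - 1)"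
  have c: "c \<ge> 0" by (simp add: c_def)
  have finite: "(\<integral>\<^sup>+t. (\<integral>\<^sup>+x. ennreal \<bar>k x t\<bar> \<partial>lborel) \<partial>sphere_borel) < \<infinity>"
  proof -
    have "(\<integral>\<^sup>+t. (\<integral>\<^sup>+x. ennreal \<bar>k x t\<bar> \<partial>lborel) \<partial>sphere_borel) \<le>
      (\<integral>\<^sup>+t. ennreal (c * B * (unit_ball_vol (DIM('a)) * R ^ DIM('a))) * ennreal (norm (f t)) \<partial>sphere_borel)"
    proof (rule nn_integral_mono_AE)
      show "AE t in sphere_borel. (\<integral>\<^sup>+x. ennreal \<bar>k x t\<bar> \<partial>lborel) \<le>
         ennreal (c * B * (unit_ball_vol (DIM('a)) * R ^ DIM('a))) * ennreal (norm (f t))"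
        using AE_sphere_borel_norm
      proof eventually_elim
        case (elim t)
        have "(\<integral>\<^sup>+x. ennreal \<bar>k x t\<bar> \<partial>lborel) \<le> (\<integral>\<^sup>+x. ennreal (c * B * norm (f t)) * indicator (cball 0 R) x \<partial>(lborel :: 'a measure))"
        proof (rule nn_integral_mono)
          fix x :: 'a
          show "ennreal \<bar>k x t\<bar> \<le> ennreal (c * B * norm (f t)) * indicator (cball 0 R) x"
          proof (cases "x \<in> cball 0 R")
            case True
            have "\<bar>k x t\<bar> \<le> (c * norm (f t)) * B"
              unfolding k_def abs_mult using poisson_kernel_bounds[of x R t] RB(2) RB(4)[of x] True elim c
              by (intro mult_mono) (auto simp: c_def)
            then show ?thesis using True by (simp add: ac_simps ennreal_leI)
          next
            case False
            then show ?thesis using RB(4)[of x] by (simp add: k_def)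
          qed
        qed
        also have "\<dots> = ennreal (c * B * norm (f t)) * ennreal (unit_ball_vol (DIM('a)) * R ^ DIM('a))"
          using RB(1) by (subst nn_integral_cmult_indicator) (auto simp: emeasure_cball)
        also have "\<dots> = ennreal (c * B * (unit_ball_vol (DIM('a)) * R ^ DIM('a))) * ennreal (norm (f t))"
          using c RB(1,3) by (simp add: ennreal_mult'[symmetric] ac_simps)
        finally show ?case .
      qed
    qed
    also have "\<dots> = ennreal (c * B * (unit_ball_vol (DIM('a)) * R ^ DIM('a))) * (\<integral>\<^sup>+t. ennreal (norm (f t)) \<partial>sphere_borel)"
      by (rule nn_integral_cmult)
         (rule measurable_compose[OF borel_measurable_integrable[OF f]], measurable)
    also have "\<dots> < \<infinity>" using f by (simp add: integrable_iff_bounded ennreal_mult_less_top)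
    finally show ?thesis .
  qed
  note F = Fubini_lborel[OF S.sigma_finite_measure_axioms sets_sphere_borel mk finite]
  have "(\<integral>t. (\<integral>x. k x t \<partial>lborel) \<partial>sphere_borel) = (\<integral>t. 0 \<partial>(sphere_borel :: 'a measure))"
  proof (rule integral_cong_AE[OF borel_measurable_integrable[OF F(3)]])
    show "AE t in sphere_borel. (\<integral>x. k x t \<partial>lborel) = 0"
      using AE_sphere_borel_norm
    proof eventually_elim
      case (elim t)
      have "(\<integral>x. k x t \<partial>lborel) = (\<integral>x. f t * (poisson_kernel x t * ?L x) \<partial>lborel)"
        by (simp add: k_def ac_simps)
      also have "\<dots> = f t * (\<integral>x. poisson_kernel x t * ?L x \<partial>lborel)" by (rule integral_mult_right_zero)
      also have "(\<integral>x. poisson_kernel x t * ?L x \<partial>lborel) = 0"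
        using poisson_kernel_weakly_harmonic[OF dim psi elim] by (simp add: laplacian_density_def ac_simps)
      finally show ?case by simp
    qed
  qed simp
  then have "(\<integral>x. (\<integral>t. k x t \<partial>sphere_borel) \<partial>lborel) = 0" using F(2) by simp
  with F(1) have "has_bochner_integral lborel (\<lambda>x. \<integral>t. k x t \<partial>sphere_borel) 0"
    by (simp add: has_bochner_integral_iff)
  then show ?thesis by (simp add: k_def)
qed

subsection \<open>Boundary limits of the Poisson integral\<close>

text \<open>Caps shrink like \<open>r^(n - 1)\<close>; for \<open>n = 1\<close> the sphere would
  consist of two atoms.\<close>

lemma sphere_borel_nonatomic:
  assumes dim: "DIM('a::euclidean_space) \<ge> 2"
  shows "emeasure sphere_borel {s::'a} = 0"
proof (rule antisym)
  have le: "emeasure sphere_borel {s} \<le> ennreal (2 ^ DIM('a) * (1 / real (Suc k)) ^ (DIM('a) - 1))" for k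
    by (rule order_trans[OF emeasure_mono emeasure_sphere_borel_ball_le[where t=s]]) auto
  have "(\<lambda>k. ennreal (2 ^ DIM('a) * (1 / real (Suc k)) ^ (DIM('a) - 1))) \<longlonglongrightarrow> ennreal (2 ^ DIM('a) * 0 ^ (DIM('a) - 1))"
    using LIMSEQ_inverse_real_of_nat
    by (intro tendsto_ennrealI tendsto_mult tendsto_const tendsto_power) (simp add: inverse_eq_divide)
  from LIMSEQ_le_const[OF this] le have "emeasure sphere_borel {s} \<le> ennreal (2 ^ DIM('a) * 0 ^ (DIM('a) - 1))"
    by blast
  then show "emeasure sphere_borel {s} \<le> 0" using dim by (simp add: zero_power)
qed simp

text \<open>The distance from s to \<open>r t\<close> is at least half of
  \<open>max (1 - r) (dist t s)\<close>, and \<open>1 - r^2 \<le> 2 (1 - r)\<close>; together this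
  gives \<open>8 = 2 * 2^2\<close>.\<close>

lemma poisson_kernel_le_radial_kernel:
  fixes t s :: "'a::euclidean_space"
  assumes r: "0 < r" "r < 1" and t: "norm t = 1" and s: "norm s = 1"
  shows "0 \<le> poisson_kernel (r *\<^sub>R t) s"
    and "poisson_kernel (r *\<^sub>R t) s \<le> 8 ^ (DIM('a) - 1) * radial_kernel t (1 - r) s"
proof -
  show "0 \<le> poisson_kernel (r *\<^sub>R t) s" using poisson_kernel_bounds(1)[of "r *\<^sub>R t" r s] r t s by simp
  let ?d = "1 - r" and ?m = "max (1 - r) (dist t s)" and ?n = "DIM('a) - 1"
  have d: "?d > 0" using r by simp
  have m: "?m > 0" using d by simp
  have d1: "?d \<le> norm (s - r *\<^sub>R t)" using norm_triangle_ineq2[of s "r *\<^sub>R t"] r t s by simp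
  have "norm (t - r *\<^sub>R t) = ?d"
  proof -
    have "t - r *\<^sub>R t = ?d *\<^sub>R t" by (simp add: algebra_simps)
    then show ?thesis using r t by simp
  qed
  then have "dist t s \<le> 2 * norm (s - r *\<^sub>R t)"
    using d1 norm_triangle_ineq[of "t - r *\<^sub>R t" "r *\<^sub>R t - s"] by (simp add: dist_norm norm_minus_commute)
  then have "?m / 2 \<le> norm (s - r *\<^sub>R t)" using d1 d by auto
  then have "(?m / 2)\<^sup>2 \<le> (norm (s - r *\<^sub>R t))\<^sup>2" using m by (intro power_mono) auto
  moreover have "1 - r\<^sup>2 \<le> 2 * ?d"
    using zero_le_power2[of "1 - r"] by (simp add: power2_eq_square algebra_simps)
  ultimately have "(1 - r\<^sup>2) / (norm (s - r *\<^sub>R t))\<^sup>2 \<le> (2 * ?d) / (?m / 2)\<^sup>2"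
    using m r by (intro frac_le) auto
  also have "\<dots> = 8 * (?d / ?m\<^sup>2)" by (simp add: power_divide)
  finally have "((1 - r\<^sup>2) / (norm (s - r *\<^sub>R t))\<^sup>2) ^ ?n \<le> (8 * (?d / ?m\<^sup>2)) ^ ?n"
    using r by (intro power_mono divide_nonneg_nonneg) (auto simp: abs_square_le_1)
  also have "\<dots> = 8 ^ ?n * (?d ^ ?n / ?m ^ (2 * ?n))"
    by (simp only: power_mult_distrib power_divide power_mult)
  finally show "poisson_kernel (r *\<^sub>R t) s \<le> 8 ^ ?n * radial_kernel t (1 - r) s"
    using r t by (simp add: poisson_kernel_def radial_kernel_def)
qed

lemma integrable_poisson_kernel_mult:
  fixes t :: "'a::euclidean_space" and f :: "'a \<Rightarrow> real"
  assumes r: "0 < r" "r < 1" and t: "norm t = 1" and f: "integrable sphere_borel f"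
  shows "integrable sphere_borel (\<lambda>s. poisson_kernel (r *\<^sub>R t) s * f s)"
proof (rule Bochner_Integration.integrable_bound)
  show "integrable sphere_borel (\<lambda>s. (1 / (1 - r)\<^sup>2) ^ (DIM('a) - 1) * f s)"
    using f by (rule integrable_mult_right)
  have "(\<lambda>s. poisson_kernel (r *\<^sub>R t) s) \<in> borel_measurable sphere_borel" by measurable
  then show "(\<lambda>s. poisson_kernel (r *\<^sub>R t) s * f s) \<in> borel_measurable sphere_borel"
    using borel_measurable_integrable[OF f] by (rule borel_measurable_times)
  show "AE s in sphere_borel. norm (poisson_kernel (r *\<^sub>R t) s * f s) \<le> norm ((1 / (1 - r)\<^sup>2) ^ (DIM('a) - 1) * f s)"
    using AE_sphere_borel_norm
  proof eventually_elim
    case (elim s)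
    show ?case unfolding norm_mult
      using poisson_kernel_bounds[of "r *\<^sub>R t" r s] r t elim by (intro mult_right_mono) auto
  qed
qed

text \<open>Lebesgue's density theorem for Poisson means. By inner regularity, compact sets
  \<open>K j\<close> exhaust the surface measure of A, and a point off A is off all of them, so
  \<open>AE_radial_limit_zero\<close> applies to surface measure restricted to A.\<close>

lemma AE_poisson_indicator_zero:
  fixes A :: "'a::euclidean_space set"
  assumes dim: "DIM('a) \<ge> 2" and A: "A \<in> sets borel"
  shows "AE t in sphere_borel. t \<notin> A \<longrightarrow>
    ((\<lambda>r. \<integral>s. poisson_kernel (r *\<^sub>R t) s * indicator A s \<partial>sphere_borel) \<longlongrightarrow> 0) (at_left 1)"
proof -
  interpret S: prob_space "sphere_borel :: 'a measure" by (rule prob_space_sphere_borel)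
  have "\<exists>K. compact K \<and> K \<subseteq> A \<and> S.prob A < S.prob K + 1 / real (Suc j)" for j
  proof -
    have eq: "ennreal (S.prob A) = (SUP K \<in> {K. K \<subseteq> A \<and> compact K}. ennreal (S.prob K))"
      using inner_regular[OF sets_sphere_borel _ A] by (simp add: S.emeasure_eq_measure)
    show ?thesis
    proof (rule ccontr)
      assume neg: "\<not> ?thesis"
      have le: "S.prob K \<le> S.prob A - 1 / real (Suc j)" if "compact K" "K \<subseteq> A" for K
        using neg that by (auto simp: not_less)
      have "ennreal (S.prob A) \<le> ennreal (S.prob A - 1 / real (Suc j))"
        unfolding eq using le by (intro SUP_least ennreal_leI) auto
      moreover have "0 \<le> S.prob A - 1 / real (Suc j)" using le[of "{}"] by simp
      ultimately have "S.prob A \<le> S.prob A - 1 / real (Suc j)" by (simp only: ennreal_le_iff)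
      then show False by simp
    qed
  qed
  then obtain K where K: "\<And>j. compact (K j)" "\<And>j. K j \<subseteq> A" "\<And>j. S.prob A < S.prob (K j) + 1 / real (Suc j)"
    by metis
  define M where "M = density sphere_borel (indicator A)"
  have sM: "sets M = sets borel" by (simp add: M_def)
  have A' [measurable]: "A \<in> sets sphere_borel" using A by simp
  have MX: "emeasure M X = emeasure sphere_borel (A \<inter> X)" if "X \<in> sets borel" for X
    unfolding M_def using that A by (subst emeasure_density) (auto simp: indicator_inter_arith[symmetric])
  have K': "K j \<in> sets borel" for j using K(1) by (simp add: borel_compact)
  have Mle: "emeasure M (- K j) \<le> ennreal (1 / real (Suc j))" for j
  proof -
    have "emeasure M (- K j) = emeasure sphere_borel (A - K j)"
      using K' by (subst MX) (auto simp: Diff_eq)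
    also have "\<dots> = ennreal (S.prob A - S.prob (K j))"
      using K(2) K' A by (simp add: S.emeasure_eq_measure S.finite_measure_Diff)
    also have "\<dots> \<le> ennreal (1 / real (Suc j))" using K(3)[of j] by (intro ennreal_leI) simp
    finally show ?thesis .
  qed
  have lim: "(\<lambda>j. emeasure M (- K j)) \<longlonglongrightarrow> 0"
  proof (rule tendsto_sandwich[OF _ _ tendsto_const])
    have "(\<lambda>j. ennreal (1 / real (Suc j))) \<longlonglongrightarrow> ennreal 0"
      using LIMSEQ_inverse_real_of_nat by (intro tendsto_ennrealI) (simp add: inverse_eq_divide)
    then show "(\<lambda>j. ennreal (1 / real (Suc j))) \<longlonglongrightarrow> 0" by simp
  qed (use Mle in auto)
  have fM: "finite_measure M"
    by (intro finite_measureI) (simp add: M_def MX[unfolded M_def] S.emeasure_eq_measure)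
  have "AE t in (sphere_borel :: 'a measure). (\<forall>j. t \<notin> K j) \<longrightarrow>
    ((\<lambda>r. \<integral>\<^sup>+y. ennreal (radial_kernel t (1 - r) y) \<partial>M) \<longlongrightarrow> 0) (at_left 1)"
    using K(1) by (intro AE_radial_limit_zero[OF dim fM sM _ lim] compact_imp_closed)
  then show ?thesis
    using AE_sphere_borel_norm
  proof eventually_elim
    case (elim t)
    show ?case
    proof
      assume "t \<notin> A"
      then have "((\<lambda>r. \<integral>\<^sup>+y. ennreal (radial_kernel t (1 - r) y) \<partial>M) \<longlongrightarrow> 0) (at_left 1)"
        using elim(1) K(2) by blast
      then have "((\<lambda>r. ennreal (8 ^ (DIM('a) - 1)) * (\<integral>\<^sup>+y. ennreal (radial_kernel t (1 - r) y) \<partial>M)) \<longlongrightarrow> ennreal (8 ^ (DIM('a) - 1)) * 0) (at_left 1)"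
        by (intro ennreal_tendsto_cmult) auto
      then have lim0: "((\<lambda>r. ennreal (8 ^ (DIM('a) - 1)) * (\<integral>\<^sup>+y. ennreal (radial_kernel t (1 - r) y) \<partial>M)) \<longlongrightarrow> 0) (at_left 1)"
        by simp
      let ?P = "\<lambda>r. \<integral>s. poisson_kernel (r *\<^sub>R t) s * indicator A s \<partial>sphere_borel"
      have bd: "\<forall>\<^sub>F r in at_left 1. ennreal \<bar>?P r\<bar> \<le> ennreal (8 ^ (DIM('a) - 1)) * (\<integral>\<^sup>+y. ennreal (radial_kernel t (1 - r) y) \<partial>M)"
      proof -
        have "\<forall>\<^sub>F r in at_left (1::real). r \<in> {0<..<1}" by (rule eventually_at_leftI[of 0]) auto
        then show ?thesis
        proof eventually_elim
          case r: (elim r)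
          have "ennreal \<bar>?P r\<bar> \<le> (\<integral>\<^sup>+s. ennreal (norm (poisson_kernel (r *\<^sub>R t) s * indicator A s)) \<partial>sphere_borel)"
            using integral_norm_bound_ennreal[OF integrable_poisson_kernel_mult[OF _ _ elim(2), of r "indicator A"]] r A
            by (simp add: integrable_real_indicator S.emeasure_eq_measure)
          also have "\<dots> \<le> (\<integral>\<^sup>+s. ennreal (8 ^ (DIM('a) - 1)) * (indicator A s * ennreal (radial_kernel t (1 - r) s)) \<partial>sphere_borel)"
          proof (rule nn_integral_mono_AE)
            show "AE s in sphere_borel. ennreal (norm (poisson_kernel (r *\<^sub>R t) s * indicator A s)) \<le>
                ennreal (8 ^ (DIM('a) - 1)) * (indicator A s * ennreal (radial_kernel t (1 - r) s))"
              using AE_sphere_borel_norm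
            proof eventually_elim
              case (elim s)
              then show ?case
                using poisson_kernel_le_radial_kernel[of r t s] r \<open>norm t = 1\<close>
                by (auto simp: indicator_def ennreal_mult'[symmetric] intro!: ennreal_leI)
            qed
          qed
          also have "\<dots> = ennreal (8 ^ (DIM('a) - 1)) * (\<integral>\<^sup>+s. indicator A s * ennreal (radial_kernel t (1 - r) s) \<partial>sphere_borel)"
            by (rule nn_integral_cmult) measurable
          also have "(\<integral>\<^sup>+s. indicator A s * ennreal (radial_kernel t (1 - r) s) \<partial>sphere_borel) = (\<integral>\<^sup>+y. ennreal (radial_kernel t (1 - r) y) \<partial>M)"
            unfolding M_def by (rule nn_integral_density[symmetric]) measurable
          finally show ?case .
        qed
      qed
      have "((\<lambda>r. ennreal \<bar>?P r\<bar>) \<longlongrightarrow> 0) (at_left 1)"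
        by (rule tendsto_sandwich[OF _ bd tendsto_const lim0]) auto
      then have "((\<lambda>r. ennreal \<bar>?P r\<bar>) \<longlongrightarrow> ennreal 0) (at_left 1)" by simp
      from tendsto_enn2real[OF this] have "((\<lambda>r. \<bar>?P r\<bar>) \<longlongrightarrow> 0) (at_left 1)" by simp
      then show "(?P \<longlongrightarrow> 0) (at_left 1)" by (rule tendsto_rabs_zero_cancel)
    qed
  qed
qed

text \<open>Induction over integrable functions. For an indicator, the points of A are treated
  through the complement and the mean 1 of the kernel. In the limit step the measures
  \<open>|s i - f| d\<sigma>\<close> have masses tending to 0, so at almost every t some i makes the
  Poisson integral of the difference small for all r at once.\<close>

lemma AE_poisson_integral_limit:
  fixes f :: "'a::euclidean_space \<Rightarrow> real"
  assumes dim: "DIM('a) \<ge> 2" and f: "integrable sphere_borel f"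
  shows "AE t in sphere_borel. ((\<lambda>r. \<integral>s. poisson_kernel (r *\<^sub>R t) s * f s \<partial>sphere_borel) \<longlongrightarrow> f t) (at_left 1)"
  using f
proof (induction rule: integrable_induct)
  interpret S: prob_space "sphere_borel :: 'a measure" by (rule prob_space_sphere_borel)
  have ev: "\<forall>\<^sub>F r in at_left (1::real). 0 < r \<and> r < 1"
    by (rule eventually_at_leftI[of 0]) auto
  {
    case (base A c)
    then have A: "A \<in> sets borel" by simp
    then have A': "- A \<in> sets borel" by auto
    have "AE t in sphere_borel. ((\<lambda>r. \<integral>s. poisson_kernel (r *\<^sub>R t) s * indicator A s \<partial>sphere_borel) \<longlongrightarrow> indicator A t) (at_left 1)"
      using AE_poisson_indicator_zero[OF dim A] AE_poisson_indicator_zero[OF dim A'] AE_sphere_borel_norm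
    proof eventually_elim
      case (elim t)
      show ?case
      proof (cases "t \<in> A")
        case False
        then show ?thesis using elim by simp
      next
        case True
        have "((\<lambda>r. 1 - (\<integral>s. poisson_kernel (r *\<^sub>R t) s * indicator (- A) s \<partial>sphere_borel)) \<longlongrightarrow> 1 - 0) (at_left 1)"
          using True elim by (intro tendsto_diff tendsto_const) auto
        moreover have "\<forall>\<^sub>F r in at_left 1. 1 - (\<integral>s. poisson_kernel (r *\<^sub>R t) s * indicator (- A) s \<partial>sphere_borel) =
            (\<integral>s. poisson_kernel (r *\<^sub>R t) s * indicator A s \<partial>sphere_borel)"
          using ev
        proof eventually_elim
          case r: (elim r)
          have iA: "integrable sphere_borel (\<lambda>s. poisson_kernel (r *\<^sub>R t) s * indicator X s)" if "X \<in> sets borel" for X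
            using that r elim(3) by (intro integrable_poisson_kernel_mult integrable_real_indicator) (auto simp: S.emeasure_eq_measure)
          have "1 = (\<integral>s. poisson_kernel (r *\<^sub>R t) s \<partial>sphere_borel)"
            using poisson_sphere_mean[OF dim elim(3)] r by simp
          also have "\<dots> = (\<integral>s. poisson_kernel (r *\<^sub>R t) s * indicator A s + poisson_kernel (r *\<^sub>R t) s * indicator (- A) s \<partial>sphere_borel)"
            by (intro Bochner_Integration.integral_cong) (auto simp: indicator_def)
          also have "\<dots> = (\<integral>s. poisson_kernel (r *\<^sub>R t) s * indicator A s \<partial>sphere_borel) + (\<integral>s. poisson_kernel (r *\<^sub>R t) s * indicator (- A) s \<partial>sphere_borel)"
            by (intro Bochner_Integration.integral_add iA A A')
          finally show ?case by simp
        qed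
        ultimately show ?thesis using True by (auto intro: Lim_transform_eventually)
      qed
    qed
    then show ?case
    proof eventually_elim
      case (elim t)
      have "((\<lambda>r. (\<integral>s. poisson_kernel (r *\<^sub>R t) s * indicator A s \<partial>sphere_borel) * c) \<longlongrightarrow> indicator A t * c) (at_left 1)"
        using elim by (intro tendsto_mult tendsto_const)
      then show ?case by (simp add: mult.assoc[symmetric])
    qed
  next
    case (add f g)
    show ?case
      using add(3,4) AE_sphere_borel_norm
    proof eventually_elim
      case (elim t)
      have "((\<lambda>r. (\<integral>s. poisson_kernel (r *\<^sub>R t) s * f s \<partial>sphere_borel) + (\<integral>s. poisson_kernel (r *\<^sub>R t) s * g s \<partial>sphere_borel)) \<longlongrightarrow> f t + g t) (at_left 1)"
        using elim by (intro tendsto_add)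
      moreover have "\<forall>\<^sub>F r in at_left 1. (\<integral>s. poisson_kernel (r *\<^sub>R t) s * f s \<partial>sphere_borel) + (\<integral>s. poisson_kernel (r *\<^sub>R t) s * g s \<partial>sphere_borel) =
          (\<integral>s. poisson_kernel (r *\<^sub>R t) s * (f s + g s) \<partial>sphere_borel)"
        using ev
      proof eventually_elim
        case r: (elim r)
        then show ?case
          using integrable_poisson_kernel_mult[OF _ _ elim(3) add(1), of r] integrable_poisson_kernel_mult[OF _ _ elim(3) add(2), of r]
          by (simp add: distrib_left)
      qed
      ultimately show ?case by (rule Lim_transform_eventually)
    qed
  next
    case (lim f s)
    define h where "h i x = norm (s i x - f x)" for i x
    have inth: "integrable sphere_borel (h i)" for i
      unfolding h_def using lim.hyps(1,4) by (intro integrable_norm Bochner_Integration.integrable_diff) auto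
    have mh: "h i \<in> borel_measurable sphere_borel" for i using inth by (rule borel_measurable_integrable)
    have mhr: "(\<lambda>x. ennreal (h i x) * ennreal (radial_kernel t (1 - r) x)) \<in> borel_measurable sphere_borel"
      "(\<lambda>x. ennreal (h i x)) \<in> borel_measurable sphere_borel"
      "(\<lambda>x. ennreal (radial_kernel t (1 - r) x)) \<in> borel_measurable sphere_borel" for i t r
    proof -
      show 1: "(\<lambda>x. ennreal (h i x)) \<in> borel_measurable sphere_borel"
        by (rule measurable_compose[OF mh]) measurable
      show 2: "(\<lambda>x. ennreal (radial_kernel t (1 - r) x)) \<in> borel_measurable sphere_borel" by measurable
      show "(\<lambda>x. ennreal (h i x) * ennreal (radial_kernel t (1 - r) x)) \<in> borel_measurable sphere_borel"
        by (rule borel_measurable_times_ennreal[OF 1 2])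
    qed
    define M where "M i = density sphere_borel (\<lambda>x. ennreal (h i x))" for i
    have sM: "sets (M i) = sets borel" for i by (simp add: M_def)
    have MU: "emeasure (M i) UNIV = ennreal (\<integral>x. h i x \<partial>sphere_borel)" for i
    proof -
      have "emeasure (M i) UNIV = (\<integral>\<^sup>+x. ennreal (h i x) \<partial>sphere_borel)"
        unfolding M_def using mh[of i] by (subst emeasure_density) auto
      also have "\<dots> = ennreal (\<integral>x. h i x \<partial>sphere_borel)"
        by (rule nn_integral_eq_integral[OF inth]) (simp add: h_def)
      finally show ?thesis .
    qed
    have fM: "finite_measure (M i)" for i
      by (intro finite_measureI) (simp add: M_def MU[unfolded M_def])
    \<comment> \<open>The approximants satisfy \<open>|s i| \<le> 2 |f|\<close>, hence the majorant
      \<open>3 |f|\<close>.\<close>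
    have "(\<lambda>i. \<integral>x. h i x \<partial>sphere_borel) \<longlonglongrightarrow> (\<integral>x. 0 \<partial>(sphere_borel :: 'a measure))"
    proof (rule integral_dominated_convergence[where w="\<lambda>x. 3 * norm (f x)"])
      show "integrable sphere_borel (\<lambda>x. 3 * norm (f x))" using lim.hyps(4) by auto
      show "AE x in sphere_borel. (\<lambda>i. h i x) \<longlonglongrightarrow> 0"
      proof (rule AE_I2)
        fix x :: 'a
        have "(\<lambda>i. norm (s i x - f x)) \<longlonglongrightarrow> norm (f x - f x)"
          using lim.hyps(2)[of x] by (intro tendsto_intros) auto
        then show "(\<lambda>i. h i x) \<longlonglongrightarrow> 0" by (simp add: h_def)
      qed
      show "AE x in sphere_borel. norm (h i x) \<le> 3 * norm (f x)" for i
      proof (rule AE_I2)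
        fix x :: 'a
        show "norm (h i x) \<le> 3 * norm (f x)"
          using lim.hyps(3)[of x i] norm_triangle_ineq4[of "s i x" "f x"] by (simp add: h_def)
      qed
    qed (use mh in auto)
    then have "(\<lambda>i. ennreal (\<integral>x. h i x \<partial>sphere_borel)) \<longlonglongrightarrow> ennreal 0"
      by (intro tendsto_ennrealI) simp
    then have mass: "(\<lambda>i. emeasure (M i) UNIV) \<longlonglongrightarrow> 0" by (simp add: MU)
    \<comment> \<open>A good index is wanted beyond every N, so that \<open>s i t\<close> is close
      to \<open>f t\<close> as well; hence the maximal estimate is applied to all tails of the
      sequence.\<close>
    have "\<forall>N. AE t in (sphere_borel :: 'a measure). \<forall>e>0. \<exists>j. sphere_maximal (M (j + N)) t \<le> ennreal e"
      by (intro allI AE_sphere_maximal_small[OF dim fM sM] LIMSEQ_ignore_initial_segment[OF mass])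
    then have "AE t in (sphere_borel :: 'a measure). \<forall>N. \<forall>e>0. \<exists>j. sphere_maximal (M (j + N)) t \<le> ennreal e"
      by (rule iffD2[OF AE_all_countable])
    moreover have "AE t in sphere_borel. \<forall>i. ((\<lambda>r. \<integral>x. poisson_kernel (r *\<^sub>R t) x * s i x \<partial>sphere_borel) \<longlongrightarrow> s i t) (at_left 1)"
      using lim.IH by (intro iffD2[OF AE_all_countable] allI)
    ultimately show ?case
      using AE_sphere_borel_norm
    proof eventually_elim
      case (elim t)
      let ?P = "\<lambda>g r. \<integral>x. poisson_kernel (r *\<^sub>R t) x * g x \<partial>sphere_borel"
      show ?case
      proof (rule tendstoI)
        fix e :: real assume e: "e > 0"
        \<comment> \<open>The constant in the majorant of the Poisson kernel times that of the
          maximal estimate.\<close>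
        define c where "c = (8::real) ^ (DIM('a) - 1) * 2 ^ DIM('a)"
        have c: "c > 0" by (simp add: c_def)
        have "\<forall>\<^sub>F i in sequentially. dist (s i t) (f t) < e / 3"
          using lim.hyps(2)[of t] e by (intro tendstoD) auto
        then obtain N where N: "\<And>i. i \<ge> N \<Longrightarrow> dist (s i t) (f t) < e / 3" by (auto simp: eventually_sequentially)
        have "e / 4 / c > 0" using e c by simp
        then obtain j where "sphere_maximal (M (j + N)) t \<le> ennreal (e / 4 / c)" using elim(1) by blast
        then obtain i where i: "i \<ge> N" "sphere_maximal (M i) t \<le> ennreal (e / 4 / c)" by (metis le_add2)
        have "\<forall>\<^sub>F r in at_left 1. dist (?P (s i) r) (s i t) < e / 3"
          using elim(2) e by (intro tendstoD) auto
        with ev show "\<forall>\<^sub>F r in at_left 1. dist (?P f r) (f t) < e"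
        proof eventually_elim
          case r: (elim r)
          have i1: "integrable sphere_borel (\<lambda>x. poisson_kernel (r *\<^sub>R t) x * f x)"
            "integrable sphere_borel (\<lambda>x. poisson_kernel (r *\<^sub>R t) x * s i x)"
            "integrable sphere_borel (\<lambda>x. poisson_kernel (r *\<^sub>R t) x * (s i x - f x))"
            using r(1) lim.hyps(1,4) elim(3) by (auto intro!: integrable_poisson_kernel_mult)
          have "?P (s i) r - ?P f r = (\<integral>x. poisson_kernel (r *\<^sub>R t) x * (s i x - f x) \<partial>sphere_borel)"
            using i1 by (simp add: right_diff_distrib)
          then have "ennreal \<bar>?P (s i) r - ?P f r\<bar> \<le> (\<integral>\<^sup>+x. ennreal (norm (poisson_kernel (r *\<^sub>R t) x * (s i x - f x))) \<partial>sphere_borel)"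
            using integral_norm_bound_ennreal[OF i1(3)] by simp
          also have "\<dots> \<le> (\<integral>\<^sup>+x. ennreal (8 ^ (DIM('a) - 1)) * (ennreal (h i x) * ennreal (radial_kernel t (1 - r) x)) \<partial>sphere_borel)"
          proof (rule nn_integral_mono_AE)
            show "AE x in sphere_borel. ennreal (norm (poisson_kernel (r *\<^sub>R t) x * (s i x - f x))) \<le>
              ennreal (8 ^ (DIM('a) - 1)) * (ennreal (h i x) * ennreal (radial_kernel t (1 - r) x))"
              using AE_sphere_borel_norm
            proof eventually_elim
              case (elim x)
              note pk = poisson_kernel_le_radial_kernel[of r t x]
              have "norm (poisson_kernel (r *\<^sub>R t) x * (s i x - f x)) \<le> (8 ^ (DIM('a) - 1) * radial_kernel t (1 - r) x) * h i x"
                unfolding norm_mult h_def using pk r(1) elim \<open>norm t = 1\<close> by (intro mult_right_mono) auto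
              then show ?case
                using r(1) radial_kernel_nonneg[of "1 - r" t x]
                by (auto simp: ennreal_mult'[symmetric] ac_simps h_def intro!: ennreal_leI)
            qed
          qed
          also have "\<dots> = ennreal (8 ^ (DIM('a) - 1)) * (\<integral>\<^sup>+x. ennreal (h i x) * ennreal (radial_kernel t (1 - r) x) \<partial>sphere_borel)"
            by (rule nn_integral_cmult[OF mhr(1)])
          also have "(\<integral>\<^sup>+x. ennreal (h i x) * ennreal (radial_kernel t (1 - r) x) \<partial>sphere_borel) = (\<integral>\<^sup>+x. ennreal (radial_kernel t (1 - r) x) \<partial>M i)"
            unfolding M_def by (rule nn_integral_density[OF mhr(2,3), symmetric])
          also have "\<dots> \<le> ennreal (2 ^ DIM('a)) * sphere_maximal (M i) t"
            using r(1) by (intro nn_integral_radial_kernel_le[OF dim sM]) simp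
          also have "\<dots> \<le> ennreal (2 ^ DIM('a)) * ennreal (e / 4 / c)" by (intro mult_left_mono i) simp
          finally have "ennreal \<bar>?P (s i) r - ?P f r\<bar> \<le> ennreal (8 ^ (DIM('a) - 1)) * (ennreal (2 ^ DIM('a)) * ennreal (e / 4 / c))"
            by (simp add: mult_left_mono)
          also have "\<dots> = ennreal (c * (e / 4 / c))" using e by (simp add: c_def ennreal_mult'[symmetric] mult.assoc)
          also have "c * (e / 4 / c) = e / 4" using c by simp
          finally have "\<bar>?P (s i) r - ?P f r\<bar> \<le> e / 4" using e by (subst (asm) ennreal_le_iff) auto
          moreover have "\<bar>b - z\<bar> < e" if "\<bar>a - b\<bar> \<le> e / 4" "\<bar>a - y\<bar> < e / 3" "\<bar>y - z\<bar> < e / 3" for a b y z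
            using that e by linarith
          ultimately show ?case using N[OF i(1)] r(2) unfolding dist_real_def by blast
        qed
      qed
    qed
  }
qed

subsection \<open>Boundary limits of the Green potential\<close>

text \<open>With \<open>y = p s\<close> and s a unit vector, the law of cosines reads
  \<open>|r t - y|^2 = (r - p)^2 + r p |t - s|^2\<close>, and \<open>r p \<ge> 1/8\<close> exceeds
  \<open>1/16\<close>.\<close>

lemma norm_diff_sgn_le:
  fixes t y :: "'a::euclidean_space"
  assumes t: "norm t = 1" and r: "1 / 2 \<le> r" and y: "1 / 4 \<le> norm y"
  shows "norm (t - sgn y) \<le> 4 * norm (r *\<^sub>R t - y)"
proof -
  define p where "p = norm y"
  define s where "s = sgn y"
  have s: "norm s = 1" using y by (auto simp: s_def norm_sgn)
  have "y \<noteq> 0" using y by auto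
  then have ys: "y = p *\<^sub>R s" by (simp add: p_def s_def sgn_div_norm)
  have ip: "t \<bullet> t = 1" "s \<bullet> s = 1" using t s by (simp_all add: norm_eq_1)
  have e1: "(norm (r *\<^sub>R t - y))\<^sup>2 = (r - p)\<^sup>2 + r * p * (2 - 2 * (t \<bullet> s))"
    unfolding ys power2_norm_eq_inner using ip
    by (simp add: inner_simps inner_commute power2_eq_square algebra_simps)
  have e2: "(norm (t - s))\<^sup>2 = 2 - 2 * (t \<bullet> s)"
    unfolding power2_norm_eq_inner using ip by (simp add: inner_simps inner_commute)
  have "1 / 2 * (1 / 4) \<le> r * p" using r y by (intro mult_mono) (auto simp: p_def)
  then have "1 / 16 * (norm (t - s))\<^sup>2 \<le> r * p * (norm (t - s))\<^sup>2" by (intro mult_right_mono) auto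
  also have "\<dots> \<le> (norm (r *\<^sub>R t - y))\<^sup>2" unfolding e1 e2 by simp
  finally have "(norm (t - s))\<^sup>2 \<le> (4 * norm (r *\<^sub>R t - y))\<^sup>2" by (simp add: power_mult_distrib)
  then show ?thesis unfolding s_def by (rule power2_le_imp_le) simp
qed

text \<open>The kernel of the part of a Green potential near the radius. Its exponent \<open>n - 3/2\<close> lies
  strictly between the exponent \<open>n - 2\<close> of the singularity and the dimension \<open>n - 1\<close> of the sphere.
  The inverse in \<open>ennreal\<close> makes it infinite if \<open>y\<close> lies on the radius of \<open>t\<close>.\<close>
definition littlewood_kernel :: "'a::euclidean_space \<Rightarrow> 'a \<Rightarrow> ennreal" where
  "littlewood_kernel t y =
     (if norm (t - sgn y) < 4 * (1 - norm y)
      then ennreal ((1 - norm y) powr (real DIM('a) - 3 / 2)) * inverse (ennreal (norm (t - sgn y) powr (real DIM('a) - 3 / 2)))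
      else 0)"

lemma borel_measurable_littlewood_kernel [measurable]:
  assumes [measurable]: "f \<in> borel_measurable M" "g \<in> borel_measurable M"
  shows "(\<lambda>z. littlewood_kernel (f z) (g z :: 'a::euclidean_space)) \<in> borel_measurable M"
proof -
  have [measurable]: "(\<lambda>z. sgn (g z)) \<in> borel_measurable M"
    by (rule measurable_compose[OF _ borel_measurable_sgn_euclidean]) measurable
  show ?thesis unfolding littlewood_kernel_def by measurable
qed

text \<open>The exponent b is below the dimension \<open>n - 1\<close> of the sphere, so the
  singularity is integrable, and over a cap of radius \<open>4 e\<close> with
  \<open>e = 1 - |y|\<close> it gives a multiple of \<open>e powr (1/2)\<close>. Together with the
  factor \<open>e powr b\<close> of the kernel this is \<open>e^(n - 1)\<close>, which the weight of
  the hypothesis on \<mu> dominates.\<close>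

lemma nn_integral_littlewood_kernel:
  assumes dim: "DIM('a::euclidean_space) \<ge> 2"
  obtains C where "C \<ge> 0" "\<And>y::'a. norm y < 1 \<Longrightarrow>
    (\<integral>\<^sup>+t. littlewood_kernel t y \<partial>sphere_borel) \<le> ennreal (C * (1 - (norm y)\<^sup>2) ^ (DIM('a) - 1))"
proof -
  let ?n = "DIM('a)"
  define b where "b = real ?n - 3 / 2"
  define d where "d = real (?n - 1)"
  have d: "d = b + 1 / 2" "d = real ?n - 1" using dim by (auto simp: d_def b_def of_nat_diff)
  have b: "b > 0" using dim by (simp add: b_def)
  define C where "C = 2 ^ ?n * 2 powr b / (1 - 2 powr (b - d)) * 4 powr (1 / 2)"
  have q: "2 powr (b - d) < 1" using d by (intro powr_less_one) auto
  have C: "C \<ge> 0" unfolding C_def using q by simp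
  show ?thesis
  proof (rule that[OF C])
    fix y :: 'a assume y: "norm y < 1"
    define e where "e = 1 - norm y"
    have e: "e > 0" using y by (simp add: e_def)
    \<comment> \<open>At \<open>t = sgn y\<close> the kernel is infinite while the integrand of the
      Riesz bound is \<open>0 powr - b = 0\<close>; so this null set is removed first.\<close>
    have "AE t in sphere_borel. t \<notin> {sgn y}"
      by (rule AE_not_in) (auto simp: null_sets_def sphere_borel_nonatomic[OF dim])
    then have "(\<integral>\<^sup>+t. littlewood_kernel t y \<partial>sphere_borel) \<le>
      (\<integral>\<^sup>+t. ennreal (e powr b) * (ennreal (norm (t - sgn y) powr - b) * indicator (ball (sgn y) (4 * e)) t) \<partial>sphere_borel)"
    proof (intro nn_integral_mono_AE, eventually_elim)
      case (elim t)
      then have "norm (t - sgn y) > 0" by simp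
      then show ?case
        using e by (simp add: littlewood_kernel_def e_def[symmetric] b_def[symmetric] inverse_ennreal powr_minus dist_norm norm_minus_commute)
    qed
    also have "\<dots> = ennreal (e powr b) * (\<integral>\<^sup>+t\<in>ball (sgn y) (4 * e). ennreal (norm (t - sgn y) powr - b) \<partial>sphere_borel)"
    proof (rule nn_integral_cmult)
      have "(indicator (ball (sgn y) (4 * e)) :: 'a \<Rightarrow> ennreal) \<in> borel_measurable sphere_borel"
        by (rule borel_measurable_indicator) simp
      then show "(\<lambda>t. ennreal (norm (t - sgn y) powr - b) * indicator (ball (sgn y) (4 * e)) t) \<in> borel_measurable sphere_borel"
        by (rule borel_measurable_times_ennreal[rotated]) measurable
    qed
    also have "\<dots> \<le> ennreal (e powr b) * ennreal (2 ^ ?n * 2 powr b / (1 - 2 powr (b - d)) * (4 * e) powr (d - b))"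
    proof (intro mult_left_mono nn_integral_riesz_le)
      show "emeasure sphere_borel (ball (sgn y) r) \<le> ennreal (2 ^ ?n * r powr d)" if "0 < r" for r
      proof -
        have "r powr d = r ^ (?n - 1)" unfolding d_def using that by (rule powr_realpow)
        then show ?thesis using emeasure_sphere_borel_ball_le[OF that, of "sgn y"] by simp
      qed
    qed (use d b e in auto)
    also have "\<dots> = ennreal (C * e ^ (?n - 1))"
    proof -
      have "e powr b * e powr (1 / 2) = e powr (real (?n - 1))" using d by (simp add: d_def flip: powr_add)
      also have "\<dots> = e ^ (?n - 1)" using e by (rule powr_realpow)
      finally have ee: "e powr b * e powr (1 / 2) = e ^ (?n - 1)" .
      have "ennreal (e powr b) * ennreal (2 ^ ?n * 2 powr b / (1 - 2 powr (b - d)) * (4 * e) powr (d - b)) =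
        ennreal (e powr b * (2 ^ ?n * 2 powr b / (1 - 2 powr (b - d)) * (4 * e) powr (d - b)))"
        by (rule ennreal_mult'[symmetric]) simp
      also have "e powr b * (2 ^ ?n * 2 powr b / (1 - 2 powr (b - d)) * (4 * e) powr (d - b)) = C * (e powr b * e powr (1 / 2))"
        using d(1) by (simp add: C_def powr_mult)
      finally show ?thesis unfolding ee .
    qed
    also have "\<dots> \<le> ennreal (C * (1 - (norm y)\<^sup>2) ^ (?n - 1))"
    proof (intro ennreal_leI mult_left_mono power_mono)
      have "norm y * norm y \<le> norm y * 1" using y by (intro mult_left_mono) auto
      then show "e \<le> 1 - (norm y)\<^sup>2" by (simp add: e_def power2_eq_square)
    qed (use e C in auto)
    finally show "(\<integral>\<^sup>+t. littlewood_kernel t y \<partial>sphere_borel) \<le> ennreal (C * (1 - (norm y)\<^sup>2) ^ (DIM('a) - 1))" .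
  qed
qed

text \<open>Put \<open>x = r t\<close> and \<open>d = 1 - r\<close>. If
  \<open>|x - y| \<ge> d / 2\<close>, the decay of the Green function in p gives the radial kernel.
  Otherwise \<open>1 - |y|\<close> is comparable to d and \<open>|x - y|\<close> is bounded below by
  the distance of the directions t and \<open>sgn y\<close>. Then r survives only in the region
  \<open>1 - |y| < 2 (1 - r)\<close>, which shrinks as r grows.\<close>

lemma green_function_radial_bound:
  assumes dim: "DIM('a::euclidean_space) \<ge> 2"
  obtains C1 C2 where "C1 \<ge> 0" "C2 > 0" "\<And>t y :: 'a. \<And>r. norm t = 1 \<Longrightarrow> norm y < 1 \<Longrightarrow> 1 / 2 \<le> r \<Longrightarrow> r < 1 \<Longrightarrow>
    green_function (r *\<^sub>R t) y \<le> ennreal C1 * (ennreal ((1 - (norm y)\<^sup>2) ^ (DIM('a) - 1)) * ennreal (radial_kernel t (1 - r) y)) +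
      ennreal C2 * (littlewood_kernel t y * indicator {y. 1 - norm y < 2 * (1 - r)} y)"
proof -
  let ?n = "DIM('a)"
  define b where "b = real ?n - 3 / 2"
  have b: "b > 0" "real ?n / 2 - 1 \<le> b / 2" "b / 2 \<le> real ?n - 1"
    using dim by (auto simp: b_def)
  define c1 where "c1 = 1 / (2 * real ?n * (real ?n - 1))"
  define c2 where "c2 = 1 / (2 * real ?n * (b / 2))"
  have c: "c1 \<ge> 0" "c2 > 0" using b dim by (auto simp: c1_def c2_def)
  have G1: "green_radial ?n p \<le> c1 * (1 / p) ^ (?n - 1)" if "p > 0" for p
  proof -
    have "p powr - (real ?n - 1) = (1 / p) ^ (?n - 1)"
    proof -
      have "real ?n - 1 = real (?n - 1)" using dim by (simp add: of_nat_diff)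
      then show ?thesis using that by (simp only: powr_minus_divide powr_realpow power_one_over)
    qed
    then show ?thesis using green_radial_le_powr[OF dim that, of "real ?n - 1"] dim by (simp add: c1_def)
  qed
  have G2: "green_radial ?n p \<le> c2 * p powr - (b / 2)" if "p > 0" for p
    using green_radial_le_powr[OF dim that, of "b / 2"] b by (simp add: c2_def)
  \<comment> \<open>The 18 is \<open>2 * 3^2\<close>, from \<open>1 - |x|^2 \<le> 2 d\<close> and
    \<open>|x - y| \<ge> m / 3\<close>. The 128 is \<open>4 * 2 * 4^2\<close>, from
    \<open>1 - |x|^2 \<le> 4 e\<close>, \<open>1 - |y|^2 \<le> 2 e\<close> and
    \<open>|x - y| \<ge> |t - sgn y| / 4\<close>, where \<open>e = 1 - |y|\<close>.\<close>
  define C1 where "C1 = c1 * 18 ^ (?n - 1)"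
  define C2 where "C2 = c2 * 128 powr (b / 2)"
  have C: "C1 \<ge> 0" "C2 > 0" using c by (auto simp: C1_def C2_def)
  show ?thesis
  proof (rule that[OF C])
    fix t y :: 'a and r :: real
    assume t: "norm t = 1" and y: "norm y < 1" and r: "1 / 2 \<le> r" "r < 1"
    define x where "x = r *\<^sub>R t"
    define d where "d = 1 - r"
    have d: "d > 0" "d \<le> 1 / 2" using r by (auto simp: d_def)
    have nx: "norm x = r" using t r by (simp add: x_def)
    have x1: "norm x < 1" using nx r by simp
    have rx: "1 - (norm x)\<^sup>2 \<le> 2 * d"
      unfolding nx d_def using zero_le_power2[of "1 - r"] by (simp add: power2_eq_square algebra_simps)
    have ry: "1 - (norm y)\<^sup>2 > 0" by (rule one_minus_norm_sq_pos[OF y])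
    have rx0: "1 - (norm x)\<^sup>2 > 0" by (rule one_minus_norm_sq_pos[OF x1])
    let ?A = "ennreal C1 * (ennreal ((1 - (norm y)\<^sup>2) ^ (?n - 1)) * ennreal (radial_kernel t d y))"
    let ?B = "ennreal C2 * (littlewood_kernel t y * indicator {y. 1 - norm y < 2 * d} y)"
    have "green_function x y \<le> ?A + ?B"
    proof (cases "dist x y \<ge> d / 2")
      case True
      then have xy: "x \<noteq> y" using d by auto
      have p0: "hyp_dist x y > 0" by (rule hyp_dist_pos[OF x1 y xy])
      define m where "m = max d (dist t y)"
      have m: "m > 0" using d by (simp add: m_def)
      have "dist t x = d"
      proof -
        have "t - x = d *\<^sub>R t" by (simp add: x_def d_def algebra_simps)
        then show ?thesis using d t by (simp add: dist_norm)
      qed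
      then have "dist t y \<le> 3 * dist x y" using dist_triangle[of t y x] True by (simp add: dist_commute)
      then have "m / 3 \<le> norm (x - y)" using True d by (auto simp: m_def dist_norm)
      then have m2: "(m / 3)\<^sup>2 \<le> (norm (x - y))\<^sup>2" using m by (intro power_mono) auto
      have "1 / hyp_dist x y = (1 - (norm x)\<^sup>2) * (1 - (norm y)\<^sup>2) / (norm (x - y))\<^sup>2" by (simp add: hyp_dist_def)
      also have "\<dots> \<le> (2 * d) * (1 - (norm y)\<^sup>2) / (m / 3)\<^sup>2"
        using rx rx0 ry m2 m d by (intro frac_le mult_right_mono) auto
      also have "\<dots> = 18 * ((1 - (norm y)\<^sup>2) * (d / m\<^sup>2))" by (simp add: power_divide)
      finally have "(1 / hyp_dist x y) ^ (?n - 1) \<le> (18 * ((1 - (norm y)\<^sup>2) * (d / m\<^sup>2))) ^ (?n - 1)"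
        using p0 by (intro power_mono) auto
      also have "\<dots> = 18 ^ (?n - 1) * ((1 - (norm y)\<^sup>2) ^ (?n - 1) * radial_kernel t d y)"
        by (simp only: radial_kernel_def m_def[symmetric] power_mult_distrib power_divide power_mult)
      finally have "green_radial ?n (hyp_dist x y) \<le> c1 * (18 ^ (?n - 1) * ((1 - (norm y)\<^sup>2) ^ (?n - 1) * radial_kernel t d y))"
        using G1[OF p0] mult_left_mono[OF _ c(1)] by (meson order_trans)
      then have "green_radial ?n (hyp_dist x y) \<le> C1 * ((1 - (norm y)\<^sup>2) ^ (?n - 1) * radial_kernel t d y)"
        by (simp add: C1_def mult.assoc)
      then have "green_function x y \<le> ennreal (C1 * ((1 - (norm y)\<^sup>2) ^ (?n - 1) * radial_kernel t d y))"
        unfolding green_function_eq_radial[OF x1 y xy] by (rule ennreal_leI)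
      also have "\<dots> = ?A"
        using C ry d radial_kernel_nonneg[of d t y] by (simp add: ennreal_mult)
      also have "\<dots> \<le> ?A + ?B" by simp
      finally show ?thesis .
    next
      case False
      then have near: "norm (x - y) < d / 2" by (simp add: dist_norm)
      define e where "e = 1 - norm y"
      have yx: "\<bar>norm y - r\<bar> < d / 2" using norm_triangle_ineq3[of y x] near nx by (simp add: norm_minus_commute)
      have yx': "norm y - r < d / 2" "r - norm y < d / 2" using yx unfolding abs_less_iff by auto
      have e1: "d / 2 < e" using yx'(1) unfolding e_def d_def by (simp add: field_simps)
      have e2: "e < 2 * d" using yx'(2) d unfolding e_def d_def by (simp add: field_simps)
      note e = e1 e2
      \<comment> \<open>Here \<open>r \<ge> 1/2\<close> enters: the direction of y is controlled
        only away from the origin.\<close>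
      have y4: "1 / 4 \<le> norm y" using yx'(2) r(1) d(2) by linarith
      have s4: "norm (t - sgn y) \<le> 4 * norm (x - y)" unfolding x_def by (rule norm_diff_sgn_le[OF t r(1) y4])
      then have s: "norm (t - sgn y) < 4 * (1 - norm y)" using near e by (simp add: e_def)
      have ind: "indicator {y. 1 - norm y < 2 * d} y = (1::ennreal)" using e by (simp add: e_def)
      show ?thesis
      proof (cases "t = sgn y")
        case True
        \<comment> \<open>The pole may lie on the radius itself, even at x; the bound then holds
          because its right side is infinite.\<close>
        have "littlewood_kernel t y = \<infinity>"
          using s e d b by (simp add: littlewood_kernel_def True e_def[symmetric] ennreal_mult_top)
        then have "?B = \<infinity>" using C by (simp add: ind ennreal_mult_top)
        then show ?thesis by simp
      next
        case ts: False
        have xy: "x \<noteq> y"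
        proof
          assume "x = y"
          with s4 have "norm (t - sgn y) \<le> 0" by simp
          with ts show False by simp
        qed
        define z where "z = norm (t - sgn y)"
        have z: "z > 0" using ts by (simp add: z_def)
        have p0: "hyp_dist x y > 0" by (rule hyp_dist_pos[OF x1 y xy])
        have "(1 - (norm x)\<^sup>2) * (1 - (norm y)\<^sup>2) \<le> (4 * e) * (2 * e)"
        proof (intro mult_mono)
          show "1 - (norm x)\<^sup>2 \<le> 4 * e" using rx e by simp
          show "1 - (norm y)\<^sup>2 \<le> 2 * e"
            unfolding e_def using zero_le_power2[of "1 - norm y"] by (simp add: power2_eq_square algebra_simps)
        qed (use ry e d in auto)
        moreover have "(z / 4)\<^sup>2 \<le> (norm (x - y))\<^sup>2" using s4 z by (intro power_mono) (auto simp: z_def)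
        ultimately have "(z / 4)\<^sup>2 / ((4 * e) * (2 * e)) \<le> hyp_dist x y"
          unfolding hyp_dist_def using rx0 ry by (intro frac_le) auto
        moreover have "(z / 4)\<^sup>2 / ((4 * e) * (2 * e)) = (z / e)\<^sup>2 / 128"
          by (simp add: power2_eq_square)
        ultimately have pz: "(z / e)\<^sup>2 / 128 \<le> hyp_dist x y" by simp
        have ze: "z / e > 0" using z e d by simp
        have "green_radial ?n (hyp_dist x y) \<le> c2 * hyp_dist x y powr - (b / 2)" by (rule G2[OF p0])
        also have "\<dots> \<le> c2 * ((z / e)\<^sup>2 / 128) powr - (b / 2)"
          using pz ze b c by (intro mult_left_mono powr_mono2') auto
        also have "((z / e)\<^sup>2 / 128) powr - (b / 2) = 128 powr (b / 2) * (e powr b * inverse (z powr b))"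
        proof -
          have "(z / e)\<^sup>2 = (z / e) powr 2" using ze by (simp flip: powr_numeral)
          then have "((z / e)\<^sup>2) powr - (b / 2) = (z / e) powr - b" by (simp only: powr_powr) simp
          moreover have "(z / e) powr - b = e powr b * inverse (z powr b)"
            using z e d by (simp add: powr_divide powr_minus divide_simps)
          moreover have "(A / 128) powr - c = 128 powr c * A powr - c" for A c :: real
            by (simp add: powr_divide powr_minus divide_simps)
          ultimately show ?thesis by (simp only:)
        qed
        finally have "green_radial ?n (hyp_dist x y) \<le> C2 * (e powr b * inverse (z powr b))" by (simp add: C2_def mult.assoc)
        then have "green_function x y \<le> ennreal (C2 * (e powr b * inverse (z powr b)))"
          unfolding green_function_eq_radial[OF x1 y xy] by (rule ennreal_leI)
        also have "\<dots> = ?B"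
          using C s z by (simp add: ind littlewood_kernel_def e_def[symmetric] z_def[symmetric] b_def[symmetric] ennreal_mult inverse_ennreal)
        also have "\<dots> \<le> ?A + ?B" by simp
        finally show ?thesis .
      qed
    qed
    then show "green_function (r *\<^sub>R t) y \<le> ennreal C1 * (ennreal ((1 - (norm y)\<^sup>2) ^ (?n - 1)) * ennreal (radial_kernel t (1 - r) y)) +
      ennreal C2 * (littlewood_kernel t y * indicator {y. 1 - norm y < 2 * (1 - r)} y)"
      by (simp only: x_def d_def)
  qed
qed

text \<open>The far part is the radial kernel against the finite measure \<open>m\<close>, which
  closed balls missing the sphere exhaust. For the near part Tonelli makes the integral of the
  Littlewood kernel finite for almost every t, and what is integrated at r is then a tail of
  it.\<close>

lemma AE_green_potential_limit:
  fixes M :: "'a::euclidean_space measure"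
  assumes dim: "DIM('a) \<ge> 2" and sM: "sets M = sets borel" and ae: "AE y in M. norm y < 1"
    and fin: "(\<integral>\<^sup>+y. ennreal ((1 - (norm y)\<^sup>2) ^ (DIM('a) - 1)) \<partial>M) < \<infinity>"
  shows "AE t in (sphere_borel :: 'a measure). ((\<lambda>r. \<integral>\<^sup>+y. green_function (r *\<^sub>R t) y \<partial>M) \<longlongrightarrow> 0) (at_left 1)"
proof -
  interpret S: prob_space "sphere_borel :: 'a measure" by (rule prob_space_sphere_borel)
  interpret M: sigma_finite_measure M by (rule sigma_finite_weighted[OF sM ae fin])
  interpret P: pair_sigma_finite "sphere_borel :: 'a measure" M ..
  let ?n = "DIM('a)"
  have spM: "space M = UNIV" using sM by (metis sets_eq_imp_space_eq space_borel)
  let ?w = "\<lambda>y::'a. ennreal ((1 - (norm y)\<^sup>2) ^ (?n - 1))"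
  have mw: "?w \<in> borel_measurable M"
    unfolding measurable_cong_sets[OF sM refl] by measurable
  define m where "m = density M ?w"
  have sm: "sets m = sets borel" by (simp add: m_def sM)
  have fm: "finite_measure m"
  proof (rule finite_measureI)
    have "emeasure m (space m) = (\<integral>\<^sup>+y. ?w y \<partial>M)"
      unfolding m_def using mw by (subst emeasure_density) (auto simp: spM sM)
    then show "emeasure m (space m) \<noteq> \<infinity>" using fin by simp
  qed
  interpret m: finite_measure m by (rule fm)
  define K where "K j = cball (0::'a) (1 - 1 / real (Suc (Suc j)))" for j
  have limK: "(\<lambda>j. emeasure m (- K j)) \<longlonglongrightarrow> 0"
  proof -
    have "(\<lambda>j. emeasure m (- K j)) \<longlonglongrightarrow> emeasure m (\<Inter>j. - K j)"
    proof (rule Lim_emeasure_decseq)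
      show "range (\<lambda>j. - K j) \<subseteq> sets m" by (auto simp: K_def sm)
      show "decseq (\<lambda>j. - K j)"
      proof (rule decseq_SucI)
        fix j
        have "1 / real (Suc (Suc (Suc j))) \<le> 1 / real (Suc (Suc j))" by (intro divide_left_mono) auto
        then have "K j \<subseteq> K (Suc j)" by (auto simp: K_def)
        then show "- K (Suc j) \<subseteq> - K j" by blast
      qed
    qed simp
    moreover have "emeasure m (\<Inter>j. - K j) = 0"
    proof -
      have INT: "(\<Inter>j. - K j) \<in> sets M" by (auto simp: K_def sM)
      have "emeasure m (\<Inter>j. - K j) = (\<integral>\<^sup>+y. ?w y * indicator (\<Inter>j. - K j) y \<partial>M)"
        unfolding m_def using mw INT by (subst emeasure_density) auto
      also have "\<dots> = (\<integral>\<^sup>+y. 0 \<partial>M)"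
      proof (rule nn_integral_cong_AE)
        show "AE y in M. ?w y * indicator (\<Inter>j. - K j) y = 0"
          using ae
        proof eventually_elim
          case (elim y)
          then obtain k where k: "inverse (real (Suc k)) < 1 - norm y" using reals_Archimedean[of "1 - norm y"] by auto
          have "1 / real (Suc (Suc k)) \<le> inverse (real (Suc k))" by (simp add: field_simps)
          with k have "y \<in> K k" by (simp add: K_def)
          then have "y \<notin> (\<Inter>j. - K j)" by blast
          then have "indicator (\<Inter>j. - K j) y = (0::ennreal)" by (rule indicator_simps(2))
          then show ?case by (metis mult_zero_right)
        qed
      qed
      finally show ?thesis by simp
    qed
    ultimately show ?thesis by simp
  qed
  have far: "AE t in (sphere_borel :: 'a measure). (\<forall>j. t \<notin> K j) \<longrightarrow>
    ((\<lambda>r. \<integral>\<^sup>+y. ennreal (radial_kernel t (1 - r) y) \<partial>m) \<longlongrightarrow> 0) (at_left 1)"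
    by (rule AE_radial_limit_zero[OF dim fm sm _ limK]) (simp add: K_def)
  obtain C where C: "C \<ge> 0" "\<And>y::'a. norm y < 1 \<Longrightarrow>
    (\<integral>\<^sup>+t. littlewood_kernel t y \<partial>sphere_borel) \<le> ennreal (C * (1 - (norm y)\<^sup>2) ^ (DIM('a) - 1))"
    by (rule nn_integral_littlewood_kernel[OF dim]) (rule that; assumption)
  have mlk: "(\<lambda>(t, y). littlewood_kernel t y) \<in> borel_measurable (sphere_borel \<Otimes>\<^sub>M M)"
  proof -
    have "(\<lambda>p. littlewood_kernel (fst p) (snd p)) \<in> borel_measurable (borel \<Otimes>\<^sub>M (borel :: 'a measure))"
      by (rule borel_measurable_littlewood_kernel) auto
    then show ?thesis
      by (simp add: case_prod_unfold measurable_cong_sets[OF sets_pair_measure_cong[OF sets_sphere_borel sM] refl])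
  qed
  have mlk1: "littlewood_kernel t \<in> borel_measurable M" for t
    unfolding measurable_cong_sets[OF sM refl] by measurable
  have "(\<integral>\<^sup>+t. (\<integral>\<^sup>+y. littlewood_kernel t y \<partial>M) \<partial>sphere_borel) = (\<integral>\<^sup>+y. (\<integral>\<^sup>+t. littlewood_kernel t y \<partial>sphere_borel) \<partial>M)"
    by (rule P.Fubini'[OF mlk, symmetric])
  also have "\<dots> \<le> (\<integral>\<^sup>+y. ennreal C * ?w y \<partial>M)"
    using ae by (intro nn_integral_mono_AE) (use C in \<open>auto elim!: eventually_mono simp: ennreal_mult'\<close>)
  also have "\<dots> = ennreal C * (\<integral>\<^sup>+y. ?w y \<partial>M)" by (rule nn_integral_cmult[OF mw])
  also have "\<dots> < \<infinity>" using fin by (simp add: ennreal_mult_less_top)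
  finally have near: "AE t in sphere_borel. (\<integral>\<^sup>+y. littlewood_kernel t y \<partial>M) \<noteq> \<infinity>"
    using M.borel_measurable_nn_integral_fst[OF mlk] by (intro nn_integral_PInf_AE) auto
  obtain C1 C2 where C12: "C1 \<ge> 0" "C2 > 0" "\<And>t y :: 'a. \<And>r. norm t = 1 \<Longrightarrow> norm y < 1 \<Longrightarrow> 1 / 2 \<le> r \<Longrightarrow> r < 1 \<Longrightarrow>
    green_function (r *\<^sub>R t) y \<le> ennreal C1 * (?w y * ennreal (radial_kernel t (1 - r) y)) +
      ennreal C2 * (littlewood_kernel t y * indicator {y. 1 - norm y < 2 * (1 - r)} y)"
    by (rule green_function_radial_bound[OF dim]) (rule that; assumption)
  from far near AE_sphere_borel_norm show ?thesis
  proof eventually_elim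
    case (elim t)
    have "t \<notin> K j" for j using elim(3) by (simp add: K_def)
    then have lim1: "((\<lambda>r. \<integral>\<^sup>+y. ennreal (radial_kernel t (1 - r) y) \<partial>m) \<longlongrightarrow> 0) (at_left 1)"
      using elim(1) by blast
    define B where "B r = {y::'a. 1 - norm y < 2 * (1 - r)}" for r
    have mB: "B r \<in> sets M" for r unfolding B_def sM by measurable
    define I where "I r = (\<integral>\<^sup>+y. littlewood_kernel t y * indicator (B r) y \<partial>M)" for r
    have lim2: "(I \<longlongrightarrow> 0) (at_left 1)"
    proof (rule tendsto_ennreal_0I)
      fix e :: real assume e: "e > 0"
      \<comment> \<open>Dominated convergence concerns sequences. Since \<open>B r\<close> shrinks
        as r grows, one member of the sequence bounds \<open>I r\<close> for all larger r.\<close>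
      let ?q = "\<lambda>k. 1 - 1 / real (Suc k)"
      have "(\<lambda>k. I (?q k)) \<longlonglongrightarrow> (\<integral>\<^sup>+y. 0 \<partial>M)"
        unfolding I_def
      proof (rule nn_integral_dominated_convergence[where w="littlewood_kernel t"])
        show "(\<integral>\<^sup>+y. littlewood_kernel t y \<partial>M) < \<infinity>" using elim(2) by (simp add: less_top)
        show "AE y in M. (\<lambda>k. littlewood_kernel t y * indicator (B (?q k)) y) \<longlonglongrightarrow> 0"
          using ae
        proof eventually_elim
          case (elim y)
          then obtain k where k: "inverse (real (Suc k)) < (1 - norm y) / 2" using reals_Archimedean[of "(1 - norm y) / 2"] by auto
          have "y \<notin> B (?q l)" if "l \<ge> k" for l
          proof -
            have "1 / real (Suc l) \<le> inverse (real (Suc k))" using that by (simp add: field_simps)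
            with k show ?thesis by (simp add: B_def)
          qed
          then have "\<forall>\<^sub>F l in sequentially. littlewood_kernel t y * indicator (B (?q l)) y = 0"
            by (auto simp: eventually_sequentially indicator_def intro!: exI[of _ k])
          then show ?case by (rule tendsto_eventually)
        qed
      qed (use mlk1 mB in \<open>auto simp: indicator_def\<close>)
      then have "(\<lambda>k. I (?q k)) \<longlonglongrightarrow> 0" by simp
      then have "\<forall>\<^sub>F k in sequentially. I (?q k) < ennreal e" using e by (intro order_tendstoD(2)) auto
      then obtain k where k: "I (?q k) < ennreal e" by (auto simp: eventually_sequentially)
      have "\<forall>\<^sub>F r in at_left 1. r \<in> {?q k<..<1}" by (rule eventually_at_leftI[of "?q k"]) auto
      then show "\<forall>\<^sub>F r in at_left 1. I r \<le> ennreal e"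
      proof eventually_elim
        case (elim r)
        have "B r \<subseteq> B (?q k)" using elim by (auto simp: B_def)
        then have "I r \<le> I (?q k)"
          unfolding I_def by (intro nn_integral_mono mult_left_mono) (auto simp: indicator_def)
        then show ?case using k by (simp add: order_trans less_imp_le)
      qed
    qed
    have "((\<lambda>r. ennreal C1 * (\<integral>\<^sup>+y. ennreal (radial_kernel t (1 - r) y) \<partial>m) + ennreal C2 * I r) \<longlongrightarrow>
        ennreal C1 * 0 + ennreal C2 * 0) (at_left 1)"
      by (intro tendsto_add ennreal_tendsto_cmult lim1 lim2) auto
    then have lim: "((\<lambda>r. ennreal C1 * (\<integral>\<^sup>+y. ennreal (radial_kernel t (1 - r) y) \<partial>m) + ennreal C2 * I r) \<longlongrightarrow> 0) (at_left 1)"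
      by simp
    have "\<forall>\<^sub>F r in at_left (1::real). r \<in> {1/2<..<1}" by (rule eventually_at_leftI[of "1/2"]) auto
    then have bd: "\<forall>\<^sub>F r in at_left 1. (\<integral>\<^sup>+y. green_function (r *\<^sub>R t) y \<partial>M) \<le>
        ennreal C1 * (\<integral>\<^sup>+y. ennreal (radial_kernel t (1 - r) y) \<partial>m) + ennreal C2 * I r"
    proof eventually_elim
      case r: (elim r)
      have mrk: "(\<lambda>y. ennreal (radial_kernel t (1 - r) y)) \<in> borel_measurable M"
        unfolding measurable_cong_sets[OF sM refl] by measurable
      have mlb: "(\<lambda>y. littlewood_kernel t y * indicator (B r) y) \<in> borel_measurable M"
        using mlk1 mB by (intro borel_measurable_times_ennreal borel_measurable_indicator)
      have "(\<integral>\<^sup>+y. green_function (r *\<^sub>R t) y \<partial>M) \<le> (\<integral>\<^sup>+y. ennreal C1 * (?w y * ennreal (radial_kernel t (1 - r) y)) +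
          ennreal C2 * (littlewood_kernel t y * indicator (B r) y) \<partial>M)"
      proof (rule nn_integral_mono_AE)
        show "AE y in M. green_function (r *\<^sub>R t) y \<le> ennreal C1 * (?w y * ennreal (radial_kernel t (1 - r) y)) +
          ennreal C2 * (littlewood_kernel t y * indicator (B r) y)"
          using ae
        proof eventually_elim
          case (elim y)
          show ?case unfolding B_def using \<open>norm t = 1\<close> elim r by (intro C12(3)) auto
        qed
      qed
      also have "\<dots> = (\<integral>\<^sup>+y. ennreal C1 * (?w y * ennreal (radial_kernel t (1 - r) y)) \<partial>M) + (\<integral>\<^sup>+y. ennreal C2 * (littlewood_kernel t y * indicator (B r) y) \<partial>M)"
        by (intro nn_integral_add borel_measurable_times_ennreal borel_measurable_const mw mrk mlb)
      also have "(\<integral>\<^sup>+y. ennreal C1 * (?w y * ennreal (radial_kernel t (1 - r) y)) \<partial>M) = ennreal C1 * (\<integral>\<^sup>+y. ?w y * ennreal (radial_kernel t (1 - r) y) \<partial>M)"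
        by (intro nn_integral_cmult borel_measurable_times_ennreal mw mrk)
      also have "(\<integral>\<^sup>+y. ?w y * ennreal (radial_kernel t (1 - r) y) \<partial>M) = (\<integral>\<^sup>+y. ennreal (radial_kernel t (1 - r) y) \<partial>m)"
        unfolding m_def by (rule nn_integral_density[OF mw mrk, symmetric])
      also have "(\<integral>\<^sup>+y. ennreal C2 * (littlewood_kernel t y * indicator (B r) y) \<partial>M) = ennreal C2 * I r"
        unfolding I_def by (intro nn_integral_cmult mlb)
      finally show ?case .
    qed
    show ?case by (rule tendsto_sandwich[OF _ bd tendsto_const lim]) simp
  qed
qed

subsection \<open>Transfer to the measures on the ball and the sphere\<close>

lemma sphere_measure_integral:
  fixes f :: "'a::euclidean_space \<Rightarrow> real"
  assumes "f \<in> borel_measurable borel"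
  shows "(\<integral>t. f t \<partial>sphere_measure) = (\<integral>t. f t \<partial>sphere_borel)"
    and "integrable sphere_measure f \<longleftrightarrow> integrable sphere_borel f"
  unfolding sphere_borel_def
  using assms by (simp_all add: integral_distr[OF measurable_ident_sphere_measure]
      integrable_distr_eq[OF measurable_ident_sphere_measure])

text \<open>P is arbitrary and its set of failures need not be measurable, so the transfer goes
  through a Borel null set that contains it.\<close>

lemma AE_sphere_measureI:
  assumes "AE t in (sphere_borel :: 'a::euclidean_space measure). P t"
  shows "AE t in sphere_measure. P t"
proof -
  obtain N where N: "{t. \<not> P t} \<subseteq> N" "N \<in> sets borel" "emeasure sphere_borel N = 0"
    using assms by (auto elim!: AE_E)
  have "AE t in sphere_borel. t \<notin> N" using N by (intro AE_not_in) (simp add: null_sets_def)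
  then have "AE t in sphere_measure. t \<notin> N"
    unfolding sphere_borel_def by (subst (asm) AE_distr_iff[OF measurable_ident_sphere_measure]) (use N in auto)
  then show ?thesis by eventually_elim (use N in auto)
qed

text \<open>Measurability on the sphere says nothing about the values elsewhere; extension by 0
  gives a Borel function on the whole space.\<close>

lemma sphere_measure_function_extension:
  fixes f :: "'a::euclidean_space \<Rightarrow> real"
  assumes "integrable sphere_measure f"
  shows "(\<lambda>t. indicator unit_sphere t * f t) \<in> borel_measurable borel"
    and "integrable sphere_borel (\<lambda>t. indicator unit_sphere t * f t)"
    and "AE t in sphere_measure. indicator unit_sphere t * f t = f t"
proof -
  have "f \<in> borel_measurable (restrict_space borel unit_sphere)"
    using borel_measurable_integrable[OF assms] unfolding measurable_cong_sets[OF sets_sphere_measure refl] .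
  then show m: "(\<lambda>t. indicator unit_sphere t * f t) \<in> borel_measurable borel"
    by (subst (asm) borel_measurable_restrict_space_iff) (auto simp: mult.commute)
  have eq: "indicator unit_sphere t * f t = f t" if "t \<in> space sphere_measure" for t
    using that by (simp add: space_sphere_measure)
  show "AE t in sphere_measure. indicator unit_sphere t * f t = f t" using eq by (rule AE_I2)
  have "integrable sphere_measure (\<lambda>t. indicator unit_sphere t * f t)"
    using assms eq by (subst Bochner_Integration.integrable_cong[OF refl]) auto
  then show "integrable sphere_borel (\<lambda>t. indicator unit_sphere t * f t)"
    using sphere_measure_integral(2)[OF m] by simp
qed

lemma has_bochner_integral_hyperbolic:
  fixes f :: "'a::euclidean_space \<Rightarrow> real"
  assumes m: "(\<lambda>x. f x * indicator unit_ball x) \<in> borel_measurable borel"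
    and f: "has_bochner_integral lborel (\<lambda>x. indicator unit_ball x * (f x / (1 - (norm x)\<^sup>2) ^ DIM('a))) (unit_ball_vol (DIM('a)) * c)"
  shows "has_bochner_integral hyperbolic_measure f c"
proof -
  let ?V = "unit_ball_vol (DIM('a))"
  let ?g = "\<lambda>x::'a. 1 / (?V * (1 - (norm x)\<^sup>2) ^ DIM('a))"
  have mf: "f \<in> borel_measurable (restrict_space lborel unit_ball)"
  proof (subst borel_measurable_restrict_space_iff)
    show "(\<lambda>x. indicator unit_ball x *\<^sub>R f x) \<in> borel_measurable lborel"
      unfolding measurable_lborel2
      by (rule back_subst[of "\<lambda>g. g \<in> borel_measurable borel", OF m]) (simp add: fun_eq_iff)
  qed simp
  have mg: "?g \<in> borel_measurable (restrict_space lborel unit_ball)"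
    by (intro measurable_restrict_space1) simp
  have g: "AE x in restrict_space lborel (unit_ball :: 'a set). 0 \<le> ?g x"
  proof (subst AE_restrict_space_iff)
    have "0 \<le> ?g x" if "norm x < 1" for x :: 'a
      using one_minus_norm_sq_pos[OF that] by (intro divide_nonneg_nonneg mult_nonneg_nonneg zero_le_power) auto
    then show "AE x in lborel. x \<in> unit_ball \<longrightarrow> 0 \<le> ?g (x :: 'a)" by (intro AE_I2) simp
  qed simp
  have "has_bochner_integral lborel (\<lambda>x. 1 / ?V * (indicator unit_ball x * (f x / (1 - (norm x)\<^sup>2) ^ DIM('a)))) (1 / ?V * (?V * c))"
    using f by (rule has_bochner_integral_mult_right)
  then have "has_bochner_integral lborel (\<lambda>x. indicator unit_ball x *\<^sub>R (?g x *\<^sub>R f x)) c"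
    by (simp add: ac_simps)
  then have "has_bochner_integral (restrict_space lborel unit_ball) (\<lambda>x. ?g x *\<^sub>R f x) c"
    by (subst has_bochner_integral_restrict_space) auto
  then show ?thesis
    unfolding hyperbolic_measure_eq_density by (rule has_bochner_integral_density[OF mf mg g])
qed

text \<open>Where the Green potential is infinite, \<open>u\<close> is \<open>- \<infinity>\<close>,
  so it lives in \<open>ereal\<close>. The weak equation integrates
  \<open>real_of_ereal (u x)\<close>, which would turn such values into 0; the first conjunct
  confines them to a null set, so that the equation is about u itself.\<close>

theorem theorem2p1:
  fixes \<mu> :: "'a::euclidean_space measure" and \<phi> :: "'a \<Rightarrow> real" and u :: "'a \<Rightarrow> ereal"
  assumes dim: "DIM('a) \<ge> 2"
    and \<mu>_borel: "sets \<mu> = sets (restrict_space borel unit_ball)"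
    and \<mu>_finite: "(\<integral>\<^sup>+y. ennreal ((1 - (norm y)\<^sup>2) ^ (DIM('a) - 1)) \<partial>\<mu>) < \<infinity>"
    and \<phi>_L1: "integrable sphere_measure \<phi>"
    and u_def: "\<And>x. u x = ereal (poisson_integral \<phi> x) - enn2ereal (green_potential \<mu> x)"
  shows "(AE x in hyperbolic_measure. \<bar>u x\<bar> \<noteq> \<infinity>) \<and>
         (\<forall>\<psi>\<in>C2c_ball. integrable \<mu> \<psi> \<and>
            has_bochner_integral hyperbolic_measure
              (\<lambda>x. real_of_ereal (u x) * hyperbolic_laplacian \<psi> x) (\<integral>y. \<psi> y \<partial>\<mu>)) \<and>
         (AE t in sphere_measure. ((\<lambda>r. u (r *\<^sub>R t)) \<longlongrightarrow> ereal (\<phi> t)) (at_left 1))"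
proof -
  let ?n = "DIM('a)" and ?V = "unit_ball_vol (DIM('a))"
  have id: "(\<lambda>x::'a. x) \<in> measurable \<mu> borel"
    unfolding measurable_cong_sets[OF \<mu>_borel refl] by (rule measurable_restrict_space1) measurable
  have sp: "space \<mu> = unit_ball" using sets_eq_imp_space_eq[OF \<mu>_borel] by (simp add: space_restrict_space)
  \<comment> \<open>As with surface measure, \<mu> is moved to the Borel sets of the whole space,
    where the complement of the ball is null.\<close>
  define M where "M = distr \<mu> borel (\<lambda>x. x)"
  have sM: "sets M = sets borel" by (simp add: M_def)
  have ae: "AE y in M. norm y < 1"
    unfolding M_def by (subst AE_distr_iff[OF id]) (auto simp: sp)
  have fin: "(\<integral>\<^sup>+y. ennreal ((1 - (norm y)\<^sup>2) ^ (?n - 1)) \<partial>M) < \<infinity>"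
    unfolding M_def using \<mu>_finite by (subst nn_integral_distr[OF id]) auto
  define G where "G x = (\<integral>\<^sup>+y. green_function x y \<partial>M)" for x
  have gp: "green_potential \<mu> x = G x" for x
    unfolding green_potential_def G_def M_def by (rule nn_integral_distr[OF id, symmetric]) measurable
  define f where "f t = indicator unit_sphere t * \<phi> t" for t
  note fp = sphere_measure_function_extension[OF \<phi>_L1, folded f_def]
  define P where "P x = (\<integral>t. poisson_kernel x t * f t \<partial>sphere_borel)" for x
  have pP: "poisson_integral \<phi> x = P x" for x
  proof -
    have "poisson_integral \<phi> x = (\<integral>t. poisson_kernel x t * f t \<partial>sphere_measure)"
      unfolding poisson_integral_def poisson_kernel_def
      by (rule Bochner_Integration.integral_cong[OF refl]) (simp add: f_def space_sphere_measure)
    also have "\<dots> = P x"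
    proof -
      have "(\<lambda>t. poisson_kernel x t * f t) \<in> borel_measurable borel"
        using fp(1) by (intro borel_measurable_times borel_measurable_poisson_kernel) auto
      then show ?thesis unfolding P_def by (rule sphere_measure_integral(1))
    qed
    finally show ?thesis .
  qed
  have u: "u x = ereal (P x) - enn2ereal (G x)" for x by (simp add: u_def gp pP)
  \<comment> \<open>The first branch is the default of \<open>real_of_ereal\<close> at
    \<open>- \<infinity>\<close>; at almost every point of the ball the second one holds.\<close>
  have real_u: "real_of_ereal (u x) = (if G x = \<infinity> then 0 else P x - enn2real (G x))" for x
    unfolding u by (cases "G x") (auto simp: enn2ereal_ennreal)
  interpret M: sigma_finite_measure M by (rule sigma_finite_weighted[OF sM ae fin])
  interpret S: prob_space "sphere_borel :: 'a measure" by (rule prob_space_sphere_borel)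
  have mG: "G \<in> borel_measurable borel"
  proof -
    have "(\<lambda>p. green_function (fst p) (snd p)) \<in> borel_measurable (borel \<Otimes>\<^sub>M (borel :: 'a measure))"
      by (intro borel_measurable_green_function) auto
    then have "(\<lambda>(x, y). green_function x y) \<in> borel_measurable (borel \<Otimes>\<^sub>M M)"
      by (simp add: case_prod_unfold measurable_cong_sets[OF sets_pair_measure_cong[OF refl sM] refl])
    from M.borel_measurable_nn_integral_fst[OF this] show ?thesis by (simp add: G_def[abs_def])
  qed
  have mP: "P \<in> borel_measurable borel"
  proof -
    have "(\<lambda>p. poisson_kernel (fst p) (snd p) * f (snd p)) \<in> borel_measurable (borel \<Otimes>\<^sub>M (borel :: 'a measure))"
      by (intro borel_measurable_times borel_measurable_poisson_kernel measurable_compose[OF measurable_snd fp(1)]) auto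
    then have "(\<lambda>(x, t). poisson_kernel x t * f t) \<in> borel_measurable (borel \<Otimes>\<^sub>M sphere_borel)"
      by (simp add: case_prod_unfold measurable_cong_sets[OF sets_pair_measure_cong[OF refl sets_sphere_borel] refl])
    from S.borel_measurable_lebesgue_integral[OF this] show ?thesis by (simp add: P_def[abs_def])
  qed
  have mu: "(\<lambda>x. real_of_ereal (u x)) \<in> borel_measurable borel"
    unfolding real_u using mP mG by measurable
  have finG: "AE x in lborel. norm x < 1 \<longrightarrow> G x \<noteq> \<infinity>"
    unfolding G_def by (rule AE_green_potential_finite[OF dim sM ae fin])
  have part1: "AE x in hyperbolic_measure. \<bar>u x\<bar> \<noteq> \<infinity>"
  proof -
    have *: "\<bar>u x\<bar> \<noteq> \<infinity>" if "G x \<noteq> \<infinity>" for x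
      unfolding u using that by (cases "G x") (auto simp: enn2ereal_ennreal)
    have "AE x in lborel. x \<in> unit_ball \<longrightarrow> \<bar>u x\<bar> \<noteq> \<infinity>"
      using finG by eventually_elim (rule impI, rule *, simp)
    then have "AE x in restrict_space lborel unit_ball. \<bar>u x\<bar> \<noteq> \<infinity>"
      by (subst AE_restrict_space_iff) simp_all
    then have "AE x in restrict_space lborel unit_ball.
        0 < ennreal (1 / (?V * (1 - (norm x)\<^sup>2) ^ ?n)) \<longrightarrow> \<bar>u x\<bar> \<noteq> \<infinity>"
      by eventually_elim blast
    then show ?thesis
      unfolding hyperbolic_measure_eq_density
      by (subst AE_density) (simp_all add: measurable_restrict_space1)
  qed
  have part2: "integrable \<mu> \<psi> \<and> has_bochner_integral hyperbolic_measure
      (\<lambda>x. real_of_ereal (u x) * hyperbolic_laplacian \<psi> x) (\<integral>y. \<psi> y \<partial>\<mu>)" if psi: "\<psi> \<in> C2c_ball" for \<psi>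
  proof -
    let ?L = "laplacian_density \<psi>"
    let ?g = "\<lambda>y. indicator unit_ball y * \<psi> y"
    note mpL = borel_measurable_C2c_ball[OF psi]
    note gw = green_potential_weak[OF dim sM ae fin psi]
    have cg: "?g y = \<psi> y" if "y \<in> space \<mu>" for y using that by (simp add: sp)
    have "integrable \<mu> ?g"
      using gw(1) unfolding M_def by (subst (asm) integrable_distr_eq[OF id]) (use mpL(1) in auto)
    then have 1: "integrable \<mu> \<psi>" using cg by (subst (asm) Bochner_Integration.integrable_cong[OF refl]) auto
    have I: "(\<integral>y. ?g y \<partial>M) = (\<integral>y. \<psi> y \<partial>\<mu>)"
    proof -
      have "(\<integral>y. ?g y \<partial>M) = (\<integral>y. ?g y \<partial>\<mu>)"
        unfolding M_def by (rule integral_distr[OF id]) (use mpL(1) in auto)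
      also have "\<dots> = (\<integral>y. \<psi> y \<partial>\<mu>)" by (rule Bochner_Integration.integral_cong[OF refl cg])
      finally show ?thesis .
    qed
    \<comment> \<open>The Poisson integral contributes 0, and the minus sign of the potential in u
      meets the minus sign of its weak identity.\<close>
    have "has_bochner_integral lborel (\<lambda>x. P x * ?L x - enn2real (G x) * ?L x) (0 - (- (?V * (\<integral>y. \<psi> y \<partial>\<mu>))))"
      using has_bochner_integral_diff[OF poisson_integral_weak[OF dim psi fp(2)] gw(2)]
      unfolding P_def G_def I .
    moreover have "AE x in lborel. P x * ?L x - enn2real (G x) * ?L x =
        indicator unit_ball x * (real_of_ereal (u x) * hyperbolic_laplacian \<psi> x / (1 - (norm x)\<^sup>2) ^ ?n)"
      using finG
    proof eventually_elim
      case (elim x)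
      then show ?case
        by (cases "norm x < 1") (simp_all add: laplacian_density_def real_u left_diff_distrib diff_divide_distrib)
    qed
    moreover have mL: "(\<lambda>x. real_of_ereal (u x) * hyperbolic_laplacian \<psi> x * indicator unit_ball x) \<in> borel_measurable borel"
    proof -
      have "(\<lambda>x. real_of_ereal (u x) * (?L x * (1 - (norm x)\<^sup>2) ^ ?n)) \<in> borel_measurable borel"
        using mu mpL(2) by (intro borel_measurable_times) auto
      moreover have "real_of_ereal (u x) * (?L x * (1 - (norm x)\<^sup>2) ^ ?n) =
          real_of_ereal (u x) * hyperbolic_laplacian \<psi> x * indicator unit_ball x" for x
        using one_minus_norm_sq_pos[of x] by (cases "norm x < 1") (simp_all add: laplacian_density_def)
      ultimately show ?thesis by simp
    qed
    moreover have "(\<lambda>x. indicator unit_ball x * (real_of_ereal (u x) * hyperbolic_laplacian \<psi> x / (1 - (norm x)\<^sup>2) ^ ?n)) \<in> borel_measurable lborel"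
    proof -
      have "(\<lambda>x. (real_of_ereal (u x) * hyperbolic_laplacian \<psi> x * indicator unit_ball x) / (1 - (norm x)\<^sup>2) ^ ?n) \<in> borel_measurable borel"
        using mL by (intro borel_measurable_divide) auto
      then show ?thesis by (simp add: ac_simps)
    qed
    ultimately have "has_bochner_integral lborel (\<lambda>x. indicator unit_ball x * (real_of_ereal (u x) * hyperbolic_laplacian \<psi> x / (1 - (norm x)\<^sup>2) ^ ?n))
        (?V * (\<integral>y. \<psi> y \<partial>\<mu>))"
      by (subst has_bochner_integral_cong_AE[symmetric]) (auto dest: has_bochner_integral_integrable borel_measurable_has_bochner_integral)
    from has_bochner_integral_hyperbolic[OF mL this] 1 show ?thesis by blast
  qed
  have part3: "AE t in sphere_measure. ((\<lambda>r. u (r *\<^sub>R t)) \<longlongrightarrow> ereal (\<phi> t)) (at_left 1)"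
  proof -
    have "AE t in sphere_measure. ((\<lambda>r. P (r *\<^sub>R t)) \<longlongrightarrow> f t) (at_left 1)"
      unfolding P_def by (rule AE_sphere_measureI[OF AE_poisson_integral_limit[OF dim fp(2)]])
    moreover have "AE t in sphere_measure. ((\<lambda>r. G (r *\<^sub>R t)) \<longlongrightarrow> 0) (at_left 1)"
      unfolding G_def by (rule AE_sphere_measureI[OF AE_green_potential_limit[OF dim sM ae fin]])
    ultimately show ?thesis
      using fp(3)
    proof eventually_elim
      case (elim t)
      \<comment> \<open>Both limits are finite, so subtraction in \<open>ereal\<close> is continuous
        there even if u is \<open>- \<infinity>\<close> at some points of the radius.\<close>
      have "((\<lambda>r. ereal (P (r *\<^sub>R t)) - enn2ereal (G (r *\<^sub>R t))) \<longlongrightarrow> ereal (f t) - enn2ereal 0) (at_left 1)"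
        by (intro tendsto_diff_ereal_general tendsto_enn2erealI elim(2)) (use elim(1) in \<open>auto simp: zero_ennreal.rep_eq\<close>)
      then show ?case using elim(3) by (simp add: u zero_ennreal.rep_eq)
    qed
  qed
  show ?thesis using part1 part2 part3 by blast
qed

end
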